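(* Let $k>1$ be a fixed integer, let $\theta>0$, and let $0<\alpha<\beta<1$ be irrational numbers that are linearly independent over $\mathbb{Q}$. For each $n$ equip $\mathfrak{S}_n$ with the Ewens distribution with parameter $\theta$, and let $$Y_{n,k} = \sum_{j=1}^n \frac{j^{k-1}\, C_j^{(n)}\,(\{j\alpha\}-\{j\beta\})}{n^{k-1}} .$$ Assume that the laws $\mathcal{L}(Y_{n,k})$ converge weakly, as $n\to\infty$, to a probability measure $\mu$. Then, as $n\to\infty$, each of the three sequences of random variables $Y_{n,k}^{\mathrm{tuple}}$, $Y_{n,k}^{\mathrm{set}}$ and $Y_{n,k}^{\mathrm{irrep}}$ converges in law to the same distribution $\mu$.
   Context: $\{x\}$ is the fractional part of $x$, $[n]=\{1,\dots,n\}$, and $\mathfrak{S}_n$ is the symmetric group on $[n]$. The Ewens distribution with parameter $\theta>0$ on $\mathfrak{S}_n$ is $\mathbb{P}(\sigma)=\theta^{K(\sigma)}/(\theta(\theta+1)\cdots(\theta+n-1))$, where $K(\sigma)$ is the total number of cycles of $\sigma$. $C_j^{(n)}(\sigma)$ is the number of cycles of $\sigma$ of length $j$. Representations: $\rho_{n,k}^{\mathrm{tuple}}$ is the permutation representation of $\mathfrak{S}_n$ on the vector space with basis indexed by the ordered $k$-tuples $(t_1,\dots,t_k)$ of distinct elements of $[n]$, with action $\sigma(t_1,\dots,t_k)=(\sigma(t_1),\dots,\sigma(t_k))$. $\rho_{n,k}^{\mathrm{set}}$ is the permutation representation on the vector space with basis indexed by the $k$-element subsets of $[n]$, with action $\sigma\{t_1,\dots,t_k\}=\{\sigma(t_1),\dots,\sigma(t_k)\}$.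 $\rho^{(n-k,1^k)}$ is the complex irreducible representation (Specht module) $S^{(n-k,1^k)}$ of $\mathfrak{S}_n$ indexed by the hook partition $(n-k,1,\dots,1)$ of $n$ with $k$ ones. All eigenvalues of these representations evaluated at $\sigma$ have the form $e^{2\pi i\phi}$ with $\phi\in[0,1)$; $\phi$ is called an eigenangle. $X_{n,k}^{\mathrm{tuple}}(\sigma)$, $X_{n,k}^{\mathrm{set}}(\sigma)$, $X_{n,k}^{\mathrm{irrep}}(\sigma)$ denote the number of eigenangles, counted with multiplicity, of $\rho_{n,k}^{\mathrm{tuple}}(\sigma)$, $\rho_{n,k}^{\mathrm{set}}(\sigma)$, $\rho^{(n-k,1^k)}(\sigma)$ respectively in the interval $(\alpha,\beta)$. With $\sigma$ Ewens distributed, $$Y_{n,k}^{\mathrm{tuple}}=\frac{X_{n,k}^{\mathrm{tuple}}-\mathbb{E}[X_{n,k}^{\mathrm{tuple}}]}{n^{k-1}},\quad Y_{n,k}^{\mathrm{set}}=k!\,\frac{X_{n,k}^{\mathrm{set}}-\mathbb{E}[X_{n,k}^{\mathrm{set}}]}{n^{k-1}},\quad Y_{n,k}^{\mathrm{irrep}}=k!\,\frac{X_{n,k}^{\mathrm{irrep}}-\mathbb{E}[X_{n,k}^{\mathrm{irrep}}]}{n^{k-1}}.$$ *)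

theory Defs
  imports
    "HOL-Probability.Probability"
    "HOL-Combinatorics.Permutations"
    "HOL-Combinatorics.Orbits"
    "HOL-Library.Function_Algebras"
begin

text \<open>Permutations of \<open>[n]\<close> are functions \<open>\<sigma> :: nat \<Rightarrow> nat\<close> with \<open>\<sigma> permutes {1..n}\<close>.\<close>

definition perm_cycles :: "nat \<Rightarrow> (nat \<Rightarrow> nat) \<Rightarrow> nat set set" where
  "perm_cycles n \<sigma> = orbit \<sigma> ` {1..n}"

definition num_cycles :: "nat \<Rightarrow> (nat \<Rightarrow> nat) \<Rightarrow> nat" where
  "num_cycles n \<sigma> = card (perm_cycles n \<sigma>)"

definition num_cycles_of_length :: "nat \<Rightarrow> nat \<Rightarrow> (nat \<Rightarrow> nat) \<Rightarrow> nat" where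
  "num_cycles_of_length n j \<sigma> = card {c \<in> perm_cycles n \<sigma>. card c = j}"

definition ewens :: "real \<Rightarrow> nat \<Rightarrow> (nat \<Rightarrow> nat) measure" where
  "ewens \<theta> n = point_measure {\<sigma>. \<sigma> permutes {1..n}}
     (\<lambda>\<sigma>. ennreal (\<theta> ^ num_cycles n \<sigma> / pochhammer \<theta> n))"

text \<open>All representation spaces are subspaces of complex function spaces \<open>'b \<Rightarrow> complex\<close>
  with pointwise operations.\<close>

global_interpretation cfun: vector_space "\<lambda>(c::complex) (f :: 'b \<Rightarrow> complex) x. c * f x"
  by unfold_locales (auto simp: fun_eq_iff algebra_simps)

global_interpretation real_over_rat: vector_space "\<lambda>(q::rat) (x::real). of_rat q * x"
  by unfold_locales (auto simp: algebra_simps of_rat_add of_rat_mult)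

text \<open>The vector space with basis \<open>B\<close> (for finite \<open>B\<close>); the basis vector of \<open>b \<in> B\<close> is the
  indicator function of \<open>b\<close>.\<close>

definition free_space :: "'b set \<Rightarrow> ('b \<Rightarrow> complex) set" where
  "free_space B = {f. \<forall>x. x \<notin> B \<longrightarrow> f x = 0}"

text \<open>The linear extension of the map \<open>a\<close> on basis elements: the coefficient of \<open>y\<close> in
  \<open>(\<Sum>x\<in>B. f x \<cdot> a x)\<close>.\<close>

definition linear_ext :: "'b set \<Rightarrow> ('b \<Rightarrow> 'b) \<Rightarrow> ('b \<Rightarrow> complex) \<Rightarrow> ('b \<Rightarrow> complex)" where
  "linear_ext B a f = (\<lambda>y. \<Sum>x\<in>{x \<in> B. a x = y}. f x)"

text \<open>Algebraic multiplicity of \<open>z\<close> as an eigenvalue of \<open>T\<close> on the finite-dimensional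
  \<open>T\<close>-invariant space \<open>V\<close>: the dimension of the generalized eigenspace.\<close>

definition eigenvalue_mult ::
    "('b \<Rightarrow> complex) set \<Rightarrow> (('b \<Rightarrow> complex) \<Rightarrow> ('b \<Rightarrow> complex)) \<Rightarrow> complex \<Rightarrow> nat" where
  "eigenvalue_mult V T z =
     cfun.dim {v \<in> V. \<exists>m. ((\<lambda>w x. T w x - z * w x) ^^ m) v = 0}"

definition eigenangles ::
    "('b \<Rightarrow> complex) set \<Rightarrow> (('b \<Rightarrow> complex) \<Rightarrow> ('b \<Rightarrow> complex)) \<Rightarrow> real set" where
  "eigenangles V T =
     {\<phi>. 0 \<le> \<phi> \<and> \<phi> < 1 \<and> (\<exists>v\<in>V. v \<noteq> 0 \<and> T v = (\<lambda>x. exp (2 * pi * \<i> * \<phi>) * v x))}"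

definition count_eigenangles ::
    "('b \<Rightarrow> complex) set \<Rightarrow> (('b \<Rightarrow> complex) \<Rightarrow> ('b \<Rightarrow> complex)) \<Rightarrow> real \<Rightarrow> real \<Rightarrow> nat" where
  "count_eigenangles V T \<alpha> \<beta> =
     (\<Sum>\<phi>\<in>eigenangles V T \<inter> {\<alpha><..<\<beta>}. eigenvalue_mult V T (exp (2 * pi * \<i> * \<phi>)))"

definition tuples :: "nat \<Rightarrow> nat \<Rightarrow> nat list set" where
  "tuples n k = {t. length t = k \<and> distinct t \<and> set t \<subseteq> {1..n}}"

definition ksubsets :: "nat \<Rightarrow> nat \<Rightarrow> nat set set" where
  "ksubsets n k = {A. A \<subseteq> {1..n} \<and> card A = k}"

definition rho_tuple :: "nat \<Rightarrow> nat \<Rightarrow> (nat \<Rightarrow> nat) \<Rightarrow> (nat list \<Rightarrow> complex) \<Rightarrow> (nat list \<Rightarrow> complex)" where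
  "rho_tuple n k \<sigma> = linear_ext (tuples n k) (map \<sigma>)"

definition rho_set :: "nat \<Rightarrow> nat \<Rightarrow> (nat \<Rightarrow> nat) \<Rightarrow> (nat set \<Rightarrow> complex) \<Rightarrow> (nat set \<Rightarrow> complex)" where
  "rho_set n k \<sigma> = linear_ext (ksubsets n k) (image \<sigma>)"

text \<open>Specht modules. A shape is the list \<open>la\<close> of its row lengths; boxes are \<open>(row, column)\<close>,
  numbered from 0. A tabloid (a tableau up to row equivalence) is encoded as the list of the
  sets of entries of its rows.\<close>

definition diagram :: "nat list \<Rightarrow> (nat \<times> nat) set" where
  "diagram la = {(i, j). i < length la \<and> j < la ! i}"

definition tableaux :: "nat list \<Rightarrow> (nat \<times> nat \<Rightarrow> nat) set" where
  "tableaux la = {t. bij_betw t (diagram la) {1..sum_list la}}"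

definition tabloid :: "nat list \<Rightarrow> (nat \<times> nat \<Rightarrow> nat) \<Rightarrow> nat set list" where
  "tabloid la t = map (\<lambda>i. {t (i, j) | j. (i, j) \<in> diagram la}) [0..<length la]"

definition tabloids :: "nat list \<Rightarrow> nat set list set" where
  "tabloids la = tabloid la ` tableaux la"

definition column_stabilizer :: "nat list \<Rightarrow> (nat \<times> nat \<Rightarrow> nat) \<Rightarrow> (nat \<Rightarrow> nat) set" where
  "column_stabilizer la t = {\<pi>. \<pi> permutes {1..sum_list la} \<and>
     (\<forall>j. \<pi> ` {t (i, j) | i. (i, j) \<in> diagram la} = {t (i, j) | i. (i, j) \<in> diagram la})}"

definition polytabloid :: "nat list \<Rightarrow> (nat \<times> nat \<Rightarrow> nat) \<Rightarrow> (nat set list \<Rightarrow> complex)" where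
  "polytabloid la t =
     (\<lambda>s. \<Sum>\<pi>\<in>column_stabilizer la t. of_int (sign \<pi>) * (if tabloid la (\<pi> \<circ> t) = s then 1 else 0))"

definition specht_module :: "nat list \<Rightarrow> (nat set list \<Rightarrow> complex) set" where
  "specht_module la = cfun.span (polytabloid la ` tableaux la)"

text \<open>The operator below acts on the whole permutation module on tabloids; it is used only on
  its invariant subspace \<open>specht_module la\<close>.\<close>

definition rho_specht ::
    "nat list \<Rightarrow> (nat \<Rightarrow> nat) \<Rightarrow> (nat set list \<Rightarrow> complex) \<Rightarrow> (nat set list \<Rightarrow> complex)" where
  "rho_specht la \<sigma> = linear_ext (tabloids la) (map (image \<sigma>))"

text \<open>A partition of \<open>n\<close> only if \<open>k < n\<close>; smaller \<open>n\<close> are irrelevant to limits as \<open>n \<rightarrow> \<infinity>\<close>.\<close>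

definition hook :: "nat \<Rightarrow> nat \<Rightarrow> nat list" where
  "hook n k = (n - k) # replicate k 1"

context
  fixes \<alpha> \<beta> :: real and n k :: nat
begin

definition X_tuple :: "(nat \<Rightarrow> nat) \<Rightarrow> real" where
  "X_tuple \<sigma> = count_eigenangles (free_space (tuples n k)) (rho_tuple n k \<sigma>) \<alpha> \<beta>"

definition X_set :: "(nat \<Rightarrow> nat) \<Rightarrow> real" where
  "X_set \<sigma> = count_eigenangles (free_space (ksubsets n k)) (rho_set n k \<sigma>) \<alpha> \<beta>"

definition X_irrep :: "(nat \<Rightarrow> nat) \<Rightarrow> real" where
  "X_irrep \<sigma> = count_eigenangles (specht_module (hook n k)) (rho_specht (hook n k) \<sigma>) \<alpha> \<beta>"

definition Y :: "(nat \<Rightarrow> nat) \<Rightarrow> real" where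
  "Y \<sigma> = (\<Sum>j=1..n. real j ^ (k - 1) * real (num_cycles_of_length n j \<sigma>)
              * (frac (real j * \<alpha>) - frac (real j * \<beta>)) / real n ^ (k - 1))"

end

definition Y_tuple :: "real \<Rightarrow> real \<Rightarrow> real \<Rightarrow> nat \<Rightarrow> nat \<Rightarrow> (nat \<Rightarrow> nat) \<Rightarrow> real" where
  "Y_tuple \<theta> \<alpha> \<beta> n k \<sigma> =
     (X_tuple \<alpha> \<beta> n k \<sigma> - (\<integral>\<tau>. X_tuple \<alpha> \<beta> n k \<tau> \<partial>ewens \<theta> n)) / real n ^ (k - 1)"

definition Y_set :: "real \<Rightarrow> real \<Rightarrow> real \<Rightarrow> nat \<Rightarrow> nat \<Rightarrow> (nat \<Rightarrow> nat) \<Rightarrow> real" where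
  "Y_set \<theta> \<alpha> \<beta> n k \<sigma> =
     fact k * ((X_set \<alpha> \<beta> n k \<sigma> - (\<integral>\<tau>. X_set \<alpha> \<beta> n k \<tau> \<partial>ewens \<theta> n)) / real n ^ (k - 1))"

definition Y_irrep :: "real \<Rightarrow> real \<Rightarrow> real \<Rightarrow> nat \<Rightarrow> nat \<Rightarrow> (nat \<Rightarrow> nat) \<Rightarrow> real" where
  "Y_irrep \<theta> \<alpha> \<beta> n k \<sigma> =
     fact k * ((X_irrep \<alpha> \<beta> n k \<sigma> - (\<integral>\<tau>. X_irrep \<alpha> \<beta> n k \<tau> \<partial>ewens \<theta> n)) / real n ^ (k - 1))"

end

theory Submission
  imports Defs
    "HOL-Analysis.Kronecker_Approximation_Theorem"
    "HOL-Combinatorics.Multiset_Permutations"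
begin

text \<open>A permutation of a finite set acts on an orbit of length \<open>L\<close> as a cyclic shift, so in the
permutation representation this orbit contributes each \<open>L\<close>-th root of unity once. As \<open>\<beta>\<close> is
irrational, exactly \<open>(\<beta> - \<alpha>) L + {L \<alpha>} - {L \<beta>}\<close> of these roots have their angle in \<open>(\<alpha>, \<beta>)\<close>. Charging
the orbit in equal shares to its points, the number of eigenangles on a basis \<open>B\<close> is the constant
\<open>(\<beta> - \<alpha>) |B|\<close> plus \<open>\<Sum>x\<in>B. h (L x) / L x\<close>, where \<open>L x\<close> is the period of \<open>x\<close> and
\<open>h j = {j \<alpha>} - {j \<beta>}\<close>. Centring removes the constant, and only the sum matters.

Consider all lists of length \<open>k\<close> whose entries lie on one cycle of length \<open>j\<close>, and
give each of them the value \<open>h j / j\<close>. Their total is \<open>j^(k-1) h j\<close> per cycle, hence \<open>n^(k-1) Y\<close>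
altogether. A list disagrees with this model only if it contains a bad pair of entries: equal ones, ones
on different cycles, or ones on the same cycle whose distance, multiplied by \<open>k!\<close>, is a multiple of the
cycle length. Up to a factor \<open>k!\<close> the period of a tuple, or of its set of entries, is at least the least
common multiple of the cycle lengths of the bad pair, so all such lists together contribute at most a constant times
\<open>n^(k-2) W\<close>, where \<open>W\<close> is the sum of \<open>1 / len x\<close> over all points plus the sum of \<open>1 / lcm (len x) (len y)\<close>
over all pairs on different cycles (\<open>list_sum_comparison\<close>). Sets are tuples up to order, which costs
the factor \<open>k!\<close>.

The polytabloid of a tableau of hook shape depends, up to sign, only on the set \<open>C\<close> of entries of its first
column, and it is the image of the boundary of the basis vector \<open>e_C\<close> of the exterior power
\<open>\<Lambda>^(k+1) \<complex>^n\<close> under the embedding of \<open>\<Lambda>^k \<complex>^n\<close> into functions of tabloids. The complex of exterior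
powers has an equivariant contracting homotopy. Hence the Specht module is the kernel of the boundary
on \<open>\<Lambda>^k \<complex>^n\<close> (\<open>specht_module_hook\<close>), and \<open>\<Lambda>^k\<close> is the sum of the modules for \<open>k\<close> and for \<open>k - 1\<close>, eigenspace
by eigenspace (\<open>dim_ext_eigenspace_split\<close>). On \<open>\<Lambda>^k\<close> the permutation acts on subsets with signs, and the sign
around an orbit is \<open>1\<close> unless the subset contains a bad pair; the module for \<open>k - 1\<close> is of lower order.

It remains to see that \<open>W\<close> has mean \<open>o(n)\<close> and that \<open>Y\<close> has mean \<open>o(1)\<close>. Building a permutation
of \<open>n + 1\<close> points from one of \<open>n\<close> points gives a recursion whose solution is the exact mean of any function of the
cycle lengths summed over cycles (\<open>ewens_cycle_sum_formula\<close>) or over pairs of cycles (\<open>ewens_pair_sum_formula\<close>). The length of the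
cycle through a given point has a law whose weights are monotone in the length and tend to \<open>0\<close> uniformly.
Averages of null sequences against it therefore tend to \<open>0\<close>, which handles \<open>W\<close>; and slowly varying weights
average the fractional parts of the multiples of an irrational number to \<open>1/2\<close>, which handles
\<open>Y\<close> (\<open>len_prob_equidistribution\<close>). So each normalised count differs from \<open>Y\<close> by a quantity whose mean absolute
value tends to \<open>0\<close>, and their characteristic functions have the same limit (\<open>weak_conv_ewens_perturb\<close>).\<close>

section \<open>Dimension counts in spaces of functions\<close>

lemma sum_fun_app: "(\<Sum>i\<in>I. f i) x = (\<Sum>i\<in>I. f i x)"
  by (induction I rule: infinite_finite_induct) auto

lemma subspace_free_space: "cfun.subspace (free_space B)"
  by (auto simp: cfun.subspace_def free_space_def)

text \<open>
  The evaluations at the points \<open>pt i\<close> are coordinates on \<open>V\<close> and the vectors \<open>b i\<close> are the dual basis.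
\<close>

lemma cfun_dim_dual_basis:
  fixes V :: "('b \<Rightarrow> complex) set"
  assumes V: "cfun.subspace V" and I: "finite I"
    and b: "\<And>i. i \<in> I \<Longrightarrow> b i \<in> V"
    and dual: "\<And>i j. i \<in> I \<Longrightarrow> j \<in> I \<Longrightarrow> b i (pt j) = (if i = j then 1 else 0)"
    and det: "\<And>f. f \<in> V \<Longrightarrow> (\<And>i. i \<in> I \<Longrightarrow> f (pt i) = 0) \<Longrightarrow> f = 0"
  shows "cfun.dim V = card I"
proof -
  have inj: "inj_on b I"
    by (rule inj_onI) (metis dual zero_neq_one)
  have "cfun.independent (b ` I)"
  proof (rule cfun.independent_if_scalars_zero)
    show "finite (b ` I)" using I by simp
  next
    fix u v assume z: "(\<Sum>x\<in>b ` I. (\<lambda>y. u x * x y)) = 0" and v: "v \<in> b ` I"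
    obtain j where j: "j \<in> I" "v = b j" using v by auto
    have "0 = (\<Sum>x\<in>b ` I. (\<lambda>y. u x * x y)) (pt j)" using z by (simp add: fun_eq_iff)
    also have "\<dots> = (\<Sum>x\<in>b ` I. u x * x (pt j))" by (simp add: sum_fun_app)
    also have "\<dots> = (\<Sum>i\<in>I. u (b i) * b i (pt j))" using inj by (simp add: sum.reindex)
    also have "\<dots> = (\<Sum>i\<in>I. if i = j then u (b j) else 0)"
      by (intro sum.cong) (auto simp: dual j)
    also have "\<dots> = u v" using j I by simp
    finally show "u v = 0" by simp
  qed
  moreover have "b ` I \<subseteq> V" using b by auto
  moreover have "V \<subseteq> cfun.span (b ` I)"
  proof
    fix f assume f: "f \<in> V"
    define g where "g = (\<Sum>i\<in>I. (\<lambda>y. f (pt i) * b i y))"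
    have gV: "g \<in> V" unfolding g_def
      by (intro cfun.subspace_sum[OF V] cfun.subspace_scale[OF V] b)
    have gs: "g \<in> cfun.span (b ` I)" unfolding g_def
      by (intro cfun.span_sum cfun.span_scale cfun.span_base imageI)
    have "f - g = 0"
    proof (rule det)
      show "f - g \<in> V" by (intro cfun.subspace_diff[OF V] f gV)
      fix j assume j: "j \<in> I"
      have "g (pt j) = (\<Sum>i\<in>I. f (pt i) * b i (pt j))" by (simp add: g_def sum_fun_app)
      also have "\<dots> = (\<Sum>i\<in>I. if i = j then f (pt j) else 0)"
        by (intro sum.cong) (auto simp: dual j)
      also have "\<dots> = f (pt j)" using j I by simp
      finally show "(f - g) (pt j) = 0" by simp
    qed
    then show "f \<in> cfun.span (b ` I)" using gs by simp
  qed
  ultimately have "cfun.dim V = card (b ` I)"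
    by (intro cfun.dim_unique) auto
  then show ?thesis using inj by (simp add: card_image)
qed

lemma free_space_subset_span:
  assumes "finite B"
  shows "free_space B \<subseteq> cfun.span ((\<lambda>b x. if x = b then 1 else 0) ` B)"
proof
  fix f :: "'a \<Rightarrow> complex" assume f: "f \<in> free_space B"
  have "f = (\<Sum>b\<in>B. (\<lambda>x. f b * (if x = b then 1 else 0)))"
  proof
    fix x
    have "(\<Sum>b\<in>B. (\<lambda>x. f b * (if x = b then 1 else 0))) x = (\<Sum>b\<in>B. if b = x then f x else 0)"
      by (auto simp: sum_fun_app intro!: sum.cong)
    also have "\<dots> = f x" using assms f by (simp add: free_space_def)
    finally show "f x = (\<Sum>b\<in>B. (\<lambda>x. f b * (if x = b then 1 else 0))) x" by simp
  qed
  also have "\<dots> \<in> cfun.span ((\<lambda>b x. if x = b then 1 else 0) ` B)"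
    by (intro cfun.span_sum cfun.span_scale cfun.span_base imageI)
  finally show "f \<in> cfun.span ((\<lambda>b x. if x = b then 1 else 0) ` B)" .
qed

lemma finite_basis_in_free_space:
  assumes "finite B" "S \<subseteq> free_space B" "cfun.independent S"
  shows "finite S"
  using cfun.independent_span_bound[of "(\<lambda>b x. if x = b then 1 else 0) ` B" S]
    free_space_subset_span[OF assms(1)] assms by auto

lemma cfun_dim_image:
  fixes \<Psi> :: "('b \<Rightarrow> complex) \<Rightarrow> ('c \<Rightarrow> complex)"
  assumes V: "cfun.subspace V"
    and add: "\<And>f g. \<Psi> (f + g) = \<Psi> f + \<Psi> g"
    and sc: "\<And>c f. \<Psi> (\<lambda>x. c * f x) = (\<lambda>x. c * \<Psi> f x)"
    and inj: "inj_on \<Psi> V"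
  shows "cfun.dim (\<Psi> ` V) = cfun.dim V"
proof -
  interpret vector_space_pair "\<lambda>(c::complex) (f :: 'b \<Rightarrow> complex) x. c * f x"
    "\<lambda>(c::complex) (f :: 'c \<Rightarrow> complex) x. c * f x" by unfold_locales
  have lin: "Vector_Spaces.linear (\<lambda>(c::complex) (f :: 'b \<Rightarrow> complex) x. c * f x)
    (\<lambda>(c::complex) (f :: 'c \<Rightarrow> complex) x. c * f x) \<Psi>"
    unfolding Vector_Spaces.linear_iff using add sc by (auto intro: cfun.vector_space_axioms)
  obtain B where B: "B \<subseteq> V" "cfun.independent B" "V \<subseteq> cfun.span B" "card B = cfun.dim V"
    using cfun.basis_exists by blast
  have sB: "cfun.span B = V" using B V by (simp add: cfun.span_subspace)
  have ind: "cfun.independent (\<Psi> ` B)"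
    using linear_independent_injective_image[OF lin B(2)] inj sB by simp
  have sp: "cfun.span (\<Psi> ` B) = \<Psi> ` V" using linear_span_image[OF lin, of B] sB by simp
  have "cfun.dim (\<Psi> ` V) = card (\<Psi> ` B)" using cfun.dim_span_eq_card_independent[OF ind] sp by simp
  also have "\<dots> = card B" using inj B(1) by (intro card_image) (auto intro: inj_on_subset)
  finally show ?thesis using B by simp
qed

text \<open>
  The dimension formula for a map with a linear section \<open>h\<close>: a basis of the kernel and the image under \<open>h\<close> of a
  basis of \<open>W\<close> together form a basis of \<open>V\<close>.
\<close>

lemma cfun_dim_split:
  fixes d :: "('b \<Rightarrow> complex) \<Rightarrow> ('c \<Rightarrow> complex)" and h :: "('c \<Rightarrow> complex) \<Rightarrow> ('b \<Rightarrow> complex)"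
  assumes B: "finite B" "V \<subseteq> free_space B" and C: "finite C" "W \<subseteq> free_space C"
    and V: "cfun.subspace V" and W: "cfun.subspace W"
    and dadd: "\<And>f g. d (f + g) = d f + d g" and dsc: "\<And>c f. d (\<lambda>x. c * f x) = (\<lambda>x. c * d f x)"
    and hadd: "\<And>f g. h (f + g) = h f + h g" and hsc: "\<And>c f. h (\<lambda>x. c * f x) = (\<lambda>x. c * h f x)"
    and dV: "\<And>f. f \<in> V \<Longrightarrow> d f \<in> W" and hW: "\<And>g. g \<in> W \<Longrightarrow> h g \<in> V"
    and dh: "\<And>g. g \<in> W \<Longrightarrow> d (h g) = g"
  shows "cfun.dim V = cfun.dim {f \<in> V. d f = 0} + cfun.dim W"
proof -
  let ?K = "{f \<in> V. d f = 0}"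
  interpret dl: Vector_Spaces.linear "\<lambda>(c::complex) (f :: 'b \<Rightarrow> complex) x. c * f x"
    "\<lambda>(c::complex) (f :: 'c \<Rightarrow> complex) x. c * f x" d
    unfolding Vector_Spaces.linear_iff using dadd dsc by (auto intro: cfun.vector_space_axioms)
  interpret hl: Vector_Spaces.linear "\<lambda>(c::complex) (f :: 'c \<Rightarrow> complex) x. c * f x"
    "\<lambda>(c::complex) (f :: 'b \<Rightarrow> complex) x. c * f x" h
    unfolding Vector_Spaces.linear_iff using hadd hsc by (auto intro: cfun.vector_space_axioms)
  have K: "cfun.subspace ?K" using V dl.add dl.scale dl.zero
    by (auto simp: cfun.subspace_def fun_eq_iff)
  obtain B1 where B1: "B1 \<subseteq> ?K" "cfun.independent B1" "?K \<subseteq> cfun.span B1" "card B1 = cfun.dim ?K"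
    using cfun.basis_exists by blast
  obtain B2 where B2: "B2 \<subseteq> W" "cfun.independent B2" "W \<subseteq> cfun.span B2" "card B2 = cfun.dim W"
    using cfun.basis_exists by blast
  have f1: "finite B1" using finite_basis_in_free_space[OF B(1) _ B1(2)] B1(1) B(2) by auto
  have f2: "finite B2" using finite_basis_in_free_space[OF C(1) _ B2(2)] B2(1) C(2) by auto
  have injh: "inj_on h B2" using dh B2(1) by (metis inj_onI subsetD)
  have d1: "d x = 0" if "x \<in> B1" for x using that B1 by auto
  have d2: "d (h x) = x" if "x \<in> B2" for x using that B2 dh by auto
  have nz: "x \<noteq> 0" if "x \<in> B2" for x using that B2(2) cfun.dependent_zero by blast
  have disj: "B1 \<inter> h ` B2 = {}" using d1 d2 nz by force
  have "cfun.independent (B1 \<union> h ` B2)"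
  proof (rule cfun.independent_if_scalars_zero)
    show "finite (B1 \<union> h ` B2)" using f1 f2 by simp
  next
    fix u v assume z: "(\<Sum>x\<in>B1 \<union> h ` B2. (\<lambda>y. u x * x y)) = 0" and v: "v \<in> B1 \<union> h ` B2"
    have z': "(\<Sum>x\<in>B1. (\<lambda>y. u x * x y)) + (\<Sum>x\<in>h ` B2. (\<lambda>y. u x * x y)) = 0"
      using z disj f1 f2 by (subst (asm) sum.union_disjoint) auto
    have "0 = d ((\<Sum>x\<in>B1. (\<lambda>y. u x * x y)) + (\<Sum>x\<in>h ` B2. (\<lambda>y. u x * x y)))"
      unfolding z' by (simp add: dl.zero)
    also have "\<dots> = (\<Sum>x\<in>B1. (\<lambda>y. u x * d x y)) + (\<Sum>x\<in>h ` B2. (\<lambda>y. u x * d x y))"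
      by (simp add: dl.add dl.sum dl.scale)
    also have "(\<Sum>x\<in>B1. (\<lambda>y. u x * d x y)) = 0" using d1 by (auto intro!: sum.neutral)
    also have "(\<Sum>x\<in>h ` B2. (\<lambda>y. u x * d x y)) = (\<Sum>x\<in>B2. (\<lambda>y. u (h x) * x y))"
      using injh d2 by (auto simp: sum.reindex intro!: sum.cong)
    finally have "(\<Sum>x\<in>B2. (\<lambda>y. u (h x) * x y)) = 0" by (metis add_0)
    then have u2: "u (h x) = 0" if "x \<in> B2" for x
      using cfun.independentD[OF B2(2) f2 subset_refl, of "\<lambda>x. u (h x)"] that by auto
    have "(\<Sum>x\<in>h ` B2. (\<lambda>y. u x * x y)) = 0" using u2 by (auto intro!: sum.neutral)
    then have "(\<Sum>x\<in>B1. (\<lambda>y. u x * x y)) = 0" using z' by simp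
    then have "u x = 0" if "x \<in> B1" for x
      using cfun.independentD[OF B1(2) f1 subset_refl, of u] that by auto
    then show "u v = 0" using v u2 by auto
  qed
  moreover have "V \<subseteq> cfun.span (B1 \<union> h ` B2)"
  proof
    fix f assume f: "f \<in> V"
    have a: "h (d f) \<in> cfun.span (B1 \<union> h ` B2)"
    proof -
      have "h (d f) \<in> h ` cfun.span B2" using B2(3) dV[OF f] by auto
      also have "\<dots> = cfun.span (h ` B2)" by (simp add: hl.span_image)
      also have "\<dots> \<subseteq> cfun.span (B1 \<union> h ` B2)" by (intro cfun.span_mono) auto
      finally show ?thesis .
    qed
    have "d (f - h (d f)) = 0" using dh[OF dV[OF f]] by (simp add: dl.diff)
    then have "f - h (d f) \<in> ?K" using cfun.subspace_diff[OF V f hW[OF dV[OF f]]] by auto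
    then have "f - h (d f) \<in> cfun.span (B1 \<union> h ` B2)"
      using B1(3) cfun.span_mono[of B1 "B1 \<union> h ` B2"] by blast
    from cfun.span_add[OF this a] show "f \<in> cfun.span (B1 \<union> h ` B2)" by simp
  qed
  moreover have "B1 \<union> h ` B2 \<subseteq> V" using B1 B2 hW by auto
  ultimately have "cfun.dim V = card (B1 \<union> h ` B2)" by (intro cfun.dim_unique) auto
  also have "\<dots> = card B1 + card B2" using disj f1 f2 injh by (simp add: card_Un_disjoint card_image)
  finally show ?thesis using B1 B2 by simp
qed

section \<open>Eigenangles of operators of finite order\<close>

definition eigenspace :: "('b \<Rightarrow> complex) set \<Rightarrow> (('b \<Rightarrow> complex) \<Rightarrow> ('b \<Rightarrow> complex)) \<Rightarrow> complex \<Rightarrow> ('b \<Rightarrow> complex) set" where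
  "eigenspace V T z = {v \<in> V. T v = (\<lambda>x. z * v x)}"

definition e2pi :: "real \<Rightarrow> complex" where
  "e2pi \<phi> = exp (2 * pi * \<i> * \<phi>)"

lemma e2pi_power: "e2pi x ^ n = e2pi (real n * x)"
  by (simp add: e2pi_def mult_ac flip: exp_of_nat_mult)

lemma e2pi_nz [simp]: "e2pi x \<noteq> 0" by (simp add: e2pi_def)

lemma e2pi_eq_iff: "e2pi x = e2pi y \<longleftrightarrow> x - y \<in> \<int>"
proof -
  have "e2pi x = e2pi y \<longleftrightarrow> (\<exists>n::int. 2 * pi * \<i> * x = 2 * pi * \<i> * y + (of_int (2*n) * pi) * \<i>)"
    unfolding e2pi_def exp_eq by simp
  also have "\<dots> \<longleftrightarrow> (\<exists>n::int. x - y = of_int n)"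
  proof (rule ex_cong1)
    fix n :: int
    have "(2 * pi * \<i> * x = 2 * pi * \<i> * y + (of_int (2*n) * pi) * \<i>) \<longleftrightarrow>
      (2 * complex_of_real pi * \<i>) * complex_of_real x = (2 * complex_of_real pi * \<i>) * complex_of_real (y + of_int n)"
      by (simp add: algebra_simps)
    also have "\<dots> \<longleftrightarrow> complex_of_real x = complex_of_real (y + of_int n)"
      by (subst mult_cancel_left) simp
    also have "\<dots> \<longleftrightarrow> x = y + of_int n" by (rule of_real_eq_iff)
    finally show "(2 * pi * \<i> * x = 2 * pi * \<i> * y + (of_int (2*n) * pi) * \<i>) \<longleftrightarrow> x - y = of_int n"
      by auto
  qed
  also have "\<dots> \<longleftrightarrow> x - y \<in> \<int>" by (auto simp: Ints_def)
  finally show ?thesis .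
qed

lemma e2pi_0 [simp]: "e2pi 0 = 1" by (simp add: e2pi_def)

text \<open>
  An operator of finite order over the complex numbers is diagonalisable. If \<open>w = (T - z) v\<close> were a nonzero
  eigenvector, then \<open>T^m v = z^m v + m z^(m-1) w\<close>, and for \<open>m = N\<close> this contradicts \<open>T^N = 1\<close>, because \<open>z^N = 1\<close>
  and the second term does not vanish. So \<open>(T - z)^2 v = 0\<close>
  implies \<open>(T - z) v = 0\<close>, and the general exponent follows by induction.
\<close>

lemma generalized_eigenspace_finite_order:
  fixes T :: "('b \<Rightarrow> complex) \<Rightarrow> ('b \<Rightarrow> complex)"
  assumes V: "cfun.subspace V"
    and add: "\<And>f g. T (f + g) = T f + T g" and sc: "\<And>c f. T (\<lambda>x. c * f x) = (\<lambda>x. c * T f x)"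
    and TV: "\<And>f. f \<in> V \<Longrightarrow> T f \<in> V"
    and ord: "\<And>f. f \<in> V \<Longrightarrow> (T ^^ N) f = f" and N: "N > 0"
  shows "{v \<in> V. \<exists>m. ((\<lambda>w x. T w x - z * w x) ^^ m) v = 0} = eigenspace V T z"
proof -
  let ?D = "\<lambda>w x. T w x - z * w x"
  have DV: "?D f \<in> V" if "f \<in> V" for f
  proof -
    have "T f - (\<lambda>x. z * f x) \<in> V" using that by (intro cfun.subspace_diff[OF V] cfun.subspace_scale[OF V] TV)
    moreover have "T f - (\<lambda>x. z * f x) = ?D f" by (rule ext) simp
    ultimately show ?thesis by simp
  qed
  have D0: "?D 0 = 0"
  proof -
    have "T 0 = 0" using sc[of 0 0] by (simp add: zero_fun_def)
    then show ?thesis by (auto simp: fun_eq_iff)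
  qed
  have two: "?D v = 0" if v: "v \<in> V" and DD: "?D (?D v) = 0" for v
  proof (rule ccontr)
    assume "?D v \<noteq> 0"
    define w where "w = ?D v"
    obtain x where x: "w x \<noteq> 0" using \<open>?D v \<noteq> 0\<close> by (auto simp: w_def fun_eq_iff)
    have Tw: "T w = (\<lambda>x. z * w x)" 
    proof -
      have "?D w = 0" using DD by (simp only: w_def)
      then show ?thesis by (simp add: fun_eq_iff)
    qed
    have Tv: "T v = (\<lambda>x. z * v x) + w" unfolding w_def by (rule ext) simp
    have w: "(T ^^ m) w = (\<lambda>x. z ^ m * w x)" for m
    proof (induction m)
      case (Suc m)
      show ?case by (simp only: funpow.simps o_apply Suc sc Tw) (simp add: mult_ac)
    qed simp
    \<comment> \<open>multiplied by \<open>z\<close> to avoid the exponent \<open>m - 1\<close>\<close>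
    have v': "(\<lambda>x. z * (T ^^ m) v x) = (\<lambda>x. z ^ Suc m * v x) + (\<lambda>x. (of_nat m * z ^ m) * w x)" for m
    proof (induction m)
      case 0 then show ?case by (auto simp: fun_eq_iff)
    next
      case (Suc m)
      have "(\<lambda>x. z * (T ^^ Suc m) v x) = T (\<lambda>x. z * (T ^^ m) v x)" by (simp add: sc)
      also have "\<dots> = T (\<lambda>x. z ^ Suc m * v x) + T (\<lambda>x. (of_nat m * z ^ m) * w x)"
        unfolding Suc add by simp
      also have "\<dots> = (\<lambda>x. z ^ Suc m * T v x) + (\<lambda>x. (of_nat m * z ^ m) * T w x)" by (simp only: sc)
      also have "\<dots> = (\<lambda>x. z ^ Suc (Suc m) * v x) + (\<lambda>x. (of_nat (Suc m) * z ^ Suc m) * w x)"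
      proof
        fix x
        have "z ^ Suc m * (z * p + q) + of_nat m * z ^ m * (z * q) = z ^ Suc (Suc m) * p + of_nat (Suc m) * z ^ Suc m * q"
          for p q by (simp add: ring_distribs)
        then show "((\<lambda>x. z ^ Suc m * T v x) + (\<lambda>x. (of_nat m * z ^ m) * T w x)) x =
          ((\<lambda>x. z ^ Suc (Suc m) * v x) + (\<lambda>x. (of_nat (Suc m) * z ^ Suc m) * w x)) x"
          by (simp only: plus_fun_apply Tw Tv)
      qed
      finally show ?case .
    qed
    have "w \<in> V" unfolding w_def using DV[OF v] .
    then have "z ^ N * w x = w x" using fun_cong[OF w[of N], of x] ord[of w] by simp
    then have zN: "z ^ N = 1" using x by simp
    have "z * v x = z ^ Suc N * v x + of_nat N * z ^ N * w x"
      using fun_cong[OF v'[of N], of x] ord[OF v] by simp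
    then have "of_nat N * w x = 0" using zN by simp
    then show False using N x by simp
  qed
  have "?D v = 0" if "v \<in> V" "(?D ^^ m) v = 0" for v m using that
  proof (induction m arbitrary: v)
    case 0
    then have "v = 0" by (simp add: zero_fun_def)
    then show ?case using D0 by (simp only:)
  next
    case (Suc m)
    have IH1: "(?D ^^ m) (?D v) = 0" using Suc.prems(2) by (simp only: funpow_Suc_right o_apply)
    have "?D (?D v) = 0" by (rule Suc.IH[OF DV[OF Suc.prems(1)] IH1])
    then show ?case by (rule two[OF Suc.prems(1)])
  qed
  moreover have "?D v = 0 \<longleftrightarrow> T v = (\<lambda>x. z * v x)" for v by (auto simp: fun_eq_iff)
  moreover have "\<exists>m. (?D ^^ m) v = 0" if "?D v = 0" for v
    using that by (intro exI[of _ 1]) (simp only: One_nat_def funpow.simps o_apply id_apply)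
  ultimately show ?thesis unfolding eigenspace_def by blast
qed

lemma dim_zero_space: "cfun.dim {0} = 0"
  using cfun.dim_unique[of "{}" "{0}" 0] cfun.independent_empty by simp

text \<open>
  The eigenvalues of an operator of order dividing \<open>N\<close> are \<open>N\<close>-th roots of unity. Summing over all the
  angles \<open>j / N\<close> in the interval does not ask which of them are eigenangles, since the others have the zero
  eigenspace.
\<close>

lemma count_eigenangles_finite_order:
  fixes T :: "('b \<Rightarrow> complex) \<Rightarrow> ('b \<Rightarrow> complex)"
  assumes V: "cfun.subspace V"
    and add: "\<And>f g. T (f + g) = T f + T g" and sc: "\<And>c f. T (\<lambda>x. c * f x) = (\<lambda>x. c * T f x)"
    and TV: "\<And>f. f \<in> V \<Longrightarrow> T f \<in> V"
    and ord: "\<And>f. f \<in> V \<Longrightarrow> (T ^^ N) f = f" and N: "N > 0"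
  shows "count_eigenangles V T \<alpha> \<beta> =
    (\<Sum>j\<in>{j::nat. j < N \<and> \<alpha> < j / N \<and> j / N < \<beta>}. cfun.dim (eigenspace V T (e2pi (j / N))))"
proof -
  have mult: "eigenvalue_mult V T z = cfun.dim (eigenspace V T z)" for z
    unfolding eigenvalue_mult_def using generalized_eigenspace_finite_order[OF assms] by metis
  let ?\<Phi> = "(\<lambda>j. real j / real N) ` {..<N}"
  have sub: "eigenangles V T \<subseteq> ?\<Phi>"
  proof
    fix \<phi> assume "\<phi> \<in> eigenangles V T"
    then obtain v where p: "0 \<le> \<phi>" "\<phi> < 1" "v \<in> V" "v \<noteq> 0" "T v = (\<lambda>x. e2pi \<phi> * v x)"
      unfolding eigenangles_def e2pi_def by auto
    have "(T ^^ m) v = (\<lambda>x. e2pi \<phi> ^ m * v x)" for m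
    proof (induction m)
      case (Suc m)
      show ?case by (simp only: funpow.simps o_apply Suc sc p(5)) (simp add: mult_ac)
    qed simp
    then have "e2pi \<phi> ^ N * v x = v x" for x using ord[OF p(3)] by (metis (no_types))
    moreover obtain x where "v x \<noteq> 0" using p(4) by (auto simp: fun_eq_iff)
    ultimately have "e2pi \<phi> ^ N = 1" by (metis mult_cancel_right1)
    then have "e2pi (real N * \<phi>) = e2pi 0" by (simp add: e2pi_power)
    then obtain i :: int where i: "real N * \<phi> = of_int i" unfolding e2pi_eq_iff by (auto elim: Ints_cases)
    have "0 \<le> real_of_int i" "real_of_int i < real N" using p N unfolding i[symmetric] by auto
    then have "nat i < N" "real N * \<phi> = real (nat i)" using i by auto
    then show "\<phi> \<in> ?\<Phi>" using N by (intro image_eqI[of _ _ "nat i"]) (auto simp: field_simps)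
  qed
  have inj: "inj_on (\<lambda>j. real j / real N) A" for A using N by (auto intro: inj_onI)
  have zero: "cfun.dim (eigenspace V T (e2pi \<phi>)) = 0" if "\<phi> \<in> ?\<Phi> - eigenangles V T" for \<phi>
  proof -
    have "0 \<le> \<phi>" "\<phi> < 1" using that by auto
    then have "eigenspace V T (e2pi \<phi>) \<subseteq> {0}"
      using that unfolding eigenangles_def eigenspace_def e2pi_def by auto
    moreover have "0 \<in> eigenspace V T (e2pi \<phi>)"
    proof -
      have "T 0 = 0" using sc[of 0 0] by (simp add: zero_fun_def)
      then show ?thesis using cfun.subspace_0[OF V] by (auto simp: eigenspace_def fun_eq_iff)
    qed
    ultimately have "eigenspace V T (e2pi \<phi>) = {0}" by auto
    then show ?thesis by (simp only: dim_zero_space)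
  qed
  have "count_eigenangles V T \<alpha> \<beta> =
      (\<Sum>\<phi>\<in>eigenangles V T \<inter> {\<alpha><..<\<beta>}. cfun.dim (eigenspace V T (e2pi \<phi>)))"
    unfolding count_eigenangles_def mult e2pi_def ..
  also have "\<dots> = (\<Sum>\<phi>\<in>?\<Phi> \<inter> {\<alpha><..<\<beta>}. cfun.dim (eigenspace V T (e2pi \<phi>)))"
  proof (intro sum.mono_neutral_left ballI)
    fix \<phi> assume "\<phi> \<in> ?\<Phi> \<inter> {\<alpha><..<\<beta>} - eigenangles V T \<inter> {\<alpha><..<\<beta>}"
    then show "cfun.dim (eigenspace V T (e2pi \<phi>)) = 0" by (intro zero) blast
  qed (use sub in auto)
  also have "?\<Phi> \<inter> {\<alpha><..<\<beta>} = (\<lambda>j. real j / real N) ` {j::nat. j < N \<and> \<alpha> < j / N \<and> j / N < \<beta>}" by auto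
  finally show ?thesis by (simp only: sum.reindex[OF inj] o_def)
qed

lemma linear_ext_add: "linear_ext B a (f + g) = linear_ext B a f + linear_ext B a g"
  by (auto simp: linear_ext_def fun_eq_iff sum.distrib)

lemma linear_ext_scale: "linear_ext B a (\<lambda>x. c * f x) = (\<lambda>x. c * linear_ext B a f x)"
  by (auto simp: linear_ext_def fun_eq_iff sum_distrib_left)

lemma linear_ext_image:
  assumes "bij_betw a B B" "x \<in> B"
  shows "linear_ext B a f (a x) = f x"
proof -
  have "{y \<in> B. a y = a x} = {x}" using assms by (auto simp: bij_betw_def inj_on_def)
  then show ?thesis by (simp add: linear_ext_def)
qed

lemma linear_ext_outside:
  assumes "bij_betw a B B" "y \<notin> B"
  shows "linear_ext B a f y = 0"
proof -
  have "{x \<in> B. a x = y} = {}" using assms by (auto simp: bij_betw_def)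
  then show ?thesis unfolding linear_ext_def by (simp only: sum.empty)
qed

lemma linear_ext_funpow:
  assumes a: "bij_betw a B B" and ord: "\<And>x. x \<in> B \<Longrightarrow> (a ^^ N) x = x" and f: "f \<in> free_space B"
  shows "(linear_ext B a ^^ N) f = f"
proof -
  have aB: "(a ^^ m) x \<in> B" if "x \<in> B" for x m
    using that bij_betw_apply[OF a] by (induction m) auto
  have *: "(linear_ext B a ^^ m) f ((a ^^ m) x) = f x" if "x \<in> B" for x m
    using that by (induction m) (auto simp: linear_ext_image[OF a aB])
  have out: "(linear_ext B a ^^ m) f y = 0" if "y \<notin> B" for m y
    using that f by (cases m) (auto simp: linear_ext_outside[OF a] free_space_def)
  show ?thesis
  proof
    fix x show "(linear_ext B a ^^ N) f x = f x"
      using *[of x N] ord[of x] out[of x N] f by (cases "x \<in> B") (auto simp: free_space_def)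
  qed
qed

lemma linear_ext_eigenvector_iff:
  assumes a: "bij_betw a B B" and f: "f \<in> free_space B"
  shows "linear_ext B a f = (\<lambda>x. z * f x) \<longleftrightarrow> (\<forall>x\<in>B. f x = z * f (a x))"
proof
  assume "linear_ext B a f = (\<lambda>x. z * f x)"
  then show "\<forall>x\<in>B. f x = z * f (a x)" using linear_ext_image[OF a] by metis
next
  assume *: "\<forall>x\<in>B. f x = z * f (a x)"
  show "linear_ext B a f = (\<lambda>x. z * f x)"
  proof
    fix y
    show "linear_ext B a f y = z * f y"
    proof (cases "y \<in> B")
      case True
      then obtain x where "x \<in> B" "y = a x" using a by (auto simp: bij_betw_def)
      then show ?thesis using * linear_ext_image[OF a] by metis
    next
      case False
      then show ?thesis using linear_ext_outside[OF a False] f by (simp add: free_space_def)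
    qed
  qed
qed

text \<open>
  An orbit in the sense of \<open>orbit\<close> consists of the iterates with positive exponent; for a periodic point
  these include the point itself, and the size of the orbit is the least period.
\<close>

lemma orbit_period:
  assumes N: "(a ^^ N) x = x" "N > 0"
  shows "0 < card (orbit a x)"
    and "(a ^^ m) x = x \<longleftrightarrow> card (orbit a x) dvd m"
    and "orbit a x = (\<lambda>m. (a ^^ m) x) ` {..<card (orbit a x)}"
    and "inj_on (\<lambda>m. (a ^^ m) x) {..<card (orbit a x)}"
    and "x \<in> orbit a x"
proof -
  show self: "x \<in> orbit a x" using N unfolding orbit_altdef by force
  let ?p = "funpow_dist1 a x x"
  have inj: "inj_on (\<lambda>n. (a ^^ n) x) {0..<?p}" by (rule inj_on_funpow_dist1[OF self])
  have o: "orbit a x = (\<lambda>n. (a ^^ n) x) ` {0..<?p}" by (rule orbit_conv_funpow_dist1[OF self])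
  have p: "card (orbit a x) = ?p" unfolding o card_image[OF inj] by simp
  show "0 < card (orbit a x)" by (simp add: p)
  show "orbit a x = (\<lambda>m. (a ^^ m) x) ` {..<card (orbit a x)}" unfolding p using o by (simp add: atLeast0LessThan)
  show "inj_on (\<lambda>m. (a ^^ m) x) {..<card (orbit a x)}" unfolding p using inj by (simp add: atLeast0LessThan)
  have px: "(a ^^ ?p) x = x" by (rule funpow_dist1_prop[OF self])
  have "(a ^^ m) x = (a ^^ (m mod ?p)) x" using funpow_mod_eq[OF px, of m] by simp
  moreover have "(a ^^ (m mod ?p)) x = x \<longleftrightarrow> m mod ?p = 0"
    using funpow_dist1_least[of "m mod ?p" a x x] by (cases "m mod ?p = 0") auto
  ultimately show "(a ^^ m) x = x \<longleftrightarrow> card (orbit a x) dvd m" unfolding p by (simp add: dvd_eq_mod_eq_0)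
qed

lemma orbit_subset_invariant:
  assumes "x \<in> B" "\<And>y. y \<in> B \<Longrightarrow> a y \<in> B"
  shows "orbit a x \<subseteq> B"
proof
  fix y assume "y \<in> orbit a x" then show "y \<in> B" using assms by induction auto
qed

lemma prod_orbit:
  fixes \<epsilon> :: "'b \<Rightarrow> 'c::comm_monoid_mult"
  assumes "(a ^^ N) x = x" "N > 0"
  shows "(\<Prod>y\<in>orbit a x. \<epsilon> y) = (\<Prod>i<card (orbit a x). \<epsilon> ((a ^^ i) x))"
  by (subst orbit_period(3)[OF assms]) (simp add: prod.reindex orbit_period(4)[OF assms])

lemma orbit_eq_of_mem:
  assumes "(a ^^ N) x = x" "N > 0" "y \<in> orbit a x"
  shows "orbit a y = orbit a x"
proof -
  have s: "x \<in> orbit a x" by (rule orbit_period(5)[OF assms(1,2)])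
  then have "x \<in> orbit a y" using assms(3) by (rule orbit_swap)
  then show ?thesis using orbit_trans[OF _ assms(3)] orbit_trans[of _ a x y] by (intro equalityI subsetI)
qed

text \<open>
  The \<open>z\<close>-eigenspace of the signed permutation that sends the basis vector of \<open>x\<close> to \<open>\<epsilon> x\<close> times the basis
  vector of \<open>a x\<close>. For \<open>\<epsilon> = 1\<close> this is the permutation representation, and
  for the sign of \<open>\<sigma>\<close> on subsets it is an exterior power.
\<close>

definition signed_eigenspace :: "'b set \<Rightarrow> ('b \<Rightarrow> 'b) \<Rightarrow> ('b \<Rightarrow> complex) \<Rightarrow> complex \<Rightarrow> ('b \<Rightarrow> complex) set" where
  "signed_eigenspace B a \<epsilon> z = {f \<in> free_space B. \<forall>x\<in>B. \<epsilon> x * f x = z * f (a x)}"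

lemma subspace_signed_eigenspace:
  assumes "\<And>x. x \<in> B \<Longrightarrow> a x \<in> B"
  shows "cfun.subspace (signed_eigenspace B a \<epsilon> z)"
  unfolding cfun.subspace_def signed_eigenspace_def free_space_def
  by (auto simp: algebra_simps)

text \<open>
  An eigenvector is determined on an orbit \<open>Q\<close> by its value at one point, and going once around the orbit gives
  the condition that the product of the signs equals \<open>z ^ card Q\<close>. The dual basis consists of one function for
  each admissible orbit, normalised at a chosen point \<open>r Q\<close>.
\<close>

lemma dim_signed_eigenspace:
  assumes fin: "finite B" and aB: "\<And>x. x \<in> B \<Longrightarrow> a x \<in> B"
    and N: "\<And>x. x \<in> B \<Longrightarrow> (a ^^ N) x = x" "N > 0" and z: "z \<noteq> 0"
  shows "cfun.dim (signed_eigenspace B a \<epsilon> z) = card {Q \<in> orbit a ` B. (\<Prod>y\<in>Q. \<epsilon> y) = z ^ card Q}"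
proof -
  define I where "I = {Q \<in> orbit a ` B. (\<Prod>y\<in>Q. \<epsilon> y) = z ^ card Q}"
  define r where "r Q = (SOME x. x \<in> B \<and> orbit a x = Q)" for Q
  have r: "r Q \<in> B \<and> orbit a (r Q) = Q" if "Q \<in> orbit a ` B" for Q
    unfolding r_def by (rule someI_ex) (use that in auto)
  \<comment> \<open>the position of a point of the orbit relative to the chosen point \<open>r Q\<close>\<close>
  define m where "m Q = inv_into {..<card Q} (\<lambda>m. (a ^^ m) (r Q))" for Q
  \<comment> \<open>solving \<open>\<epsilon> x * f x = z * f (a x)\<close> along the orbit from \<open>f (r Q) = 1\<close>\<close>
  define b where "b Q y = (if y \<in> Q then (\<Prod>i<m Q y. \<epsilon> ((a ^^ i) (r Q))) / z ^ m Q y else 0)" for Q y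
  note period_facts = orbit_period[OF N]
  have m: "m Q ((a ^^ i) (r Q)) = i" if "Q \<in> orbit a ` B" "i < card Q" for Q i
    unfolding m_def using period_facts(4)[of "r Q"] r[OF that(1)] that(2) by (intro inv_into_f_f) auto
  have rm: "\<exists>i<card Q. y = (a ^^ i) (r Q)" if "Q \<in> orbit a ` B" "y \<in> Q" for Q y
    using period_facts(3)[of "r Q"] r[OF that(1)] that(2) by auto
  have c0: "0 < card Q" if "Q \<in> orbit a ` B" for Q using period_facts(1) that by auto
  have rO: "r Q \<in> Q" if "Q \<in> orbit a ` B" for Q using period_facts(5)[of "r Q"] r[OF that] by simp
  have br: "b Q (r Q) = 1" if "Q \<in> orbit a ` B" for Q
    using m[OF that, of 0] c0[OF that] rO[OF that] by (simp add: b_def)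
  have aO: "a x \<in> Q \<longleftrightarrow> x \<in> Q" if "Q \<in> orbit a ` B" "x \<in> B" for Q x
  proof -
    have "orbit a (a x) = orbit a x" using period_facts(5)[OF that(2)] by (rule self_in_orbit_step)
    then have "x \<in> orbit a (a x)" "a x \<in> orbit a x" using period_facts(5)[OF that(2)] by (auto intro: orbit.base)
    then show ?thesis using that(1) orbit_trans[of "a x" a x] orbit_trans[of x a "a x"] orbit_trans by fast
  qed
  have prodO: "(\<Prod>y\<in>Q. \<epsilon> y) = (\<Prod>i<card Q. \<epsilon> ((a ^^ i) (r Q)))" if "Q \<in> orbit a ` B" for Q
    using prod_orbit[OF N, of "r Q" \<epsilon>] r[OF that] by auto
  have OB: "Q \<subseteq> B" if "Q \<in> orbit a ` B" for Q using that orbit_subset_invariant[of _ B a] aB by blast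
  have "cfun.dim (signed_eigenspace B a \<epsilon> z) = card I"
  proof (rule cfun_dim_dual_basis[where b = b and pt = r])
    show "cfun.subspace (signed_eigenspace B a \<epsilon> z)" using aB by (rule subspace_signed_eigenspace)
    show "finite I" using fin by (simp add: I_def)
  next
    fix Q assume Q: "Q \<in> I"
    then have Q': "Q \<in> orbit a ` B" and adm: "(\<Prod>i<card Q. \<epsilon> ((a ^^ i) (r Q))) = z ^ card Q"
      using prodO[of Q] by (auto simp: I_def)
    have "\<epsilon> x * b Q x = z * b Q (a x)" if x: "x \<in> B" for x
    proof (cases "x \<in> Q")
      case False then show ?thesis using aO[OF Q' x] by (simp add: b_def)
    next
      case True
      then obtain i where i: "i < card Q" "x = (a ^^ i) (r Q)" using rm[OF Q'] by blast
      have ax: "a x = (a ^^ Suc i) (r Q)" using i by simp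
      have axO: "a x \<in> Q" using aO[OF Q' x] True by simp
      have mx: "m Q x = i" using m[OF Q' i(1)] i(2) by simp
      show ?thesis
      proof (cases "Suc i < card Q")
        case True
        then have "m Q (a x) = Suc i" using m[OF Q' True] ax by simp
        then show ?thesis using mx axO \<open>x \<in> Q\<close> z i by (simp add: b_def field_simps)
      next
        case False
        then have c: "card Q = Suc i" using i by simp
        then have "a x = r Q" using period_facts(2)[of "r Q" "card Q"] r[OF Q'] ax by simp
        then have "b Q (a x) = 1" using br[OF Q'] by simp
        moreover have "\<epsilon> x * b Q x = (\<Prod>i<card Q. \<epsilon> ((a ^^ i) (r Q))) / z ^ i"
          using \<open>x \<in> Q\<close> mx i c by (simp add: b_def)
        ultimately show ?thesis using adm c z by simp
      qed
    qed
    moreover have "b Q \<in> free_space B" using OB[OF Q'] by (auto simp: free_space_def b_def)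
    ultimately show "b Q \<in> signed_eigenspace B a \<epsilon> z" by (simp add: signed_eigenspace_def)
  next
    fix Q Q' assume Q: "Q \<in> I" "Q' \<in> I"
    show "b Q (r Q') = (if Q = Q' then 1 else 0)"
    proof (cases "Q = Q'")
      case True then show ?thesis using br Q by (auto simp: I_def)
    next
      case False
      have "r Q' \<notin> Q"
      proof
        assume "r Q' \<in> Q"
        then have "orbit a (r Q') = orbit a (r Q)"
          using orbit_eq_of_mem[OF N(1) N(2), of "r Q" "r Q'"] r Q by (auto simp: I_def)
        then show False using r Q False by (auto simp: I_def)
      qed
      then show ?thesis using False by (simp add: b_def)
    qed
  next
    fix f assume f: "f \<in> signed_eigenspace B a \<epsilon> z" and f0: "\<And>Q. Q \<in> I \<Longrightarrow> f (r Q) = 0"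
    have fB: "f x = 0" if "x \<notin> B" for x using f that by (simp add: signed_eigenspace_def free_space_def)
    have am: "(a ^^ k) x \<in> B" if "x \<in> B" for x k using that aB by (induction k) auto
    have step: "z ^ k * f ((a ^^ k) x) = (\<Prod>i<k. \<epsilon> ((a ^^ i) x)) * f x" if x: "x \<in> B" for x k
    proof (induction k)
      case (Suc k)
      have "z ^ Suc k * f ((a ^^ Suc k) x) = z ^ k * (z * f (a ((a ^^ k) x)))" by simp
      also have "z * f (a ((a ^^ k) x)) = \<epsilon> ((a ^^ k) x) * f ((a ^^ k) x)"
        using f am[OF x, of k] by (simp add: signed_eigenspace_def)
      also have "z ^ k * (\<epsilon> ((a ^^ k) x) * f ((a ^^ k) x)) = \<epsilon> ((a ^^ k) x) * (z ^ k * f ((a ^^ k) x))"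
        by (simp only: mult_ac)
      finally show ?case unfolding Suc by simp
    qed simp
    show "f = 0"
    proof
      fix y
      show "f y = 0 y"
      proof (cases "y \<in> B")
        case True
        let ?Q = "orbit a y"
        have Q: "?Q \<in> orbit a ` B" using True by simp
        have "f (r ?Q) = 0"
        proof (cases "?Q \<in> I")
          case False
          then have ne: "(\<Prod>i<card ?Q. \<epsilon> ((a ^^ i) (r ?Q))) \<noteq> z ^ card ?Q"
            using Q prodO[OF Q] by (auto simp: I_def)
          have "(a ^^ card ?Q) (r ?Q) = r ?Q" using period_facts(2)[of "r ?Q" "card ?Q"] r[OF Q] by simp
          then have "z ^ card ?Q * f (r ?Q) = (\<Prod>i<card ?Q. \<epsilon> ((a ^^ i) (r ?Q))) * f (r ?Q)"
            using step[of "r ?Q" "card ?Q"] r[OF Q] by simp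
          then show ?thesis using ne by simp
        qed (rule f0)
        moreover obtain i where "y = (a ^^ i) (r ?Q)" using rm[OF Q] period_facts(5)[OF True] by blast
        ultimately have "z ^ i * f y = 0" using step[of "r ?Q" i] r[OF Q] by simp
        then show ?thesis using z by simp
      qed (simp add: fB)
    qed
  qed
  then show ?thesis by (simp add: I_def)
qed

lemma sum_orbits:
  fixes g :: "'b set \<Rightarrow> real"
  assumes fin: "finite B" and aB: "\<And>x. x \<in> B \<Longrightarrow> a x \<in> B"
    and N: "\<And>x. x \<in> B \<Longrightarrow> (a ^^ N) x = x" "N > 0"
  shows "(\<Sum>Q\<in>orbit a ` B. g Q) = (\<Sum>x\<in>B. g (orbit a x) / card (orbit a x))"
proof -
  have "(\<Sum>x\<in>B. g (orbit a x) / card (orbit a x)) =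
    (\<Sum>Q\<in>orbit a ` B. \<Sum>x | x \<in> B \<and> orbit a x = Q. g (orbit a x) / card (orbit a x))"
    by (rule sum.image_gen[OF fin])
  also have "\<dots> = (\<Sum>Q\<in>orbit a ` B. g Q)"
  proof (rule sum.cong[OF refl])
    fix Q assume "Q \<in> orbit a ` B"
    then obtain x where x: "x \<in> B" "Q = orbit a x" by auto
    have "{y. y \<in> B \<and> orbit a y = Q} = Q"
      using orbit_subset_invariant[OF x(1), of a] aB orbit_eq_of_mem[OF N(1) N(2), OF x(1)] x(2)
        orbit_period(5)[OF N] by auto
    then have "(\<Sum>x | x \<in> B \<and> orbit a x = Q. g (orbit a x) / card (orbit a x)) = (\<Sum>x\<in>Q. g Q / card Q)"
      by (intro sum.cong) auto
    also have "\<dots> = g Q" using orbit_period(1)[OF N, OF x(1)] x(2) by simp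
    finally show "(\<Sum>x | x \<in> B \<and> orbit a x = Q. g (orbit a x) / card (orbit a x)) = g Q" .
  qed
  finally show ?thesis by simp
qed

lemma card_ints_between:
  fixes x y :: real assumes "x < y"
  shows "real (card {i::int. x < i \<and> i < y}) = real_of_int (\<lceil>y\<rceil> - \<lfloor>x\<rfloor> - 1)"
proof -
  have "{i::int. x < i \<and> i < y} = {\<lfloor>x\<rfloor><..<\<lceil>y\<rceil>}"
    by (auto simp: floor_less_iff less_ceiling_iff)
  moreover have "\<lfloor>x\<rfloor> < \<lceil>y\<rceil>" using assms by linarith
  ultimately show ?thesis by simp
qed

text \<open>
  The solutions of \<open>e2pi (j / N) ^ L = e2pi \<psi>\<close> are the \<open>j\<close> for which \<open>j / M - \<psi>\<close> is an integer \<open>i\<close>, and then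
  \<open>j / N = (i + \<psi>) / L\<close>; this is a bijection between the two sets.
\<close>

lemma count_roots:
  fixes \<alpha> \<beta> \<psi> :: real and N L M :: nat
  assumes N: "N = L * M" "L > 0" "M > 0" and \<psi>: "\<psi> * M \<in> \<int>" and ab: "0 < \<alpha>" "\<alpha> < \<beta>" "\<beta> < 1"
  shows "card {j::nat. j < N \<and> \<alpha> < j / N \<and> j / N < \<beta> \<and> e2pi (j / N) ^ L = e2pi \<psi>} =
    card {i::int. L * \<alpha> - \<psi> < i \<and> i < L * \<beta> - \<psi>}"
proof (rule bij_betw_same_card[of "\<lambda>j. \<lfloor>real j / real M - \<psi>\<rfloor>"])
  obtain s :: int where s: "\<psi> * M = s" using \<psi> by (auto elim: Ints_cases)
  have eq: "e2pi (j / N) ^ L = e2pi \<psi> \<longleftrightarrow> j / M - \<psi> \<in> \<int>" for j :: nat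
    unfolding e2pi_power e2pi_eq_iff using N by simp
  have fl: "real_of_int \<lfloor>j / M - \<psi>\<rfloor> = j / M - \<psi>" if "j / M - \<psi> \<in> \<int>" for j :: nat
    using that by (auto elim!: Ints_cases)
  show "bij_betw (\<lambda>j. \<lfloor>real j / real M - \<psi>\<rfloor>)
    {j::nat. j < N \<and> \<alpha> < j / N \<and> j / N < \<beta> \<and> e2pi (j / N) ^ L = e2pi \<psi>}
    {i::int. L * \<alpha> - \<psi> < i \<and> i < L * \<beta> - \<psi>}"
  proof (rule bij_betwI')
    fix x y :: nat
    assume "x \<in> {j::nat. j < N \<and> \<alpha> < j / N \<and> j / N < \<beta> \<and> e2pi (j / N) ^ L = e2pi \<psi>}"
      "y \<in> {j::nat. j < N \<and> \<alpha> < j / N \<and> j / N < \<beta> \<and> e2pi (j / N) ^ L = e2pi \<psi>}"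
    then have "real_of_int \<lfloor>x / M - \<psi>\<rfloor> = x / M - \<psi>" "real_of_int \<lfloor>y / M - \<psi>\<rfloor> = y / M - \<psi>"
      using fl eq by auto
    then have "\<lfloor>x / M - \<psi>\<rfloor> = \<lfloor>y / M - \<psi>\<rfloor> \<longleftrightarrow> real x / M = real y / M" by (metis diff_add_cancel)
    then show "(\<lfloor>x / M - \<psi>\<rfloor> = \<lfloor>y / M - \<psi>\<rfloor>) = (x = y)" using N by simp
  next
    fix j :: nat
    assume j: "j \<in> {j::nat. j < N \<and> \<alpha> < j / N \<and> j / N < \<beta> \<and> e2pi (j / N) ^ L = e2pi \<psi>}"
    then have f: "real_of_int \<lfloor>j / M - \<psi>\<rfloor> = j / M - \<psi>" using fl eq by auto
    have "L * \<alpha> < j / M" "j / M < L * \<beta>" using j N by (auto simp: field_simps)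
    then show "\<lfloor>j / M - \<psi>\<rfloor> \<in> {i::int. L * \<alpha> - \<psi> < i \<and> i < L * \<beta> - \<psi>}" using f by auto
  next
    fix i :: int assume i: "i \<in> {i::int. L * \<alpha> - \<psi> < i \<and> i < L * \<beta> - \<psi>}"
    \<comment> \<open>from \<open>j / M - \<psi> = i\<close>\<close>
    define j where "j = nat (i * M + s)"
    have "0 < L * \<alpha>" "L * \<beta> < L" using ab N by auto
    then have b: "0 < i + \<psi>" "i + \<psi> < L" using i by auto
    then have "0 < (i + \<psi>) * M" using N by simp
    then have "0 < real_of_int (i * M + s)" using s by (simp add: algebra_simps)
    then have "0 \<le> i * M + s" by linarith
    then have rj: "real j = i * M + s" unfolding j_def by simp
    then have rj': "real j = (i + \<psi>) * M" using s by (simp add: algebra_simps)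
    then have jM: "j / M - \<psi> = i" using N by (simp add: field_simps)
    have "(i + \<psi>) * M < L * M" using b N by simp
    then have "real j < real N" unfolding rj' N by simp
    moreover have "j / N = (i + \<psi>) / L" unfolding rj' N using N by simp
    moreover have "\<alpha> < (i + \<psi>) / L" "(i + \<psi>) / L < \<beta>" using i N by (auto simp: field_simps)
    moreover have "e2pi (j / N) ^ L = e2pi \<psi>" unfolding eq jM by simp
    ultimately have "j \<in> {j::nat. j < N \<and> \<alpha> < j / N \<and> j / N < \<beta> \<and> e2pi (j / N) ^ L = e2pi \<psi>}" by auto
    moreover have "i = \<lfloor>j / M - \<psi>\<rfloor>" using jM by simp
    ultimately show "\<exists>j\<in>{j::nat. j < N \<and> \<alpha> < j / N \<and> j / N < \<beta> \<and> e2pi (j / N) ^ L = e2pi \<psi>}. i = \<lfloor>j / M - \<psi>\<rfloor>"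
      by blast
  qed
qed

definition frac_diff :: "real \<Rightarrow> real \<Rightarrow> nat \<Rightarrow> real" where
  "frac_diff \<alpha> \<beta> j = frac (real j * \<alpha>) - frac (real j * \<beta>)"

lemma card_ints_between_approx:
  fixes x y :: real assumes "x < y"
  shows "\<bar>real (card {i::int. x < i \<and> i < y}) - (y - x)\<bar> \<le> 1"
  unfolding card_ints_between[OF assms] by linarith

text \<open>
  The irrationality of \<open>\<beta>\<close> ensures that \<open>L * \<beta>\<close> is not an integer, so that rounding up is rounding down plus one.
\<close>

lemma card_multiples_between:
  fixes \<alpha> \<beta> :: real and L :: nat
  assumes "L > 0" "\<alpha> < \<beta>" "\<beta> \<notin> \<rat>"
  shows "real (card {i::int. L * \<alpha> < i \<and> i < L * \<beta>}) = (\<beta> - \<alpha>) * L + frac_diff \<alpha> \<beta> L"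
proof -
  have "L * \<beta> \<notin> \<int>"
  proof
    assume "L * \<beta> \<in> \<int>"
    then have "L * \<beta> \<in> \<rat>" using Ints_subset_Rats by blast
    then have "(L * \<beta>) / L \<in> \<rat>" by (intro Rats_divide) auto
    then show False using assms by simp
  qed
  then have "\<lceil>L * \<beta>\<rceil> = \<lfloor>L * \<beta>\<rfloor> + 1" by (simp add: ceiling_altdef) (metis Ints_of_int)
  moreover have "L * \<alpha> < L * \<beta>" using assms by simp
  ultimately show ?thesis unfolding card_ints_between[OF \<open>L * \<alpha> < L * \<beta>\<close>] frac_diff_def frac_def
    by (simp add: algebra_simps)
qed

text \<open>
  An orbit of length \<open>L\<close> whose product of signs is \<open>e2pi \<psi>\<close> contributes the roots of \<open>z ^ L = e2pi \<psi>\<close>, hence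
  \<open>(\<beta> - \<alpha>) L\<close> up to an error of at most \<open>1\<close>, and the error is \<open>frac_diff \<alpha> \<beta> L\<close> if the product is \<open>1\<close>. Dividing by
  the length turns the sum over orbits into a sum over points. An orbit with product \<open>-1\<close> has eigenvalues whose order
  divides \<open>2 * L\<close> but not \<open>L\<close>, which is why the roots of order dividing \<open>2 * M\<close> are taken.
\<close>

lemma signed_eigenangle_count:
  fixes \<epsilon> :: "'b \<Rightarrow> complex" and \<alpha> \<beta> :: real and M :: nat
  assumes fin: "finite B" and aB: "\<And>x. x \<in> B \<Longrightarrow> a x \<in> B"
    and M: "\<And>x. x \<in> B \<Longrightarrow> (a ^^ M) x = x" "M > 0"
    and \<epsilon>: "\<And>x. x \<in> B \<Longrightarrow> \<epsilon> x = 1 \<or> \<epsilon> x = -1"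
    and ab: "0 < \<alpha>" "\<alpha> < \<beta>" "\<beta> < 1" "\<beta> \<notin> \<rat>"
  obtains \<eta> :: "'b \<Rightarrow> real" where "\<And>x. x \<in> B \<Longrightarrow> \<bar>\<eta> x\<bar> \<le> 1"
    "\<And>x. x \<in> B \<Longrightarrow> (\<Prod>y\<in>orbit a x. \<epsilon> y) = 1 \<Longrightarrow> \<eta> x = frac_diff \<alpha> \<beta> (card (orbit a x))"
    "(\<Sum>j\<in>{j::nat. j < 2 * M \<and> \<alpha> < j / (2 * M) \<and> j / (2 * M) < \<beta>}. real (cfun.dim (signed_eigenspace B a \<epsilon> (e2pi (j / (2 * M)))))) =
      (\<beta> - \<alpha>) * card B + (\<Sum>x\<in>B. \<eta> x / card (orbit a x))"
proof -
  define N where "N = 2 * M"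
  have N0: "N > 0" using M by (simp add: N_def)
  have N: "(a ^^ N) x = x" if "x \<in> B" for x
    using M(1)[OF that] by (simp add: N_def mult_2 funpow_add)
  let ?J = "{j::nat. j < N \<and> \<alpha> < j / N \<and> j / N < \<beta>}"
  let ?P = "\<lambda>Q. \<Prod>y\<in>Q. \<epsilon> y"
  define c where "c Q = card {j \<in> ?J. ?P Q = e2pi (j / N) ^ card Q}" for Q
  define \<eta> where "\<eta> x = c (orbit a x) - (\<beta> - \<alpha>) * card (orbit a x)" for x
  note period_facts = orbit_period[OF M]
  have P: "?P (orbit a x) = (1::complex) \<or> ?P (orbit a x) = -1" if "x \<in> B" for x
  proof -
    have *: "\<forall>y\<in>S. \<epsilon> y = 1 \<or> \<epsilon> y = -1 \<Longrightarrow> ?P S = 1 \<or> ?P S = -1" for S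
      by (induction S rule: infinite_finite_induct) auto
    have "orbit a x \<subseteq> B" using that aB by (rule orbit_subset_invariant)
    then show ?thesis using \<epsilon> by (intro *) auto
  qed
  have c: "c (orbit a x) = card {i::int. card (orbit a x) * \<alpha> - \<psi> < i \<and> i < card (orbit a x) * \<beta> - \<psi>}"
    if x: "x \<in> B" and \<psi>: "?P (orbit a x) = e2pi \<psi>" "2 * \<psi> \<in> \<int>" for x and \<psi> :: real
  proof -
    let ?L = "card (orbit a x)"
    have L0: "?L > 0" using period_facts(1)[OF x] .
    have "?L dvd M" using period_facts(2)[OF x] M(1)[OF x] by simp
    then obtain q where q: "M = ?L * q" by auto
    have q0: "q > 0" using M(2) q by (metis mult_0_right neq0_conv)
    have "N = ?L * (2 * q)" using q N_def by simp
    moreover have "\<psi> * real (2 * q) \<in> \<int>" using Ints_mult[OF \<psi>(2), of "of_nat q"] by (simp add: mult_ac)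
    ultimately have cr: "card {j::nat. j < N \<and> \<alpha> < j / N \<and> j / N < \<beta> \<and> e2pi (j / N) ^ ?L = e2pi \<psi>} =
        card {i::int. ?L * \<alpha> - \<psi> < i \<and> i < ?L * \<beta> - \<psi>}"
      using L0 q0 ab by (intro count_roots[where M = "2 * q"]) auto
    have "c (orbit a x) = card {j::nat. j < N \<and> \<alpha> < j / N \<and> j / N < \<beta> \<and> e2pi (j / N) ^ ?L = e2pi \<psi>}"
      unfolding c_def \<psi>(1) by (rule arg_cong[where f = card]) auto
    then show ?thesis unfolding cr .
  qed
  show ?thesis
  proof (rule that[of \<eta>])
    fix x assume x: "x \<in> B"
    have "e2pi (1/2) = -1" by (simp add: e2pi_def)
    then obtain \<psi> :: real where \<psi>: "?P (orbit a x) = e2pi \<psi>" "2 * \<psi> \<in> \<int>"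
    proof (cases "?P (orbit a x) = 1")
      case True then show ?thesis using that[of 0] by simp
    next
      case False then show ?thesis using that[of "1/2"] P[OF x] \<open>e2pi (1/2) = -1\<close> by simp
    qed
    have "card (orbit a x) * \<alpha> - \<psi> < card (orbit a x) * \<beta> - \<psi>" using period_facts(1)[OF x] ab by simp
    from card_ints_between_approx[OF this] show "\<bar>\<eta> x\<bar> \<le> 1"
      unfolding \<eta>_def c[OF x \<psi>] by (simp add: algebra_simps)
  next
    fix x assume x: "x \<in> B" and P1: "?P (orbit a x) = 1"
    let ?L = "card (orbit a x)"
    have L0: "?L > 0" using period_facts(1)[OF x] .
    have "real (c (orbit a x)) = (\<beta> - \<alpha>) * ?L + frac_diff \<alpha> \<beta> ?L"
      using c[OF x, of 0] P1 card_multiples_between[OF L0 ab(2,4)] by simp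
    then show "\<eta> x = frac_diff \<alpha> \<beta> ?L" unfolding \<eta>_def by simp
  next
    have "(\<Sum>j\<in>?J. real (cfun.dim (signed_eigenspace B a \<epsilon> (e2pi (j / N))))) =
       (\<Sum>j\<in>?J. \<Sum>Q\<in>orbit a ` B. if ?P Q = e2pi (j / N) ^ card Q then 1 else 0)"
      using fin by (intro sum.cong refl) (simp add: dim_signed_eigenspace[OF fin aB N N0] sum.If_cases Int_def)
    also have "\<dots> = (\<Sum>Q\<in>orbit a ` B. \<Sum>j\<in>?J. if ?P Q = e2pi (j / N) ^ card Q then 1 else 0)"
      by (rule sum.swap)
    also have "\<dots> = (\<Sum>Q\<in>orbit a ` B. real (c Q))"
      by (intro sum.cong refl) (simp add: c_def sum.If_cases Int_def)
    also have "\<dots> = (\<Sum>x\<in>B. c (orbit a x) / card (orbit a x))"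
      by (rule sum_orbits[OF fin aB M])
    also have "\<dots> = (\<Sum>x\<in>B. (\<beta> - \<alpha>) + \<eta> x / card (orbit a x))"
      using period_facts(1) by (intro sum.cong refl) (simp add: \<eta>_def field_simps)
    also have "\<dots> = (\<beta> - \<alpha>) * card B + (\<Sum>x\<in>B. \<eta> x / card (orbit a x))"
      by (simp add: sum.distrib)
    finally show "(\<Sum>j\<in>{j::nat. j < 2 * M \<and> \<alpha> < j / (2 * M) \<and> j / (2 * M) < \<beta>}. real (cfun.dim (signed_eigenspace B a \<epsilon> (e2pi (j / (2 * M)))))) =
      (\<beta> - \<alpha>) * card B + (\<Sum>x\<in>B. \<eta> x / card (orbit a x))" by (simp add: N_def)
  qed
qed

lemma bij_betw_of_funpow:
  assumes "\<And>x. x \<in> B \<Longrightarrow> a x \<in> B" "\<And>x. x \<in> B \<Longrightarrow> (a ^^ Suc M) x = x"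
  shows "bij_betw a B B"
proof (rule bij_betwI[of _ _ _ "a ^^ M"])
  have "(a ^^ m) x \<in> B" if "x \<in> B" for x m using that assms(1) by (induction m) auto
  then show "a ^^ M \<in> B \<rightarrow> B" by auto
  show "a \<in> B \<rightarrow> B" using assms(1) by auto
  fix x assume "x \<in> B"
  then show "(a ^^ M) (a x) = x" using assms(2)[of x] by (simp add: funpow_swap1)
  show "a ((a ^^ M) x) = x" using assms(2)[of x] \<open>x \<in> B\<close> by simp
qed

lemma count_eigenangles_free:
  assumes inv: "\<And>x. x \<in> B \<Longrightarrow> a x \<in> B" and ord: "\<And>x. x \<in> B \<Longrightarrow> (a ^^ N) x = x" and N: "N > 0"
  shows "count_eigenangles (free_space B) (linear_ext B a) \<alpha> \<beta> =
    (\<Sum>j\<in>{j::nat. j < N \<and> \<alpha> < j / N \<and> j / N < \<beta>}. cfun.dim (signed_eigenspace B a (\<lambda>_. 1) (e2pi (j / N))))"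
proof -
  obtain M where M: "N = Suc M" using N by (cases N) auto
  have bij: "bij_betw a B B" by (rule bij_betw_of_funpow[of _ _ M, OF inv]) (use ord M in auto)
  have e: "eigenspace (free_space B) (linear_ext B a) z = signed_eigenspace B a (\<lambda>_. 1) z" for z
    using linear_ext_eigenvector_iff[OF bij] by (auto simp: eigenspace_def signed_eigenspace_def)
  show ?thesis
    unfolding e[symmetric]
  proof (rule count_eigenangles_finite_order)
    show "linear_ext B a f \<in> free_space B" for f using linear_ext_outside[OF bij] by (simp add: free_space_def)
    show "(linear_ext B a ^^ N) f = f" if "f \<in> free_space B" for f using linear_ext_funpow[OF bij ord that] .
  qed (simp_all add: subspace_free_space linear_ext_add linear_ext_scale N)
qed

lemma count_eigenangles_permutation:
  fixes \<alpha> \<beta> :: real and M :: nat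
  assumes fin: "finite B" and aB: "\<And>x. x \<in> B \<Longrightarrow> a x \<in> B"
    and M: "\<And>x. x \<in> B \<Longrightarrow> (a ^^ M) x = x" "M > 0"
    and ab: "0 < \<alpha>" "\<alpha> < \<beta>" "\<beta> < 1" "\<beta> \<notin> \<rat>"
  shows "real (count_eigenangles (free_space B) (linear_ext B a) \<alpha> \<beta>) =
    (\<beta> - \<alpha>) * card B + (\<Sum>x\<in>B. frac_diff \<alpha> \<beta> (card (orbit a x)) / card (orbit a x))"
proof -
  obtain \<eta> where \<eta>: "\<And>x. x \<in> B \<Longrightarrow> (\<Prod>y\<in>orbit a x. (1::complex)) = 1 \<Longrightarrow> \<eta> x = frac_diff \<alpha> \<beta> (card (orbit a x))"
    "(\<Sum>j\<in>{j::nat. j < 2 * M \<and> \<alpha> < j / (2 * M) \<and> j / (2 * M) < \<beta>}.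
       real (cfun.dim (signed_eigenspace B a (\<lambda>_. 1) (e2pi (j / (2 * M)))))) =
      (\<beta> - \<alpha>) * card B + (\<Sum>x\<in>B. \<eta> x / card (orbit a x))"
    by (rule signed_eigenangle_count[of B a M "\<lambda>_. 1" \<alpha> \<beta>, OF fin aB M _ ab]) auto
  have N: "(a ^^ (2 * M)) x = x" if "x \<in> B" for x
    using M(1)[OF that] by (simp add: mult_2 funpow_add)
  have "real (count_eigenangles (free_space B) (linear_ext B a) \<alpha> \<beta>) =
      (\<beta> - \<alpha>) * card B + (\<Sum>x\<in>B. \<eta> x / card (orbit a x))"
    unfolding \<eta>(2)[symmetric] of_nat_sum[symmetric] using M(2)
    by (intro arg_cong[where f = real] count_eigenangles_free[OF aB N]) auto
  also have "(\<Sum>x\<in>B. \<eta> x / card (orbit a x)) = (\<Sum>x\<in>B. frac_diff \<alpha> \<beta> (card (orbit a x)) / card (orbit a x))"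
    using \<eta>(1) by (intro sum.cong refl) simp
  finally show ?thesis .
qed

section \<open>The exterior algebra on finite subsets\<close>

text \<open>
  In the exterior algebra the basis vector of a finite set \<open>A\<close> is the wedge product of its elements in increasing order. The
  functions \<open>list_sign\<close>, \<open>ins_sign\<close> and \<open>subset_sign\<close> below are the resulting signs. They are products of signs of
  differences, so by \<open>subset_sign_list\<close> any other order can be used instead of the increasing one.
\<close>

definition order_sign :: "nat \<Rightarrow> nat \<Rightarrow> complex" where
  "order_sign x y = (if x < y then 1 else if y < x then -1 else 0)"

fun list_sign :: "nat list \<Rightarrow> complex" where
  "list_sign [] = 1"
| "list_sign (x # l) = (\<Prod>y\<leftarrow>l. order_sign x y) * list_sign l"

definition ins_sign :: "nat \<Rightarrow> nat set \<Rightarrow> complex" where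
  "ins_sign x A = (\<Prod>y\<in>A. order_sign x y)"

lemma order_sign_swap: "order_sign y x = - order_sign x y" by (simp add: order_sign_def)
lemma order_sign_self [simp]: "order_sign x x = 0" by (simp add: order_sign_def)
lemma order_sign_sq: "x \<noteq> y \<Longrightarrow> order_sign x y * order_sign x y = 1" by (auto simp: order_sign_def)

lemma ins_sign_sq: "x \<notin> A \<Longrightarrow> ins_sign x A * ins_sign x A = 1"
proof -
  assume x: "x \<notin> A"
  have "ins_sign x A * ins_sign x A = (\<Prod>y\<in>A. order_sign x y * order_sign x y)" by (simp add: ins_sign_def prod.distrib)
  also have "\<dots> = 1" using x by (intro prod.neutral ballI order_sign_sq) auto
  finally show ?thesis .
qed

lemma ins_sign_insert: "finite A \<Longrightarrow> y \<notin> A \<Longrightarrow> ins_sign x (insert y A) = order_sign x y * ins_sign x A"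
  by (simp add: ins_sign_def)

lemma list_sign_Cons: "distinct l \<Longrightarrow> list_sign (x # l) = ins_sign x (set l) * list_sign l"
  by (simp add: ins_sign_def prod.distinct_set_conv_list)

lemma list_sign_sq: "distinct l \<Longrightarrow> list_sign l * list_sign l = 1"
proof (induction l)
  case (Cons x l)
  then have d: "distinct l" "x \<notin> set l" by auto
  have "list_sign (x # l) * list_sign (x # l) = (ins_sign x (set l) * ins_sign x (set l)) * (list_sign l * list_sign l)"
    using d by (simp only: list_sign_Cons mult_ac)
  then show ?case by (simp only: ins_sign_sq[OF d(2)] Cons.IH[OF d(1)] mult_1)
qed simp

lemma list_sign_nz: "distinct l \<Longrightarrow> list_sign l \<noteq> 0" using list_sign_sq[of l] by auto

lemma list_sign_swap: "list_sign (xs @ y # x # ys) = - list_sign (xs @ x # y # ys)"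
proof (induction xs)
  case Nil show ?case using order_sign_swap[of y x] by simp
next
  case (Cons z xs) then show ?case by simp
qed

text \<open>
  Adjacent transpositions generate all rearrangements.
\<close>

lemma adjacent_swap_invariant:
  assumes "\<And>xs x y ys. g (xs @ x # y # ys) = g (xs @ y # x # ys)" and "mset l = mset l'"
  shows "g l = g l'"
  using assms
proof (induction l arbitrary: l' g)
  case Nil then show ?case by simp
next
  case (Cons x l)
  have "x \<in> set l'" using Cons.prems(2) by (metis list.set_intros(1) set_mset_mset)
  then obtain ys zs where l': "l' = ys @ x # zs" by (meson split_list)
  have "mset l = mset (ys @ zs)" using Cons.prems(2) unfolding l' by simp
  then have 1: "g (x # l) = g (x # ys @ zs)"
    using Cons.IH[of "\<lambda>t. g (x # t)" "ys @ zs"] Cons.prems(1)[of "x # _"] by simp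
  have "g (p @ x # ys @ zs) = g (p @ ys @ x # zs)" for p
  proof (induction ys arbitrary: p)
    case (Cons y ys)
    show ?case using Cons.IH[of "p @ [y]"] \<open>\<And>xs x y ys. g (xs @ x # y # ys) = g (xs @ y # x # ys)\<close>[of p x y "ys @ zs"] by simp
  qed simp
  from this[of "[]"] show ?case using 1 l' by simp
qed

text \<open>
  The coefficient with which \<open>\<sigma>\<close> maps the basis vector of \<open>A\<close> in the exterior algebra to the one of \<open>\<sigma> ` A\<close>.
\<close>

definition subset_sign :: "(nat \<Rightarrow> nat) \<Rightarrow> nat set \<Rightarrow> complex" where
  "subset_sign \<sigma> A = list_sign (map \<sigma> (sorted_list_of_set A)) * list_sign (sorted_list_of_set A)"

text \<open>
  Swapping two adjacent entries changes both factors by the sign \<open>-1\<close>, so the product depends on the set only.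
\<close>

lemma subset_sign_list:
  assumes "distinct l"
  shows "subset_sign \<sigma> (set l) = list_sign (map \<sigma> l) * list_sign l"
proof -
  have "mset l = mset (sorted_list_of_set (set l))"
    using assms by (metis List.finite_set distinct_sorted_list_of_set set_eq_iff_mset_eq_distinct set_sorted_list_of_set)
  then have "list_sign (map \<sigma> l) * list_sign l = subset_sign \<sigma> (set l)"
    unfolding subset_sign_def
  proof (rule adjacent_swap_invariant[of "\<lambda>l. list_sign (map \<sigma> l) * list_sign l", rotated])
    fix xs x y ys
    show "list_sign (map \<sigma> (xs @ x # y # ys)) * list_sign (xs @ x # y # ys) =
      list_sign (map \<sigma> (xs @ y # x # ys)) * list_sign (xs @ y # x # ys)"
      using list_sign_swap[of xs x y ys] list_sign_swap[of "map \<sigma> xs" "\<sigma> x" "\<sigma> y" "map \<sigma> ys"] by simp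
  qed
  then show ?thesis by simp
qed

lemma list_sign_map:
  assumes "distinct l" shows "list_sign (map \<sigma> l) = subset_sign \<sigma> (set l) * list_sign l"
  using list_sign_sq[OF assms] by (simp add: subset_sign_list[OF assms] mult.assoc)

lemma subset_sign_sq:
  assumes "finite A" "inj_on \<sigma> A" shows "subset_sign \<sigma> A * subset_sign \<sigma> A = 1"
proof -
  let ?l = "sorted_list_of_set A"
  have d: "distinct ?l" "distinct (map \<sigma> ?l)" using assms by (auto simp: distinct_map)
  have "subset_sign \<sigma> A * subset_sign \<sigma> A = (list_sign (map \<sigma> ?l) * list_sign (map \<sigma> ?l)) * (list_sign ?l * list_sign ?l)"
    unfolding subset_sign_def by (simp only: mult_ac)
  then show ?thesis using list_sign_sq[OF d(1)] list_sign_sq[OF d(2)] by simp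
qed

lemma subset_sign_pm1:
  assumes "finite A" "inj_on \<sigma> A" shows "subset_sign \<sigma> A = 1 \<or> subset_sign \<sigma> A = -1"
  using subset_sign_sq[OF assms] by (simp add: square_eq_1_iff)

lemma subset_sign_insert:
  assumes A: "finite A" "x \<notin> A" and inj: "inj_on \<sigma> (insert x A)"
  shows "subset_sign \<sigma> (insert x A) = ins_sign (\<sigma> x) (\<sigma> ` A) * ins_sign x A * subset_sign \<sigma> A"
proof -
  let ?l = "sorted_list_of_set A"
  have d: "distinct (x # ?l)" "distinct (map \<sigma> ?l)" using assms by (auto simp: distinct_map inj_on_def)
  have "subset_sign \<sigma> (set (x # ?l)) = list_sign (map \<sigma> (x # ?l)) * list_sign (x # ?l)" by (rule subset_sign_list[OF d(1)])
  also have "list_sign (map \<sigma> (x # ?l)) = ins_sign (\<sigma> x) (\<sigma> ` A) * list_sign (map \<sigma> ?l)"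
    using d A list_sign_Cons[of "map \<sigma> ?l" "\<sigma> x"] by (simp del: list_sign.simps)
  also have "list_sign (x # ?l) = ins_sign x A * list_sign ?l"
    using d A list_sign_Cons[of ?l x] by (simp del: list_sign.simps)
  finally show ?thesis using A by (simp add: subset_sign_def mult_ac)
qed

lemma list_sign_transpose:
  assumes l: "distinct l" "a \<in> set l" "b \<in> set l" "a \<noteq> b"
  shows "list_sign (map (Transposition.transpose a b) l) = - list_sign l"
proof -
  define r where "r = sorted_list_of_set (set l - {a, b})"
  have s: "set (a # b # r) = set l" and d: "distinct (a # b # r)" using l by (auto simp: r_def)
  have "subset_sign (Transposition.transpose a b) (set l) = list_sign (map (Transposition.transpose a b) (a # b # r)) * list_sign (a # b # r)"
    using subset_sign_list[OF d, of "Transposition.transpose a b"] unfolding s .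
  also have "map (Transposition.transpose a b) (a # b # r) = b # a # r"
  proof -
    have "map (Transposition.transpose a b) r = r" 
      by (intro map_idI Transposition.transpose_apply_other) (use d in auto)
    then show ?thesis by simp
  qed
  also have "list_sign (b # a # r) = - list_sign (a # b # r)" using list_sign_swap[of "[]" b a r] by simp
  also have "- list_sign (a # b # r) * list_sign (a # b # r) = -1" using list_sign_sq[OF d] by simp
  finally show ?thesis unfolding list_sign_map[OF l(1)] by simp
qed

text \<open>
  Both sides change sign when \<open>p\<close> is composed with a transposition.
\<close>

lemma sign_list_sign:
  assumes c: "distinct c" and p: "p permutes set c"
  shows "of_int (sign p) = list_sign (map p c) * list_sign c"
  using p List.finite_set[of c]
proof (induction p rule: permutes_induct)
  case id then show ?case using list_sign_sq[OF c] by simp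
next
  case (swap a b p)
  have d: "distinct (map p c)" using swap c by (simp add: distinct_map permutes_inj_on)
  have s: "set (map p c) = set c" using swap by (simp add: permutes_image)
  have A: "list_sign (map (Transposition.transpose a b \<circ> p) c) = - list_sign (map p c)"
    using list_sign_transpose[OF d, of a b] swap unfolding s by simp
  have "permutation p" using swap by (auto simp: permutation_permutes)
  then have B: "sign (Transposition.transpose a b \<circ> p) = - sign p"
    using swap by (subst sign_compose) (auto simp: sign_swap_id permutation_swap_id)
  show ?case unfolding A B using swap.IH swap.prems swap.hyps by simp
qed

text \<open>
  The boundary map from functions on \<open>(k+1)\<close>-subsets to functions on \<open>k\<close>-subsets, which is the contraction of
  exterior powers of \<open>\<complex>^n\<close> with the sum of the coordinates; and the wedge product with the average of the basis
  vectors, which goes in the other direction. Both are equivariant because the sum of the coordinates and the average are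
  invariant under permutations.
\<close>

definition bdry :: "nat \<Rightarrow> (nat set \<Rightarrow> complex) \<Rightarrow> nat set \<Rightarrow> complex" where
  "bdry n F A = (\<Sum>x\<in>{1..n} - A. ins_sign x A * F (insert x A))"

definition avg_wedge :: "nat \<Rightarrow> (nat set \<Rightarrow> complex) \<Rightarrow> nat set \<Rightarrow> complex" where
  "avg_wedge n F A = (\<Sum>x\<in>A \<inter> {1..n}. ins_sign x (A - {x}) * F (A - {x})) / of_nat n"

lemma bdry_add: "bdry n (F + G) = bdry n F + bdry n G"
  by (rule ext) (simp add: bdry_def distrib_left sum.distrib)

lemma bdry_scale: "bdry n (\<lambda>A. c * F A) = (\<lambda>A. c * bdry n F A)"
  by (rule ext) (simp add: bdry_def sum_distrib_left mult_ac)

lemma avg_wedge_add: "avg_wedge n (F + G) = avg_wedge n F + avg_wedge n G"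
  by (rule ext) (simp add: avg_wedge_def distrib_left sum.distrib add_divide_distrib)

lemma avg_wedge_scale: "avg_wedge n (\<lambda>A. c * F A) = (\<lambda>A. c * avg_wedge n F A)"
  by (rule ext) (simp add: avg_wedge_def sum_distrib_left mult_ac)

lemma bdry_free: assumes "F \<in> free_space (ksubsets n (Suc k))" shows "bdry n F \<in> free_space (ksubsets n k)"
proof -
  have "F (insert x A) = 0" if "A \<notin> ksubsets n k" "x \<in> {1..n} - A" for A x
  proof -
    have "insert x A \<notin> ksubsets n (Suc k)"
    proof
      assume "insert x A \<in> ksubsets n (Suc k)"
      then have "A \<subseteq> {1..n}" "card (insert x A) = Suc k" by (auto simp: ksubsets_def)
      moreover have "finite A" using \<open>A \<subseteq> {1..n}\<close> finite_subset by blast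
      ultimately show False using that by (simp add: ksubsets_def)
    qed
    then show ?thesis using assms by (simp add: free_space_def)
  qed
  then show ?thesis unfolding free_space_def bdry_def by (auto intro!: sum.neutral)
qed

lemma avg_wedge_free: assumes "F \<in> free_space (ksubsets n k)" shows "avg_wedge n F \<in> free_space (ksubsets n (Suc k))"
proof -
  have "F (A - {x}) = 0" if "A \<notin> ksubsets n (Suc k)" "x \<in> A \<inter> {1..n}" for A x
  proof -
    have "A - {x} \<notin> ksubsets n k"
    proof
      assume "A - {x} \<in> ksubsets n k"
      then have "A \<subseteq> {1..n}" "card (A - {x}) = k" using that by (auto simp: ksubsets_def)
      moreover have "finite A" using \<open>A \<subseteq> {1..n}\<close> finite_subset by blast
      ultimately show False using that card_Suc_Diff1[of A x] by (auto simp: ksubsets_def)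
    qed
    then show ?thesis using assms by (simp add: free_space_def)
  qed
  then have "avg_wedge n F A = 0" if "A \<notin> ksubsets n (Suc k)" for A
    using that unfolding avg_wedge_def by simp
  then show ?thesis unfolding free_space_def by auto
qed

text \<open>
  The contracting homotopy. Contraction with a linear form \<open>f\<close> is an antiderivation, so the anticommutator of it with the
  wedge product by a vector \<open>v\<close> is multiplication by \<open>f v\<close>; here \<open>f v = 1\<close>. In coordinates, the terms that exchange
  an element \<open>y\<close> of \<open>A\<close> for an element \<open>x\<close> outside cancel, and each of the \<open>n\<close> points contributes \<open>F A\<close> once.
\<close>

lemma bdry_avg_wedge:
  assumes n: "n > 0" and A: "A \<subseteq> {1..n}"
  shows "bdry n (avg_wedge n F) A + avg_wedge n (bdry n F) A = F A"
proof -
  have fA: "finite A" using A finite_subset by blast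
  define C where "C = {1..n} - A"
  have fC: "finite C" by (simp add: C_def)
  \<comment> \<open>the term that exchanges \<open>y\<close> in \<open>A\<close> for \<open>x\<close> outside \<open>A\<close>\<close>
  define q where "q x y = ins_sign x (A - {y}) * ins_sign y (A - {y}) * F (insert x (A - {y}))" for x y
  have 1: "ins_sign x A * (\<Sum>y\<in>insert x A \<inter> {1..n}. ins_sign y (insert x A - {y}) * F (insert x A - {y})) =
      F A - (\<Sum>y\<in>A. q x y)" if x: "x \<in> C" for x
  proof -
    have xA: "x \<notin> A" "x \<in> {1..n}" using x by (auto simp: C_def)
    have i: "insert x A \<inter> {1..n} = insert x A" using xA A by auto
    have "ins_sign x A * (ins_sign y (insert x A - {y}) * F (insert x A - {y})) = - q x y" if y: "y \<in> A" for y
    proof -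
      have e: "insert x A - {y} = insert x (A - {y})" using y xA by auto
      have "ins_sign x A = order_sign x y * ins_sign x (A - {y})"
        using ins_sign_insert[of "A - {y}" y x] fA y by (simp add: insert_absorb)
      moreover have "ins_sign y (insert x (A - {y})) = order_sign y x * ins_sign y (A - {y})"
        using fA xA by (intro ins_sign_insert) auto
      moreover have "order_sign x y * order_sign y x = -1" using order_sign_sq[of x y] order_sign_swap[of y x] y xA by auto
      ultimately have "ins_sign x A * ins_sign y (insert x (A - {y})) = - (ins_sign x (A - {y}) * ins_sign y (A - {y}))"
        by (metis (no_types, lifting) mult.assoc mult.left_commute mult_minus1)
      then show ?thesis unfolding e q_def by (metis (no_types, lifting) mult.assoc mult_minus_left)
    qed
    then have "(\<Sum>y\<in>A. ins_sign x A * (ins_sign y (insert x A - {y}) * F (insert x A - {y}))) = - (\<Sum>y\<in>A. q x y)"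
      by (simp add: sum_negf)
    moreover have "ins_sign x A * (ins_sign x (insert x A - {x}) * F (insert x A - {x})) = F A"
    proof -
      have "insert x A - {x} = A" using xA by auto
      then show ?thesis using ins_sign_sq[OF xA(1)] by (simp flip: mult.assoc)
    qed
    ultimately show ?thesis unfolding i using fA xA by (simp add: sum_distrib_left distrib_left)
  qed
  have 2: "ins_sign y (A - {y}) * (\<Sum>x\<in>{1..n} - (A - {y}). ins_sign x (A - {y}) * F (insert x (A - {y}))) =
      F A + (\<Sum>x\<in>C. q x y)" if y: "y \<in> A" for y
  proof -
    have e: "{1..n} - (A - {y}) = insert y C" "y \<notin> C" using y A by (auto simp: C_def)
    have "ins_sign y (A - {y}) * (ins_sign y (A - {y}) * F (insert y (A - {y}))) = F A"
      using ins_sign_sq[of y "A - {y}"] y by (simp add: insert_absorb flip: mult.assoc)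
    moreover have "(\<Sum>x\<in>C. ins_sign y (A - {y}) * (ins_sign x (A - {y}) * F (insert x (A - {y})))) = (\<Sum>x\<in>C. q x y)"
      unfolding q_def by (simp only: mult_ac)
    ultimately show ?thesis unfolding e(1) using e(2) fC by (simp add: sum_distrib_left distrib_left)
  qed
  have "of_nat n * bdry n (avg_wedge n F) A = (\<Sum>x\<in>C. ins_sign x A * (\<Sum>y\<in>insert x A \<inter> {1..n}. ins_sign y (insert x A - {y}) * F (insert x A - {y})))"
    unfolding bdry_def avg_wedge_def C_def[symmetric] sum_distrib_left[of "of_nat n" _ C] using n
    by (intro sum.cong refl) simp
  also have "\<dots> = (\<Sum>x\<in>C. F A - (\<Sum>y\<in>A. q x y))" using 1 by (rule sum.cong[OF refl])
  finally have 3: "of_nat n * bdry n (avg_wedge n F) A = of_nat (card C) * F A - (\<Sum>x\<in>C. \<Sum>y\<in>A. q x y)"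
    by (simp add: sum_subtractf)
  have "of_nat n * avg_wedge n (bdry n F) A = (\<Sum>y\<in>A. ins_sign y (A - {y}) * (\<Sum>x\<in>{1..n} - (A - {y}). ins_sign x (A - {y}) * F (insert x (A - {y}))))"
    using n A by (simp add: bdry_def avg_wedge_def Int_absorb2)
  also have "\<dots> = (\<Sum>y\<in>A. F A + (\<Sum>x\<in>C. q x y))" using 2 by (rule sum.cong[OF refl])
  finally have 4: "of_nat n * avg_wedge n (bdry n F) A = of_nat (card A) * F A + (\<Sum>x\<in>C. \<Sum>y\<in>A. q x y)"
    by (simp add: sum.distrib sum.swap[of _ A C])
  have "card C + card A = n"
    using A fA card_Diff_subset[OF fA A] card_mono[OF _ A] by (simp add: C_def)
  then have "of_nat n * (bdry n (avg_wedge n F) A + avg_wedge n (bdry n F) A) = of_nat n * F A"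
    unfolding distrib_left 3 4 by (simp flip: distrib_right of_nat_add)
  then show ?thesis using n by simp
qed

text \<open>
  Removing \<open>x\<close> and then \<open>y\<close> differs by a sign from removing them in the other order.
\<close>

lemma bdry_bdry:
  assumes A: "finite A"
  shows "bdry n (bdry n F) A = 0"
proof -
  define C where "C = {1..n} - A"
  have fC: "finite C" by (simp add: C_def)
  define q where "q x y = ins_sign x A * ins_sign y A * order_sign y x * F (insert x (insert y A))" for x y
  have "ins_sign x A * bdry n F (insert x A) = (\<Sum>y\<in>C. q x y)" if x: "x \<in> C" for x
  proof -
    have e: "{1..n} - insert x A = C - {x}" by (auto simp: C_def)
    have "ins_sign x A * bdry n F (insert x A) = (\<Sum>y\<in>C - {x}. q x y)"
      unfolding bdry_def e sum_distrib_left
    proof (rule sum.cong[OF refl])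
      fix y assume "y \<in> C - {x}"
      have "ins_sign y (insert x A) = order_sign y x * ins_sign y A" using x A by (intro ins_sign_insert) (auto simp: C_def)
      moreover have "insert y (insert x A) = insert x (insert y A)" by auto
      ultimately show "ins_sign x A * (ins_sign y (insert x A) * F (insert y (insert x A))) = q x y"
        unfolding q_def by (simp only: mult_ac)
    qed
    also have "\<dots> = (\<Sum>y\<in>C. q x y)" using x fC by (intro sum.mono_neutral_left) (auto simp: q_def)
    finally show ?thesis .
  qed
  then have s: "bdry n (bdry n F) A = (\<Sum>x\<in>C. \<Sum>y\<in>C. q x y)"
    unfolding bdry_def[of n "bdry n F"] C_def[symmetric] by (rule sum.cong[OF refl])
  also have "\<dots> = (\<Sum>y\<in>C. \<Sum>x\<in>C. q x y)" by (rule sum.swap)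
  also have "\<dots> = (\<Sum>y\<in>C. \<Sum>x\<in>C. - q y x)"
  proof (intro sum.cong refl)
    fix x y
    have "q x y = ins_sign x A * ins_sign y A * - order_sign x y * F (insert y (insert x A))"
      unfolding q_def by (subst order_sign_swap) (simp only: insert_commute)
    then show "q x y = - q y x" by (simp add: q_def mult_ac)
  qed
  also have "\<dots> = - bdry n (bdry n F) A" unfolding s by (simp add: sum_negf)
  finally show ?thesis by simp
qed

lemma bdry_bdry_free:
  assumes F: "F \<in> free_space (ksubsets n (Suc k))"
  shows "bdry n (bdry n F) = 0"
proof
  fix A show "bdry n (bdry n F) A = 0 A"
  proof (cases "finite A")
    case True then show ?thesis by (simp add: bdry_bdry)
  next
    case False
    then have "insert x A \<notin> ksubsets n k" for x
      using finite_subset[of "insert x A" "{1..n}"] by (auto simp: ksubsets_def)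
    then have "bdry n F (insert x A) = 0" for x using bdry_free[OF F] unfolding free_space_def by blast
    then show ?thesis by (simp add: bdry_def[of n "bdry n F"])
  qed
qed

text \<open>
  The hypothesis says that \<open>G\<close> is the image of \<open>F\<close> under \<open>\<sigma>\<close>, on the sets that the boundary at \<open>A\<close> looks at.
\<close>

lemma bdry_equivariant:
  assumes \<sigma>: "\<sigma> permutes {1..n}" and A: "A \<subseteq> {1..n}"
    and F: "\<And>x. x \<in> {1..n} - A \<Longrightarrow> subset_sign \<sigma> (insert x A) * F (insert x A) = G (\<sigma> ` insert x A)"
  shows "subset_sign \<sigma> A * bdry n F A = bdry n G (\<sigma> ` A)"
proof -
  have fA: "finite A" using A finite_subset by blast
  have inj: "inj_on \<sigma> B" for B using permutes_inj_on[OF \<sigma>] .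
  have im: "{1..n} - \<sigma> ` A = \<sigma> ` ({1..n} - A)"
    using permutes_image[OF \<sigma>] inj[of UNIV] by (simp add: image_set_diff)
  have "bdry n G (\<sigma> ` A) = (\<Sum>x\<in>{1..n} - A. ins_sign (\<sigma> x) (\<sigma> ` A) * G (insert (\<sigma> x) (\<sigma> ` A)))"
    unfolding bdry_def im by (subst sum.reindex[OF inj]) simp
  also have "\<dots> = (\<Sum>x\<in>{1..n} - A. subset_sign \<sigma> A * (ins_sign x A * F (insert x A)))"
  proof (rule sum.cong[OF refl])
    fix x assume x: "x \<in> {1..n} - A"
    have "ins_sign (\<sigma> x) (\<sigma> ` A) * G (insert (\<sigma> x) (\<sigma> ` A)) = ins_sign (\<sigma> x) (\<sigma> ` A) * subset_sign \<sigma> (insert x A) * F (insert x A)"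
      using F[OF x] by simp
    also have "ins_sign (\<sigma> x) (\<sigma> ` A) * subset_sign \<sigma> (insert x A) =
        (ins_sign (\<sigma> x) (\<sigma> ` A) * ins_sign (\<sigma> x) (\<sigma> ` A)) * (subset_sign \<sigma> A * ins_sign x A)"
      using x fA by (subst subset_sign_insert[OF _ _ inj]) (simp_all add: mult_ac)
    also have "ins_sign (\<sigma> x) (\<sigma> ` A) * ins_sign (\<sigma> x) (\<sigma> ` A) = 1"
      using x permutes_inj[OF \<sigma>] by (intro ins_sign_sq) (auto dest: injD)
    finally show "ins_sign (\<sigma> x) (\<sigma> ` A) * G (insert (\<sigma> x) (\<sigma> ` A)) = subset_sign \<sigma> A * (ins_sign x A * F (insert x A))"
      by (simp add: mult_ac)
  qed
  finally show ?thesis unfolding bdry_def[of n F] by (simp add: sum_distrib_left)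
qed

lemma avg_wedge_equivariant:
  assumes \<sigma>: "\<sigma> permutes {1..n}" and A: "A \<subseteq> {1..n}"
    and F: "\<And>x. x \<in> A \<Longrightarrow> subset_sign \<sigma> (A - {x}) * F (A - {x}) = G (\<sigma> ` (A - {x}))"
  shows "subset_sign \<sigma> A * avg_wedge n F A = avg_wedge n G (\<sigma> ` A)"
proof -
  have fA: "finite A" using A finite_subset by blast
  have inj: "inj_on \<sigma> B" for B using permutes_inj_on[OF \<sigma>] .
  have i1: "A \<inter> {1..n} = A" using A by auto
  have i2: "\<sigma> ` A \<inter> {1..n} = \<sigma> ` A" using A permutes_image[OF \<sigma>] by blast
  have d: "\<sigma> ` A - {\<sigma> x} = \<sigma> ` (A - {x})" for x using permutes_inj[OF \<sigma>] by (auto dest: injD)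
  have "(\<Sum>x\<in>\<sigma> ` A. ins_sign x (\<sigma> ` A - {x}) * G (\<sigma> ` A - {x})) =
    (\<Sum>x\<in>A. ins_sign (\<sigma> x) (\<sigma> ` (A - {x})) * G (\<sigma> ` (A - {x})))"
    by (subst sum.reindex[OF inj]) (simp add: d)
  also have "\<dots> = (\<Sum>x\<in>A. subset_sign \<sigma> A * (ins_sign x (A - {x}) * F (A - {x})))"
  proof (rule sum.cong[OF refl])
    fix x assume x: "x \<in> A"
    have "subset_sign \<sigma> A = ins_sign (\<sigma> x) (\<sigma> ` (A - {x})) * ins_sign x (A - {x}) * subset_sign \<sigma> (A - {x})"
      using subset_sign_insert[of "A - {x}" x \<sigma>] fA x inj by (simp add: insert_absorb)
    then have "subset_sign \<sigma> A * ins_sign x (A - {x}) = ins_sign (\<sigma> x) (\<sigma> ` (A - {x})) * subset_sign \<sigma> (A - {x}) *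
        (ins_sign x (A - {x}) * ins_sign x (A - {x}))" by (simp only: mult_ac)
    also have "ins_sign x (A - {x}) * ins_sign x (A - {x}) = 1" by (intro ins_sign_sq) auto
    finally have "subset_sign \<sigma> A * ins_sign x (A - {x}) = ins_sign (\<sigma> x) (\<sigma> ` (A - {x})) * subset_sign \<sigma> (A - {x})" by simp
    then show "ins_sign (\<sigma> x) (\<sigma> ` (A - {x})) * G (\<sigma> ` (A - {x})) = subset_sign \<sigma> A * (ins_sign x (A - {x}) * F (A - {x}))"
      using F[OF x] by (metis mult.assoc)
  qed
  finally show ?thesis unfolding avg_wedge_def i1 i2 by (simp add: sum_distrib_left)
qed

section \<open>Specht modules of hook shape\<close>

text \<open>
  The first column below the corner. It determines the tabloid of a hook tableau, since the rows below the first one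
  have a single box each.
\<close>

definition leg :: "nat \<Rightarrow> (nat \<times> nat \<Rightarrow> nat) \<Rightarrow> nat list" where
  "leg k t = map (\<lambda>i. t (i, 0)) [1..<Suc k]"

definition hook_tabloid :: "nat \<Rightarrow> nat list \<Rightarrow> nat set list" where
  "hook_tabloid n l = ({1..n} - set l) # map (\<lambda>x. {x}) l"

lemma length_hook [simp]: "length (hook n k) = Suc k" by (simp add: hook_def)

lemma sum_list_hook: "k < n \<Longrightarrow> sum_list (hook n k) = n" by (simp add: hook_def sum_list_replicate)

lemma diagram_hook:
  assumes "k < n"
  shows "diagram (hook n k) = Pair 0 ` {..<n - k} \<union> (\<lambda>i. (i, 0)) ` {..k}"
proof -
  have "j < hook n k ! i \<longleftrightarrow> (if i = 0 then j < n - k else j = 0)" if "i \<le> k" for i j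
    using that by (cases i) (auto simp: hook_def)
  then show ?thesis using assms unfolding diagram_def by (auto simp: less_Suc_eq_le split: if_splits)
qed

lemma diagram_hook_iff:
  assumes "k < n"
  shows "(i, j) \<in> diagram (hook n k) \<longleftrightarrow> (i = 0 \<and> j < n - k) \<or> (i \<le> k \<and> j = 0)"
  unfolding diagram_hook[OF assms] by auto

lemma hook_tableauD:
  assumes k: "k < n" and t: "t \<in> tableaux (hook n k)"
  shows "leg k t \<in> tuples n k" and "t (0, 0) \<in> {1..n} - set (leg k t)"
    and "tabloid (hook n k) t = hook_tabloid n (leg k t)"
proof -
  have b: "bij_betw t (diagram (hook n k)) {1..n}" using t k by (simp add: tableaux_def sum_list_hook)
  have inj: "inj_on t (diagram (hook n k))" using b by (simp add: bij_betw_def)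
  have im: "t ` diagram (hook n k) = {1..n}" using b by (simp add: bij_betw_def)
  note dg = diagram_hook_iff[OF k]
  have d: "distinct (leg k t)"
    unfolding leg_def distinct_map
  proof
    show "inj_on (\<lambda>i. t (i, 0)) (set [1..<Suc k])"
    proof (rule inj_onI)
      fix x y assume xy: "x \<in> set [1..<Suc k]" "y \<in> set [1..<Suc k]" "t (x, 0) = t (y, 0)"
      have "(x, 0) \<in> diagram (hook n k)" "(y, 0) \<in> diagram (hook n k)" using xy by (auto simp: dg)
      from inj_onD[OF inj xy(3) this] show "x = y" by simp
    qed
  qed simp
  have sl: "set (leg k t) = t ` (\<lambda>i. (i, 0)) ` {1..k}" by (auto simp: leg_def image_image)
  have sub: "set (leg k t) \<subseteq> {1..n}" unfolding sl im[symmetric] by (intro image_mono) (auto simp: dg)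
  show "leg k t \<in> tuples n k" using d sub by (simp add: tuples_def leg_def)
  have row0: "t ` Pair 0 ` {..<n - k} = {1..n} - set (leg k t)"
  proof -
    have "{1..n} - set (leg k t) = t ` diagram (hook n k) - t ` (\<lambda>i. (i, 0)) ` {1..k}" by (simp only: im sl)
    also have "\<dots> = t ` (diagram (hook n k) - (\<lambda>i. (i, 0)) ` {1..k})"
      by (intro inj_on_image_set_diff[OF inj, symmetric]) (auto simp: dg)
    also have "diagram (hook n k) - (\<lambda>i. (i, 0)) ` {1..k} = Pair 0 ` {..<n - k}"
    proof (rule set_eqI)
      fix z :: "nat \<times> nat"
      obtain i j where z: "z = (i, j)" by fastforce
      show "z \<in> diagram (hook n k) - (\<lambda>i. (i, 0)) ` {1..k} \<longleftrightarrow> z \<in> Pair 0 ` {..<n - k}"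
        unfolding z using k by (cases "i = 0") (auto simp: dg)
    qed
    finally show ?thesis by simp
  qed
  then show "t (0, 0) \<in> {1..n} - set (leg k t)" using k by (metis imageI lessThan_iff zero_less_diff)
  have r0: "{t (0, j) |j. (0, j) \<in> diagram (hook n k)} = {1..n} - set (leg k t)"
    unfolding row0[symmetric] using k by (auto simp: dg)
  have ri: "{t (i, j) |j. (i, j) \<in> diagram (hook n k)} = {t (i, 0)}" if "i \<in> set [1..<Suc k]" for i
    using that by (auto simp: dg)
  have "[0..<length (hook n k)] = 0 # [1..<Suc k]" by (simp add: upt_rec)
  then have "tabloid (hook n k) t = {t (0, j) |j. (0, j) \<in> diagram (hook n k)} #
      map (\<lambda>i. {t (i, j) |j. (i, j) \<in> diagram (hook n k)}) [1..<Suc k]"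
    unfolding tabloid_def by (simp only: list.map)
  also have "map (\<lambda>i. {t (i, j) |j. (i, j) \<in> diagram (hook n k)}) [1..<Suc k] = map (\<lambda>i. {t (i, 0)}) [1..<Suc k]"
    using ri by (intro map_cong refl) auto
  finally show "tabloid (hook n k) t = hook_tabloid n (leg k t)"
    unfolding r0 by (simp add: hook_tabloid_def leg_def o_def)
qed

lemma hook_tableau_exists:
  assumes k: "k < n" and c: "distinct (x # l)" "length l = k" "set (x # l) \<subseteq> {1..n}"
  obtains t where "t \<in> tableaux (hook n k)" "t (0, 0) = x" "leg k t = l"
proof -
  let ?c = "x # l"
  have "card ({1..n} - set ?c) = card (Pair (0::nat) ` {1..<n - k})"
    using c card_Diff_subset[of "set ?c" "{1..n}"] distinct_card[OF c(1)]
    by (simp add: card_image inj_on_def)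
  then obtain g where g: "bij_betw g (Pair (0::nat) ` {1..<n - k}) ({1..n} - set ?c)"
    using finite_same_card_bij[of "Pair (0::nat) ` {1..<n - k}" "{1..n} - set ?c"] by auto
  \<comment> \<open>the first column is \<open>x # l\<close>, and an arbitrary bijection fills the rest of the first row\<close>
  define t where "t p = (if snd p = 0 then ?c ! fst p else g p)" for p :: "nat \<times> nat"
  have b1: "bij_betw t ((\<lambda>i. (i, 0)) ` {..k}) (set ?c)"
  proof -
    have "bij_betw (\<lambda>i. ?c ! i) {..<Suc k} (set ?c)" using bij_betw_nth[OF c(1), of "{..<Suc k}"] c by auto
    then have *: "bij_betw (\<lambda>i. t (i, 0)) {..k} (set ?c)" by (simp add: t_def lessThan_Suc_atMost)
    have "bij_betw (\<lambda>i. (i, 0::nat)) {..k} ((\<lambda>i. (i, 0)) ` {..k})" by (auto simp: bij_betw_def inj_on_def)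
    from bij_betw_comp_iff[OF this, of t "set ?c"] * show ?thesis by (simp add: o_def)
  qed
  have b2: "bij_betw t (Pair 0 ` {1..<n - k}) ({1..n} - set ?c)"
    using g by (subst bij_betw_cong[of _ t g]) (auto simp: t_def)
  have "bij_betw t ((\<lambda>i. (i, 0)) ` {..k} \<union> Pair 0 ` {1..<n - k}) (set ?c \<union> ({1..n} - set ?c))"
    using b1 b2 by (rule bij_betw_combine) auto
  moreover have "(\<lambda>i. (i, 0)) ` {..k} \<union> Pair 0 ` {1..<n - k} = diagram (hook n k)"
  proof (rule set_eqI)
    fix z :: "nat \<times> nat"
    obtain i j where z: "z = (i, j)" by fastforce
    show "z \<in> (\<lambda>i. (i, 0)) ` {..k} \<union> Pair 0 ` {1..<n - k} \<longleftrightarrow> z \<in> diagram (hook n k)"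
      unfolding z diagram_hook_iff[OF k] using k by (cases j) auto
  qed
  moreover have "set ?c \<union> ({1..n} - set ?c) = {1..n}" using c by auto
  ultimately have "t \<in> tableaux (hook n k)" using k by (simp add: tableaux_def sum_list_hook)
  moreover have "leg k t = l"
    using c by (intro nth_equalityI) (auto simp: leg_def t_def simp del: upt_Suc)
  ultimately show ?thesis using that[of t] by (simp add: t_def)
qed

lemma hook_tabloid_inj: "hook_tabloid n l = hook_tabloid n l' \<Longrightarrow> l = l'"
  unfolding hook_tabloid_def by (simp add: inj_map_eq_map inj_def)

lemma tabloids_hook:
  assumes k: "k < n"
  shows "tabloids (hook n k) = hook_tabloid n ` tuples n k"
proof
  show "tabloids (hook n k) \<subseteq> hook_tabloid n ` tuples n k"
    using hook_tableauD[OF k] by (auto simp: tabloids_def)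
next
  show "hook_tabloid n ` tuples n k \<subseteq> tabloids (hook n k)"
  proof
    fix s assume "s \<in> hook_tabloid n ` tuples n k"
    then obtain l where l: "s = hook_tabloid n l" "distinct l" "length l = k" "set l \<subseteq> {1..n}"
      by (auto simp: tuples_def)
    have "card (set l) < card {1..n}" using l k by (simp add: distinct_card)
    then have "\<not> {1..n} \<subseteq> set l" by (metis List.finite_set card_mono not_le)
    then obtain x where "x \<in> {1..n} - set l" by blast
    then obtain t where "t \<in> tableaux (hook n k)" "leg k t = l"
      using hook_tableau_exists[OF k, of x l] l by auto
    then show "s \<in> tabloids (hook n k)" using hook_tableauD(3)[OF k] l(1) by (auto simp: tabloids_def)
  qed
qed

text \<open>
  All columns except the first have one box, and so the permutations that preserve each column fix everything outside
  the first column.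
\<close>

lemma column_stabilizer_hook:
  assumes k: "k < n" and t: "t \<in> tableaux (hook n k)"
  shows "column_stabilizer (hook n k) t = {\<pi>. \<pi> permutes set (t (0, 0) # leg k t)}"
proof -
  let ?C = "set (t (0, 0) # leg k t)"
  note dg = diagram_hook_iff[OF k]
  have c0: "{t (i, 0) |i. (i, 0) \<in> diagram (hook n k)} = ?C"
  proof -
    have "?C = (\<lambda>i. t (i, 0)) ` (insert 0 {1..k})" by (auto simp: leg_def)
    also have "insert 0 {1..k} = {..k}" by auto
    finally show ?thesis using k by (auto simp: dg)
  qed
  have cj: "{t (i, j) |i. (i, j) \<in> diagram (hook n k)} = (if j < n - k then {t (0, j)} else {})" if "j \<noteq> 0" for j
    using that by (auto simp: dg)
  have im: "t ` diagram (hook n k) = {1..n}" using t k by (simp add: tableaux_def sum_list_hook bij_betw_def)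
  have Cn: "?C \<subseteq> {1..n}" using hook_tableauD[OF k t] by (auto simp: tuples_def)
  have out: "\<exists>j. j \<noteq> 0 \<and> j < n - k \<and> x = t (0, j)" if "x \<in> {1..n} - ?C" for x
  proof -
    have "x \<in> t ` diagram (hook n k)" unfolding im using that by simp
    then obtain i j where ij: "x = t (i, j)" "(i, j) \<in> diagram (hook n k)" by (elim imageE) (metis surj_pair)
    have "j \<noteq> 0"
    proof
      assume "j = 0" then have "x \<in> ?C" unfolding c0[symmetric] using ij by auto
      then show False using that by simp
    qed
    then show ?thesis using ij by (auto simp: dg)
  qed
  have ne: "t (0, j) \<notin> ?C" if "j \<noteq> 0" "j < n - k" for j
  proof
    assume "t (0, j) \<in> ?C"
    then obtain i where i: "t (0, j) = t (i, 0)" "(i, 0) \<in> diagram (hook n k)" unfolding c0[symmetric] by auto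
    have "inj_on t (diagram (hook n k))" using t by (simp add: tableaux_def bij_betw_def)
    then have "(0::nat, j) = (i, 0)" using i that by (intro inj_onD[OF \<open>inj_on t _\<close>, of "(0, j)" "(i, 0)"]) (auto simp: dg)
    then show False using that by simp
  qed
  show ?thesis
  proof (intro set_eqI iffI)
    fix \<pi> assume "\<pi> \<in> column_stabilizer (hook n k) t"
    then have p: "\<pi> permutes {1..n}" and
      cs: "\<And>j. \<pi> ` {t (i, j) |i. (i, j) \<in> diagram (hook n k)} = {t (i, j) |i. (i, j) \<in> diagram (hook n k)}"
      using k by (auto simp: column_stabilizer_def sum_list_hook)
    have "\<pi> x = x" if x: "x \<in> {1..n} - ?C" for x
    proof -
      obtain j where j: "j \<noteq> 0" "j < n - k" "x = t (0, j)" using out[OF x] by blast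
      show ?thesis using cs[of j] unfolding cj[OF j(1)] using j by simp
    qed
    then have "\<pi> permutes ?C" using p by (intro permutes_superset[OF p]) auto
    then show "\<pi> \<in> {\<pi>. \<pi> permutes ?C}" by simp
  next
    fix \<pi> assume "\<pi> \<in> {\<pi>. \<pi> permutes ?C}"
    then have p: "\<pi> permutes ?C" by simp
    have "\<pi> ` {t (i, j) |i. (i, j) \<in> diagram (hook n k)} = {t (i, j) |i. (i, j) \<in> diagram (hook n k)}" for j
    proof (cases "j = 0")
      case True show ?thesis unfolding True c0 by (rule permutes_image[OF p])
    next
      case False
      show ?thesis unfolding cj[OF False] using permutes_not_in[OF p ne[OF False]] by auto
    qed
    then show "\<pi> \<in> column_stabilizer (hook n k) t"
      using permutes_subset[OF p Cn] k by (simp add: column_stabilizer_def sum_list_hook)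
  qed
qed

lemma permutation_between_lists:
  assumes "distinct c" "distinct c'" "set c = set c'"
  obtains p where "p permutes set c" "map p c = c'"
proof -
  have len: "length c = length c'" using assms by (metis distinct_card)
  define p where "p x = (case map_of (zip c c') x of Some y \<Rightarrow> y | None \<Rightarrow> x)" for x
  have pc: "p (c ! i) = c' ! i" if "i < length c" for i
    using map_of_zip_nth[OF len assms(1) that[unfolded len]] that by (simp add: p_def)
  have m: "map p c = c'" using pc len by (intro nth_equalityI) auto
  have "p ` set c = set c" using m assms(3) by (metis list.set_map)
  moreover have "p x = x" if "x \<notin> set c" for x
  proof -
    have "map_of (zip c c') x = None" using that dom_map_of_zip[OF len] by blast
    then show ?thesis by (simp add: p_def)
  qed
  moreover have "inj_on p (set c)" using m assms(2) by (metis distinct_map)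
  ultimately have "p permutes set c" by (intro bij_imp_permutes) (auto simp: bij_betw_def)
  then show ?thesis using m that by blast
qed

text \<open>
  Tabloids of hook shape correspond to the \<open>k\<close>-tuples of distinct points, and a function on \<open>k\<close>-subsets corresponds to the
  alternating function of tuples with the values \<open>list_sign l * F (set l)\<close>.
\<close>

definition alt_ext :: "nat \<Rightarrow> nat \<Rightarrow> (nat set \<Rightarrow> complex) \<Rightarrow> nat set list \<Rightarrow> complex" where
  "alt_ext n k F s = (if s \<in> tabloids (hook n k)
     then list_sign (map the_elem (tl s)) * F (set (map the_elem (tl s))) else 0)"

lemma alt_ext_hook_tabloid:
  assumes "k < n" "l \<in> tuples n k"
  shows "alt_ext n k F (hook_tabloid n l) = list_sign l * F (set l)"
proof -
  have "map the_elem (tl (hook_tabloid n l)) = l" by (simp add: hook_tabloid_def o_def)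
  then show ?thesis using assms by (auto simp: alt_ext_def tabloids_hook)
qed

lemma alt_ext_add: "alt_ext n k (F + G) = alt_ext n k F + alt_ext n k G"
  by (rule ext) (simp add: alt_ext_def distrib_left)

lemma alt_ext_scale: "alt_ext n k (\<lambda>A. c * F A) = (\<lambda>s. c * alt_ext n k F s)"
  by (rule ext) (simp add: alt_ext_def mult_ac)

text \<open>
  At the tabloid of \<open>l\<close> both sides vanish unless \<open>l\<close> and one more point \<open>x\<close> make up the first column \<open>C\<close> of \<open>t\<close>. In
  that case exactly one column permutation maps the first column, read downwards, to \<open>x # l\<close>, and its sign is the sign
  with which \<open>x\<close> is removed from \<open>C\<close> in the boundary, up to the signs of \<open>l\<close> and of the first column as lists.
\<close>

lemma polytabloid_hook:
  assumes k: "k < n" and t: "t \<in> tableaux (hook n k)"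
  shows "polytabloid (hook n k) t =
    (\<lambda>s. list_sign (t (0, 0) # leg k t) * alt_ext n k (bdry n (\<lambda>A. if A = set (t (0, 0) # leg k t) then 1 else 0)) s)"
proof
  fix s
  let ?c = "t (0, 0) # leg k t"
  let ?C = "set ?c"
  let ?\<delta> = "\<lambda>A. if A = ?C then 1 else (0::complex)"
  have legt: "leg k t \<in> tuples n k" by (rule hook_tableauD(1)[OF k t])
  have dc: "distinct ?c" using hook_tableauD[OF k t] by (auto simp: tuples_def)
  have Cn: "?C \<subseteq> {1..n}" using hook_tableauD[OF k t] by (auto simp: tuples_def)
  have \<pi>t: "\<pi> \<circ> t \<in> tableaux (hook n k)" if "\<pi> permutes ?C" for \<pi>
    using t bij_betw_trans[of t _ "{1..n}" \<pi> "{1..n}"] permutes_imp_bij[OF permutes_subset[OF that Cn]] k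
    by (simp add: tableaux_def sum_list_hook)
  have legc: "leg k (\<pi> \<circ> t) = map \<pi> (leg k t)" for \<pi> by (simp add: leg_def)
  have pt: "polytabloid (hook n k) t s =
    (\<Sum>\<pi> | \<pi> permutes ?C. of_int (sign \<pi>) * (if hook_tabloid n (map \<pi> (leg k t)) = s then 1 else 0))"
    unfolding polytabloid_def column_stabilizer_hook[OF k t]
    using hook_tableauD(3)[OF k \<pi>t] by (intro sum.cong refl) (simp add: legc)
  show "polytabloid (hook n k) t s = list_sign ?c * alt_ext n k (bdry n ?\<delta>) s"
  proof (cases "s \<in> tabloids (hook n k)")
    case False
    have "hook_tabloid n (map \<pi> (leg k t)) \<noteq> s" if "\<pi> permutes ?C" for \<pi>
    proof
      assume "hook_tabloid n (map \<pi> (leg k t)) = s"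
      then have "tabloid (hook n k) (\<pi> \<circ> t) = s" using hook_tableauD(3)[OF k \<pi>t[OF that]] by (simp add: legc)
      then show False using False \<pi>t[OF that] by (auto simp: tabloids_def)
    qed
    then have "polytabloid (hook n k) t s = 0" unfolding pt by (intro sum.neutral) auto
    then show ?thesis using False by (simp add: alt_ext_def)
  next
    case True
    then obtain l where l: "l \<in> tuples n k" "s = hook_tabloid n l" using tabloids_hook[OF k] by auto
    have dl: "distinct l" "set l \<subseteq> {1..n}" using l by (auto simp: tuples_def)
    have pt': "polytabloid (hook n k) t s =
      (\<Sum>\<pi> | \<pi> permutes ?C. of_int (sign \<pi>) * (if map \<pi> (leg k t) = l then 1 else 0))"
      unfolding pt unfolding l(2) using hook_tabloid_inj by (intro sum.cong refl) auto
    have rhs: "alt_ext n k (bdry n ?\<delta>) s = list_sign l * (\<Sum>x\<in>{1..n} - set l. ins_sign x (set l) * ?\<delta> (insert x (set l)))"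
      unfolding l(2) alt_ext_hook_tabloid[OF k l(1)] bdry_def ..
    show ?thesis
    proof (cases "\<exists>x\<in>{1..n} - set l. insert x (set l) = ?C")
      case True
      then obtain x where x: "x \<in> {1..n} - set l" "insert x (set l) = ?C" by blast
      have xu: "y = x" if "y \<in> {1..n} - set l" "insert y (set l) = ?C" for y using that x by blast
      have dx: "distinct (x # l)" "set (x # l) = ?C" using x dl by auto
      obtain p where p: "p permutes ?C" "map p ?c = x # l"
        using permutation_between_lists[OF dc dx(1)] dx(2) by metis
      have uniq: "\<pi> = p" if \<pi>: "\<pi> permutes ?C" "map \<pi> (leg k t) = l" for \<pi>
      proof -
        have "insert (\<pi> (t (0, 0))) (set l) = \<pi> ` ?C" unfolding \<pi>(2)[symmetric] by simp
        also have "\<dots> = ?C" by (rule permutes_image[OF \<pi>(1)])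
        finally have i: "insert (\<pi> (t (0, 0))) (set l) = ?C" .
        have "distinct (map \<pi> ?c)" unfolding distinct_map using dc permutes_inj_on[OF \<pi>(1)] by blast
        then have "\<pi> (t (0, 0)) \<notin> set l" using \<pi>(2) by auto
        moreover have "\<pi> (t (0, 0)) \<in> {1..n}" using i Cn by blast
        ultimately have "\<pi> (t (0, 0)) = x" using xu i by auto
        then have mm: "map \<pi> ?c = map p ?c" using \<pi>(2) p(2) by simp
        show ?thesis
        proof
          fix y show "\<pi> y = p y"
            using mm permutes_not_in[OF \<pi>(1), of y] permutes_not_in[OF p(1), of y]
            by (cases "y \<in> ?C") (metis map_eq_conv, metis)
        qed
      qed
      have "polytabloid (hook n k) t s = (\<Sum>\<pi>\<in>{p}. of_int (sign \<pi>) * (if map \<pi> (leg k t) = l then 1 else 0))"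
        unfolding pt' using uniq p(1) by (intro sum.mono_neutral_right) (auto simp: finite_permutations)
      also have "\<dots> = of_int (sign p)" using p(2) by simp
      also have "\<dots> = list_sign (x # l) * list_sign ?c" using sign_list_sign[OF dc p(1)] unfolding p(2) .
      also have "list_sign (x # l) = ins_sign x (set l) * list_sign l" by (rule list_sign_Cons[OF dl(1)])
      finally have L: "polytabloid (hook n k) t s = ins_sign x (set l) * list_sign l * list_sign ?c" .
      have "(\<Sum>y\<in>{1..n} - set l. ins_sign y (set l) * ?\<delta> (insert y (set l))) =
          (\<Sum>y\<in>{x}. ins_sign y (set l) * ?\<delta> (insert y (set l)))"
      proof (rule sum.mono_neutral_right)
        show "{x} \<subseteq> {1..n} - set l" using x(1) by simp
        show "\<forall>y\<in>{1..n} - set l - {x}. ins_sign y (set l) * ?\<delta> (insert y (set l)) = 0"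
        proof
          fix y assume y: "y \<in> {1..n} - set l - {x}"
          then have "insert y (set l) \<noteq> ?C" using xu[of y] by blast
          then show "ins_sign y (set l) * ?\<delta> (insert y (set l)) = 0" by (simp only: if_False mult_zero_right)
        qed
      qed simp
      also have "\<dots> = ins_sign x (set l) * ?\<delta> (insert x (set l))" by (subst sum.insert) simp_all
      also have "\<dots> = ins_sign x (set l)" by (simp only: x(2) simp_thms if_True mult_1_right)
      finally show ?thesis unfolding L rhs by (simp only: mult_ac)
    next
      case False
      have "map \<pi> (leg k t) \<noteq> l" if \<pi>: "\<pi> permutes ?C" for \<pi>
      proof
        assume m: "map \<pi> (leg k t) = l"
        have "insert (\<pi> (t (0, 0))) (set l) = \<pi> ` ?C" unfolding m[symmetric] by simp
        also have "\<dots> = ?C" by (rule permutes_image[OF \<pi>(1)])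
        finally have i: "insert (\<pi> (t (0, 0))) (set l) = ?C" .
        have "distinct (map \<pi> ?c)" unfolding distinct_map using dc permutes_inj_on[OF \<pi>] by blast
        then have "\<pi> (t (0, 0)) \<notin> set l" using m by auto
        moreover have "\<pi> (t (0, 0)) \<in> {1..n}" using i Cn by blast
        ultimately show False using False i by blast
      qed
      then have "polytabloid (hook n k) t s = 0" unfolding pt' by (intro sum.neutral) auto
      moreover have "(\<Sum>x\<in>{1..n} - set l. ins_sign x (set l) * ?\<delta> (insert x (set l))) = 0"
        using False by (intro sum.neutral) auto
      ultimately show ?thesis unfolding rhs by simp
    qed
  qed
qed

lemma subspace_ker_bdry:
  assumes "cfun.subspace V" shows "cfun.subspace {F \<in> V. bdry n F = 0}"
proof -
  have "bdry n (0::nat set \<Rightarrow> complex) = 0" by (rule ext) (simp add: bdry_def)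
  then show ?thesis using assms bdry_add[of n] bdry_scale[of n]
    unfolding cfun.subspace_def by (auto simp: fun_eq_iff)
qed

lemma finite_ksubsets [simp]: "finite (ksubsets n k)"
  unfolding ksubsets_def by (rule finite_subset[of _ "Pow {1..n}"]) auto

lemma bdry_avg_wedge_kernel:
  assumes n: "n > 0" and F: "F \<in> free_space (ksubsets n k)" "bdry n F = 0"
  shows "bdry n (avg_wedge n F) = F"
proof
  fix A
  have h0: "avg_wedge n (bdry n F) A = 0" unfolding F(2) by (simp add: avg_wedge_def)
  show "bdry n (avg_wedge n F) A = F A"
  proof (cases "A \<subseteq> {1..n}")
    case True
    then show ?thesis using bdry_avg_wedge[OF n True, of F] h0 by simp
  next
    case False
    have "bdry n (avg_wedge n F) \<in> free_space (ksubsets n k)" by (intro bdry_free avg_wedge_free F)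
    moreover have "A \<notin> ksubsets n k" using False by (simp add: ksubsets_def)
    ultimately show ?thesis using F(1) by (simp add: free_space_def)
  qed
qed

lemma tuple_of_ksubset:
  assumes "A \<in> ksubsets n k"
  obtains l where "l \<in> tuples n k" "set l = A" "distinct l"
proof -
  have "finite A" "A \<subseteq> {1..n}" "card A = k" using assms finite_subset[of A "{1..n}"] by (auto simp: ksubsets_def)
  then show ?thesis using that[of "sorted_list_of_set A"] by (simp add: tuples_def)
qed

text \<open>
  The polytabloids are, up to sign, the images of the boundaries of the basis vectors, so they span the
  image of the boundary map; by the contracting homotopy this is the kernel of the next one.
\<close>

lemma specht_module_hook:
  assumes k: "k < n"
  shows "specht_module (hook n k) = alt_ext n k ` {F \<in> free_space (ksubsets n k). bdry n F = 0}"
proof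
  let ?K = "{F \<in> free_space (ksubsets n k). bdry n F = 0}"
  have sK: "cfun.subspace ?K" by (intro subspace_ker_bdry subspace_free_space)
  interpret P: Vector_Spaces.linear "\<lambda>(c::complex) (f :: nat set \<Rightarrow> complex) x. c * f x"
    "\<lambda>(c::complex) (f :: nat set list \<Rightarrow> complex) x. c * f x" "alt_ext n k"
    unfolding Vector_Spaces.linear_iff using alt_ext_add alt_ext_scale by (auto intro: cfun.vector_space_axioms)
  interpret D: Vector_Spaces.linear "\<lambda>(c::complex) (f :: nat set \<Rightarrow> complex) x. c * f x"
    "\<lambda>(c::complex) (f :: nat set \<Rightarrow> complex) x. c * f x" "bdry n"
    unfolding Vector_Spaces.linear_iff using bdry_add bdry_scale by (auto intro: cfun.vector_space_axioms)
  have sI: "cfun.subspace (alt_ext n k ` ?K)" by (rule P.subspace_image[OF sK])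
  have delta: "bdry n (\<lambda>A. if A = C then 1 else 0) \<in> ?K" if C: "C \<in> ksubsets n (Suc k)" for C
  proof -
    let ?d = "\<lambda>A. if A = C then 1 else (0::complex)"
    have "?d \<in> free_space (ksubsets n (Suc k))" using C by (auto simp: free_space_def)
    then show ?thesis using bdry_free bdry_bdry_free by blast
  qed
  have legC: "set (t (0, 0) # leg k t) \<in> ksubsets n (Suc k)" if t: "t \<in> tableaux (hook n k)" for t
    using hook_tableauD[OF k t] by (auto simp: tuples_def ksubsets_def distinct_card)
  show "specht_module (hook n k) \<subseteq> alt_ext n k ` ?K"
    unfolding specht_module_def
  proof (rule cfun.span_minimal[OF _ sI], rule image_subsetI)
    fix t assume t: "t \<in> tableaux (hook n k)"
    show "polytabloid (hook n k) t \<in> alt_ext n k ` ?K"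
      unfolding polytabloid_hook[OF k t]
      by (intro cfun.subspace_scale[OF sI] imageI delta legC[OF t])
  qed
  show "alt_ext n k ` ?K \<subseteq> specht_module (hook n k)"
  proof (rule image_subsetI)
    fix F assume F: "F \<in> ?K"
    \<comment> \<open>the homotopy gives a preimage of \<open>F\<close> under the boundary, which is then expanded in basis vectors\<close>
    let ?G = "avg_wedge n F"
    have G: "?G \<in> free_space (ksubsets n (Suc k))" using F by (intro avg_wedge_free) simp
    have Gs: "?G = (\<Sum>C\<in>ksubsets n (Suc k). (\<lambda>A. ?G C * (if A = C then 1 else 0)))"
    proof
      fix A
      have "(\<Sum>C\<in>ksubsets n (Suc k). (\<lambda>A. ?G C * (if A = C then 1 else 0))) A =
        (\<Sum>C\<in>ksubsets n (Suc k). if C = A then ?G A else 0)"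
        unfolding sum_fun_app by (intro sum.cong) auto
      also have "\<dots> = ?G A" using G by (simp add: free_space_def)
      finally show "?G A = (\<Sum>C\<in>ksubsets n (Suc k). (\<lambda>A. ?G C * (if A = C then 1 else 0))) A" by simp
    qed
    have "F = bdry n ?G" using bdry_avg_wedge_kernel[of n F k] F k by simp
    also have "\<dots> = bdry n (\<Sum>C\<in>ksubsets n (Suc k). (\<lambda>A. ?G C * (if A = C then 1 else 0)))"
      by (rule arg_cong[OF Gs])
    also have "\<dots> = (\<Sum>C\<in>ksubsets n (Suc k). (\<lambda>B. ?G C * bdry n (\<lambda>A. if A = C then 1 else 0) B))"
      by (simp only: D.sum D.scale)
    finally have "alt_ext n k F = alt_ext n k (\<Sum>C\<in>ksubsets n (Suc k). (\<lambda>B. ?G C * bdry n (\<lambda>A. if A = C then 1 else 0) B))"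
      by (rule arg_cong)
    also have "\<dots> = (\<Sum>C\<in>ksubsets n (Suc k). (\<lambda>s. ?G C * alt_ext n k (bdry n (\<lambda>A. if A = C then 1 else 0)) s))"
      by (simp only: P.sum P.scale)
    also have "\<dots> \<in> specht_module (hook n k)"
      unfolding specht_module_def
    proof (intro cfun.span_sum cfun.span_scale)
      fix C assume C: "C \<in> ksubsets n (Suc k)"
      obtain c where c: "c \<in> tuples n (Suc k)" "set c = C" "distinct c" using tuple_of_ksubset[OF C] by blast
      then obtain x l where xl: "c = x # l" by (cases c) (auto simp: tuples_def)
      obtain t where t: "t \<in> tableaux (hook n k)" "t (0, 0) = x" "leg k t = l"
        using hook_tableau_exists[OF k, of x l] c unfolding xl by (auto simp: tuples_def)
      have eq: "alt_ext n k (bdry n (\<lambda>A. if A = C then 1 else 0)) = (\<lambda>s. list_sign c * polytabloid (hook n k) t s)"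
        unfolding polytabloid_hook[OF k t(1)] t(2,3) xl[symmetric] c(2)
        using list_sign_sq[OF c(3)] by (simp flip: mult.assoc)
      have "polytabloid (hook n k) t \<in> cfun.span (polytabloid (hook n k) ` tableaux (hook n k))"
        by (intro cfun.span_base imageI t(1))
      then show "alt_ext n k (bdry n (\<lambda>A. if A = C then 1 else 0)) \<in> cfun.span (polytabloid (hook n k) ` tableaux (hook n k))"
        unfolding eq by (rule cfun.span_scale)
    qed
    finally show "alt_ext n k F \<in> specht_module (hook n k)" .
  qed
qed

lemma hook_tabloid_map:
  assumes "\<sigma> permutes {1..n}"
  shows "map (image \<sigma>) (hook_tabloid n l) = hook_tabloid n (map \<sigma> l)"
proof -
  have "\<sigma> ` ({1..n} - set l) = {1..n} - \<sigma> ` set l"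
    using permutes_image[OF assms] permutes_inj[OF assms] by (simp add: image_set_diff)
  then show ?thesis by (simp add: hook_tabloid_def)
qed

lemma tuples_map: "\<sigma> permutes {1..n} \<Longrightarrow> l \<in> tuples n k \<Longrightarrow> map \<sigma> l \<in> tuples n k"
  using permutes_in_image[of \<sigma> "{1..n}"]
  by (auto simp: tuples_def distinct_map permutes_inj_on)

lemma map_funpow:
  fixes f :: "'a \<Rightarrow> 'a"
  shows "(map f ^^ m) l = map (f ^^ m) l"
  by (induction m) auto

lemma image_funpow:
  fixes f :: "'a \<Rightarrow> 'a"
  shows "((`) f ^^ m) A = (f ^^ m) ` A"
  by (induction m) (auto simp: image_image)

lemma alt_ext_inj: assumes "k < n" shows "inj_on (alt_ext n k) (free_space (ksubsets n k))"
proof (rule inj_onI)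
  fix F G assume F: "F \<in> free_space (ksubsets n k)" "G \<in> free_space (ksubsets n k)" "alt_ext n k F = alt_ext n k G"
  show "F = G"
  proof
    fix A show "F A = G A"
    proof (cases "A \<in> ksubsets n k")
      case True
      then obtain l where l: "l \<in> tuples n k" "set l = A" "distinct l" using tuple_of_ksubset by blast
      have "list_sign l * F A = list_sign l * G A"
        using fun_cong[OF F(3), of "hook_tabloid n l"] unfolding alt_ext_hook_tabloid[OF assms l(1)] l(2) .
      then show ?thesis using list_sign_nz[OF l(3)] by simp
    qed (use F in \<open>simp add: free_space_def\<close>)
  qed
qed

text \<open>
  The \<open>z\<close>-eigenspace of \<open>\<sigma>\<close> on the exterior power \<open>\<Lambda>^k \<complex>^n\<close>.
\<close>

definition ext_eigenspace :: "nat \<Rightarrow> nat \<Rightarrow> (nat \<Rightarrow> nat) \<Rightarrow> complex \<Rightarrow> (nat set \<Rightarrow> complex) set" where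
  "ext_eigenspace n k \<sigma> z = signed_eigenspace (ksubsets n k) (image \<sigma>) (subset_sign \<sigma>) z"

lemma ksubsets_image: "\<sigma> permutes {1..n} \<Longrightarrow> A \<in> ksubsets n k \<Longrightarrow> \<sigma> ` A \<in> ksubsets n k"
  using permutes_image[of \<sigma> "{1..n}"] by (auto simp: ksubsets_def card_image permutes_inj_on)

text \<open>
  The embedding \<open>alt_ext\<close> is equivariant: both sides of the eigenvector equation at a tuple \<open>l\<close> carry the sign of \<open>l\<close>, up to
  the sign of \<open>\<sigma>\<close> on the set of its entries.
\<close>

lemma eigenspace_specht_hook:
  assumes k: "k < n" and \<sigma>: "\<sigma> permutes {1..n}"
    and bij: "bij_betw (map (image \<sigma>)) (tabloids (hook n k)) (tabloids (hook n k))"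
  shows "eigenspace (specht_module (hook n k)) (rho_specht (hook n k) \<sigma>) z =
    alt_ext n k ` {F \<in> ext_eigenspace n k \<sigma> z. bdry n F = 0}"
proof -
  have iff: "rho_specht (hook n k) \<sigma> (alt_ext n k F) = (\<lambda>s. z * alt_ext n k F s) \<longleftrightarrow>
      (\<forall>A\<in>ksubsets n k. subset_sign \<sigma> A * F A = z * F (\<sigma> ` A))" for F
  proof -
    have P: "alt_ext n k F \<in> free_space (tabloids (hook n k))" by (simp add: free_space_def alt_ext_def)
    have one: "list_sign l * F (set l) = z * (list_sign (map \<sigma> l) * F (set (map \<sigma> l))) \<longleftrightarrow>
        subset_sign \<sigma> (set l) * F (set l) = z * F (\<sigma> ` set l)" if l: "l \<in> tuples n k" for l
    proof -
      have d: "distinct l" using l by (simp add: tuples_def)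
      let ?e = "subset_sign \<sigma> (set l)"
      have e2: "?e * ?e = 1" using \<sigma> by (intro subset_sign_sq permutes_inj_on) auto
      have "list_sign l * F (set l) = z * (list_sign (map \<sigma> l) * F (set (map \<sigma> l))) \<longleftrightarrow>
        list_sign l * F (set l) = list_sign l * (?e * (z * F (\<sigma> ` set l)))"
        unfolding list_sign_map[OF d] by (simp add: mult_ac)
      also have "\<dots> \<longleftrightarrow> F (set l) = ?e * (z * F (\<sigma> ` set l))" using list_sign_nz[OF d] by simp
      also have "\<dots> \<longleftrightarrow> ?e * F (set l) = z * F (\<sigma> ` set l)"
        using e2 by (metis mult.assoc mult_1)
      finally show ?thesis .
    qed
    have "rho_specht (hook n k) \<sigma> (alt_ext n k F) = (\<lambda>s. z * alt_ext n k F s) \<longleftrightarrow>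
      (\<forall>s\<in>tabloids (hook n k). alt_ext n k F s = z * alt_ext n k F (map (image \<sigma>) s))"
      unfolding rho_specht_def by (rule linear_ext_eigenvector_iff[OF bij P])
    also have "\<dots> \<longleftrightarrow> (\<forall>l\<in>tuples n k. list_sign l * F (set l) = z * (list_sign (map \<sigma> l) * F (set (map \<sigma> l))))"
      unfolding tabloids_hook[OF k] Ball_image_comp comp_def
      by (intro ball_cong refl) (simp only: hook_tabloid_map[OF \<sigma>] alt_ext_hook_tabloid[OF k] tuples_map[OF \<sigma>])
    also have "\<dots> \<longleftrightarrow> (\<forall>l\<in>tuples n k. subset_sign \<sigma> (set l) * F (set l) = z * F (\<sigma> ` set l))"
      using one by (intro ball_cong refl)
    also have "\<dots> \<longleftrightarrow> (\<forall>A\<in>ksubsets n k. subset_sign \<sigma> A * F A = z * F (\<sigma> ` A))"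
    proof
      assume *: "\<forall>l\<in>tuples n k. subset_sign \<sigma> (set l) * F (set l) = z * F (\<sigma> ` set l)"
      show "\<forall>A\<in>ksubsets n k. subset_sign \<sigma> A * F A = z * F (\<sigma> ` A)"
      proof
        fix A assume "A \<in> ksubsets n k"
        then obtain l where "l \<in> tuples n k" "set l = A" using tuple_of_ksubset by blast
        then show "subset_sign \<sigma> A * F A = z * F (\<sigma> ` A)" using * by blast
      qed
    next
      assume *: "\<forall>A\<in>ksubsets n k. subset_sign \<sigma> A * F A = z * F (\<sigma> ` A)"
      show "\<forall>l\<in>tuples n k. subset_sign \<sigma> (set l) * F (set l) = z * F (\<sigma> ` set l)"
        using * by (auto simp: tuples_def ksubsets_def distinct_card)
    qed
    finally show ?thesis .
  qed
  show ?thesis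
    unfolding eigenspace_def specht_module_hook[OF k] ext_eigenspace_def signed_eigenspace_def using iff by auto
qed

lemma dim_eigenspace_specht_hook:
  assumes k: "k < n" and \<sigma>: "\<sigma> permutes {1..n}"
    and bij: "bij_betw (map (image \<sigma>)) (tabloids (hook n k)) (tabloids (hook n k))"
  shows "cfun.dim (eigenspace (specht_module (hook n k)) (rho_specht (hook n k) \<sigma>) z) =
    cfun.dim {F \<in> ext_eigenspace n k \<sigma> z. bdry n F = 0}"
  unfolding eigenspace_specht_hook[OF assms]
proof (rule cfun_dim_image[OF _ alt_ext_add alt_ext_scale])
  show "cfun.subspace {F \<in> ext_eigenspace n k \<sigma> z. bdry n F = 0}"
    unfolding ext_eigenspace_def by (rule subspace_ker_bdry[OF subspace_signed_eigenspace[OF ksubsets_image[OF \<sigma>]]])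
  show "inj_on (alt_ext n k) {F \<in> ext_eigenspace n k \<sigma> z. bdry n F = 0}"
    by (rule inj_on_subset[OF alt_ext_inj[OF k]]) (auto simp: ext_eigenspace_def signed_eigenspace_def)
qed

text \<open>
  The eigenspace version of \<open>\<Lambda>^(k+1) = S_(k+1) \<oplus> S_k\<close>, where \<open>S_k\<close> is the kernel of the boundary on \<open>\<Lambda>^k\<close>. The boundary
  maps onto \<open>S_k\<close> with section \<open>avg_wedge\<close>, and both maps are equivariant.
\<close>

lemma dim_ext_eigenspace_split:
  assumes n: "n > 0" and \<sigma>: "\<sigma> permutes {1..n}"
  shows "cfun.dim (ext_eigenspace n (Suc k) \<sigma> z) =
    cfun.dim {F \<in> ext_eigenspace n (Suc k) \<sigma> z. bdry n F = 0} + cfun.dim {F \<in> ext_eigenspace n k \<sigma> z. bdry n F = 0}"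
proof (rule cfun_dim_split[where d = "bdry n" and h = "avg_wedge n" and B = "ksubsets n (Suc k)" and C = "ksubsets n k",
      OF _ _ _ _ _ _ bdry_add bdry_scale avg_wedge_add avg_wedge_scale])
  show "cfun.subspace (ext_eigenspace n (Suc k) \<sigma> z)"
    unfolding ext_eigenspace_def by (rule subspace_signed_eigenspace[OF ksubsets_image[OF \<sigma>]])
  show "cfun.subspace {F \<in> ext_eigenspace n k \<sigma> z. bdry n F = 0}"
    unfolding ext_eigenspace_def by (rule subspace_ker_bdry[OF subspace_signed_eigenspace[OF ksubsets_image[OF \<sigma>]]])
  show "ext_eigenspace n (Suc k) \<sigma> z \<subseteq> free_space (ksubsets n (Suc k))"
    "{F \<in> ext_eigenspace n k \<sigma> z. bdry n F = 0} \<subseteq> free_space (ksubsets n k)"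
    by (auto simp: ext_eigenspace_def signed_eigenspace_def)
  show "bdry n (avg_wedge n g) = g" if "g \<in> {F \<in> ext_eigenspace n k \<sigma> z. bdry n F = 0}" for g
    using that n by (intro bdry_avg_wedge_kernel[of _ _ k]) (auto simp: ext_eigenspace_def signed_eigenspace_def)
next
  fix f assume f: "f \<in> ext_eigenspace n (Suc k) \<sigma> z"
  then have ff: "f \<in> free_space (ksubsets n (Suc k))" by (simp add: ext_eigenspace_def signed_eigenspace_def)
  have fd: "bdry n f \<in> free_space (ksubsets n k)" by (rule bdry_free[OF ff])
  have "subset_sign \<sigma> A * bdry n f A = z * bdry n f (\<sigma> ` A)" if A: "A \<in> ksubsets n k" for A
  proof -
    have An: "A \<subseteq> {1..n}" and fA: "finite A" using A finite_subset[of A "{1..n}"] by (auto simp: ksubsets_def)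
    have "subset_sign \<sigma> A * bdry n f A = bdry n (\<lambda>A. z * f A) (\<sigma> ` A)"
    proof (rule bdry_equivariant[OF \<sigma> An])
      fix x assume "x \<in> {1..n} - A"
      then have "insert x A \<in> ksubsets n (Suc k)" using A fA by (auto simp: ksubsets_def)
      then show "subset_sign \<sigma> (insert x A) * f (insert x A) = z * f (\<sigma> ` insert x A)"
        using f by (simp add: ext_eigenspace_def signed_eigenspace_def del: image_insert)
    qed
    then show ?thesis by (simp add: bdry_scale)
  qed
  moreover have "bdry n (bdry n f) = 0" by (rule bdry_bdry_free[OF ff])
  ultimately show "bdry n f \<in> {F \<in> ext_eigenspace n k \<sigma> z. bdry n F = 0}" using fd by (simp add: ext_eigenspace_def signed_eigenspace_def)
next
  fix g assume "g \<in> {F \<in> ext_eigenspace n k \<sigma> z. bdry n F = 0}"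
  then have g: "g \<in> ext_eigenspace n k \<sigma> z" by simp
  then have gf: "g \<in> free_space (ksubsets n k)" by (simp add: ext_eigenspace_def signed_eigenspace_def)
  have "subset_sign \<sigma> A * avg_wedge n g A = z * avg_wedge n g (\<sigma> ` A)" if A: "A \<in> ksubsets n (Suc k)" for A
  proof -
    have An: "A \<subseteq> {1..n}" and fA: "finite A" using A finite_subset[of A "{1..n}"] by (auto simp: ksubsets_def)
    have "subset_sign \<sigma> A * avg_wedge n g A = avg_wedge n (\<lambda>A. z * g A) (\<sigma> ` A)"
    proof (rule avg_wedge_equivariant[OF \<sigma> An])
      fix x assume "x \<in> A"
      then have "A - {x} \<in> ksubsets n k" using A fA by (auto simp: ksubsets_def)
      then show "subset_sign \<sigma> (A - {x}) * g (A - {x}) = z * g (\<sigma> ` (A - {x}))"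
        using g by (simp add: ext_eigenspace_def signed_eigenspace_def)
    qed
    then show ?thesis by (simp add: avg_wedge_scale)
  qed
  then show "avg_wedge n g \<in> ext_eigenspace n (Suc k) \<sigma> z" using avg_wedge_free[OF gf] by (simp add: ext_eigenspace_def signed_eigenspace_def)
qed simp_all

lemma dim_ext_eigenspace_0: "{F \<in> ext_eigenspace n 0 \<sigma> z. bdry n F = 0} = ext_eigenspace n 0 \<sigma> z"
proof -
  have "bdry n F = 0" if "F \<in> ext_eigenspace n 0 \<sigma> z" for F
  proof
    fix A
    have "F (insert x A) = 0" for x
      using that finite_subset[of "insert x A" "{1..n}"]
      by (auto simp: ext_eigenspace_def signed_eigenspace_def free_space_def ksubsets_def card_eq_0_iff)
    then show "bdry n F A = 0 A" by (simp add: bdry_def)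
  qed
  then show ?thesis by auto
qed

text \<open>
  The witness \<open>G\<close> is the image of \<open>F\<close> under \<open>\<sigma>\<close> in the exterior power.
\<close>

lemma rho_specht_hook_invariant:
  assumes k: "k < n" and \<sigma>: "\<sigma> permutes {1..n}"
    and bij: "bij_betw (map (image \<sigma>)) (tabloids (hook n k)) (tabloids (hook n k))"
    and v: "v \<in> specht_module (hook n k)"
  shows "rho_specht (hook n k) \<sigma> v \<in> specht_module (hook n k)"
proof -
  obtain F where F: "v = alt_ext n k F" "F \<in> free_space (ksubsets n k)" "bdry n F = 0"
    using v unfolding specht_module_hook[OF k] by auto
  define i where "i = inv \<sigma>"
  have i: "i permutes {1..n}" unfolding i_def by (rule permutes_inv[OF \<sigma>])
  have iA: "i ` \<sigma> ` A = A" "\<sigma> ` i ` A = A" for A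
    unfolding i_def image_image by (simp_all add: permutes_inverses[OF \<sigma>])
  define G where "G B = subset_sign \<sigma> (i ` B) * F (i ` B)" for B
  have G: "G (\<sigma> ` A) = subset_sign \<sigma> A * F A" for A unfolding G_def iA ..
  have Gf: "G \<in> free_space (ksubsets n k)"
    unfolding free_space_def
  proof (intro CollectI allI impI)
    fix B assume "B \<notin> ksubsets n k"
    then have "i ` B \<notin> ksubsets n k" using ksubsets_image[OF \<sigma>, of "i ` B" k] iA by auto
    then show "G B = 0" using F(2) by (simp add: G_def free_space_def)
  qed
  have dG: "bdry n G = 0"
  proof
    fix B
    show "bdry n G B = 0 B"
    proof (cases "B \<subseteq> {1..n}")
      case True
      then have iB: "i ` B \<subseteq> {1..n}" using permutes_image[OF i] by blast
      have "subset_sign \<sigma> (i ` B) * bdry n F (i ` B) = bdry n G (\<sigma> ` i ` B)"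
        by (rule bdry_equivariant[OF \<sigma> iB]) (simp only: G)
      then show ?thesis unfolding iA F(3) by simp
    next
      case False
      then have "G (insert x B) = 0" for x using Gf by (simp add: free_space_def ksubsets_def)
      then show ?thesis by (simp add: bdry_def)
    qed
  qed
  have "rho_specht (hook n k) \<sigma> v = alt_ext n k G"
  proof
    fix s
    show "rho_specht (hook n k) \<sigma> v s = alt_ext n k G s"
    proof (cases "s \<in> tabloids (hook n k)")
      case False
      then show ?thesis unfolding rho_specht_def linear_ext_outside[OF bij False] by (simp add: alt_ext_def)
    next
      case True
      then obtain s' where s': "s' \<in> tabloids (hook n k)" "s = map (image \<sigma>) s'"
        using bij unfolding bij_betw_def by blast
      then obtain l where l: "l \<in> tuples n k" "s' = hook_tabloid n l" using tabloids_hook[OF k] by auto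
      have d: "distinct l" using l by (simp add: tuples_def)
      have e2: "subset_sign \<sigma> (set l) * subset_sign \<sigma> (set l) = 1" using \<sigma> by (intro subset_sign_sq permutes_inj_on) auto
      have "rho_specht (hook n k) \<sigma> v s = v s'"
        unfolding rho_specht_def s'(2) by (rule linear_ext_image[OF bij s'(1)])
      also have "\<dots> = list_sign l * F (set l)" unfolding F(1) l(2) alt_ext_hook_tabloid[OF k l(1)] ..
      also have "\<dots> = (subset_sign \<sigma> (set l) * subset_sign \<sigma> (set l)) * (list_sign l * F (set l))" unfolding e2 by simp
      also have "\<dots> = (subset_sign \<sigma> (set l) * list_sign l) * (subset_sign \<sigma> (set l) * F (set l))" by (simp only: mult_ac)
      also have "\<dots> = list_sign (map \<sigma> l) * G (set (map \<sigma> l))"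
        by (simp only: list_sign_map[OF d] list.set_map G)
      also have "\<dots> = alt_ext n k G s"
        unfolding s'(2) l(2) hook_tabloid_map[OF \<sigma>] alt_ext_hook_tabloid[OF k tuples_map[OF \<sigma> l(1)]] ..
      finally show ?thesis .
    qed
  qed
  then show ?thesis unfolding specht_module_hook[OF k] using Gf dG by auto
qed

lemma count_eigenangles_specht_hook:
  assumes k: "k < n" and \<sigma>: "\<sigma> permutes {1..n}" and N: "\<sigma> ^^ N = id" "N > 0"
  shows "count_eigenangles (specht_module (hook n k)) (rho_specht (hook n k) \<sigma>) \<alpha> \<beta> =
    (\<Sum>j\<in>{j::nat. j < N \<and> \<alpha> < j / N \<and> j / N < \<beta>}. cfun.dim {F \<in> ext_eigenspace n k \<sigma> (e2pi (j / N)). bdry n F = 0})"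
proof -
  have ord: "(map (image \<sigma>) ^^ N) s = s" for s
  proof -
    have "((`) \<sigma> ^^ N) = id" by (rule ext) (simp add: image_funpow N)
    then show ?thesis by (simp add: map_funpow)
  qed
  have inv: "map (image \<sigma>) s \<in> tabloids (hook n k)" if "s \<in> tabloids (hook n k)" for s
    using that tuples_map[OF \<sigma>] by (auto simp: tabloids_hook[OF k] hook_tabloid_map[OF \<sigma>])
  obtain M where M: "N = Suc M" using N(2) by (cases N) auto
  have bij: "bij_betw (map (image \<sigma>)) (tabloids (hook n k)) (tabloids (hook n k))"
    by (rule bij_betw_of_funpow[of _ _ M, OF inv]) (use ord M in auto)
  have sub: "specht_module (hook n k) \<subseteq> free_space (tabloids (hook n k))"
    unfolding specht_module_hook[OF k] by (auto simp: alt_ext_def free_space_def)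
  show ?thesis
    unfolding dim_eigenspace_specht_hook[OF k \<sigma> bij, symmetric]
  proof (rule count_eigenangles_finite_order)
    show "cfun.subspace (specht_module (hook n k))" unfolding specht_module_def by (rule cfun.subspace_span)
    show "rho_specht (hook n k) \<sigma> f \<in> specht_module (hook n k)" if "f \<in> specht_module (hook n k)" for f
      by (rule rho_specht_hook_invariant[OF k \<sigma> bij that])
    show "(rho_specht (hook n k) \<sigma> ^^ N) f = f" if "f \<in> specht_module (hook n k)" for f
      unfolding rho_specht_def by (rule linear_ext_funpow[OF bij ord]) (use that sub in auto)
    show "0 < N" by fact
  qed (simp_all only: rho_specht_def linear_ext_add linear_ext_scale)
qed

section \<open>Sums over lists and pairs of entries\<close>

definition lists_of :: "nat \<Rightarrow> nat \<Rightarrow> nat list set" where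
  "lists_of n k = {t. set t \<subseteq> {1..n} \<and> length t = k}"

lemma finite_lists_of [simp]: "finite (lists_of n k)"
  unfolding lists_of_def by (rule finite_lists_length_eq) simp

lemma card_lists_of: "card (lists_of n k) = n ^ k"
  unfolding lists_of_def by (simp add: card_lists_length_eq)

lemma sum_lists_of_Suc:
  "(\<Sum>t\<in>lists_of n (Suc k). f t) = (\<Sum>x\<in>{1..n}. \<Sum>s\<in>lists_of n k. f (x # s))"
proof -
  have "lists_of n (Suc k) = (\<lambda>(x, s). x # s) ` ({1..n} \<times> lists_of n k)"
  proof
    show "lists_of n (Suc k) \<subseteq> (\<lambda>(x, s). x # s) ` ({1..n} \<times> lists_of n k)"
    proof
      fix t assume "t \<in> lists_of n (Suc k)"
      then obtain x s where "t = x # s" "x \<in> {1..n}" "s \<in> lists_of n k"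
        by (cases t) (auto simp: lists_of_def)
      then show "t \<in> (\<lambda>(x, s). x # s) ` ({1..n} \<times> lists_of n k)" by (intro image_eqI[of _ _ "(x, s)"]) auto
    qed
  qed (auto simp: lists_of_def)
  moreover have "inj_on (\<lambda>(x, s). x # s) ({1..n} \<times> lists_of n k)" by (auto simp: inj_on_def)
  ultimately show ?thesis by (simp add: sum.reindex sum.cartesian_product case_prod_unfold)
qed

lemma lists_of_0: "lists_of n 0 = {[]}" by (auto simp: lists_of_def)

lemma sum_lists_sum_list:
  fixes g :: "nat \<Rightarrow> real"
  shows "(\<Sum>s\<in>lists_of n (Suc k). \<Sum>y\<leftarrow>s. g y) = Suc k * real n ^ k * (\<Sum>y\<in>{1..n}. g y)"
proof (induction k)
  case 0 then show ?case by (simp add: sum_lists_of_Suc lists_of_0)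
next
  case (Suc k)
  have "(\<Sum>s\<in>lists_of n (Suc (Suc k)). \<Sum>y\<leftarrow>s. g y) =
    (\<Sum>x\<in>{1..n}. \<Sum>s\<in>lists_of n (Suc k). g x + (\<Sum>y\<leftarrow>s. g y))"
    by (subst sum_lists_of_Suc) simp
  also have "\<dots> = real n ^ Suc k * (\<Sum>y\<in>{1..n}. g y) + real n * (\<Sum>s\<in>lists_of n (Suc k). \<Sum>y\<leftarrow>s. g y)"
    by (simp add: sum.distrib card_lists_of sum_distrib_left)
  finally show ?case unfolding Suc by (simp add: algebra_simps)
qed

fun list_pair_sum :: "(nat \<Rightarrow> nat \<Rightarrow> real) \<Rightarrow> nat list \<Rightarrow> real" where
  "list_pair_sum q [] = 0"
| "list_pair_sum q (x # s) = (\<Sum>y\<leftarrow>s. q x y) + list_pair_sum q s"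

fun has_pair :: "(nat \<Rightarrow> nat \<Rightarrow> bool) \<Rightarrow> nat list \<Rightarrow> bool" where
  "has_pair P [] = False"
| "has_pair P (x # s) = ((\<exists>y\<in>set s. P x y) \<or> has_pair P s)"

lemma list_pair_sum_nonneg: "(\<And>x y. 0 \<le> q x y) \<Longrightarrow> 0 \<le> list_pair_sum q t"
proof (induction t)
  case (Cons x s)
  have "0 \<le> (\<Sum>y\<leftarrow>s. q x y)" by (rule sum_list_nonneg) (use Cons.prems in auto)
  then show ?case using Cons by simp
qed simp

lemma list_pair_sum_ge:
  assumes q: "\<And>x y. 0 \<le> q x y" and P: "\<And>x y. P x y \<Longrightarrow> x \<in> set t \<Longrightarrow> y \<in> set t \<Longrightarrow> c \<le> q x y"
    and h: "has_pair P t"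
  shows "c \<le> list_pair_sum q t"
  using P h
proof (induction t)
  case (Cons x s)
  have nn: "0 \<le> (\<Sum>y\<leftarrow>s. q x y)" by (rule sum_list_nonneg) (use q in auto)
  show ?case
  proof (cases "has_pair P s")
    case True
    then have "c \<le> list_pair_sum q s" using Cons.IH Cons.prems(1) by simp
    then show ?thesis using nn by simp
  next
    case False
    then obtain y where y: "y \<in> set s" "P x y" using Cons.prems(2) by auto
    have "c \<le> q x y" using Cons.prems(1)[OF y(2)] y by simp
    also have "q x y \<le> (\<Sum>y\<leftarrow>s. q x y)" using y(1) q by (intro member_le_sum_list) auto
    finally show ?thesis using list_pair_sum_nonneg[of q s] q by simp
  qed
qed simp

text \<open>
  A list of length \<open>m + 2\<close> has at most \<open>(m + 2)^2\<close> pairs of positions, and prescribing the entries at one pair of positions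
  leaves \<open>n^m\<close> lists.
\<close>

lemma sum_list_pair_sum_le:
  assumes q: "\<And>x y. 0 \<le> q x y"
  shows "(\<Sum>t\<in>lists_of n (Suc (Suc m)). list_pair_sum q t) \<le> (real m + 2) ^ 2 * real n ^ m * (\<Sum>x\<in>{1..n}. \<Sum>y\<in>{1..n}. q x y)"
proof (induction m)
  case 0
  have "0 \<le> (\<Sum>x\<in>{1..n}. \<Sum>y\<in>{1..n}. q x y)" using q by (intro sum_nonneg) auto
  then show ?case by (simp add: sum_lists_of_Suc lists_of_0)
next
  case (Suc m)
  let ?W = "\<Sum>x\<in>{1..n}. \<Sum>y\<in>{1..n}. q x y"
  have W: "0 \<le> ?W" using q by (intro sum_nonneg) auto
  have "(\<Sum>t\<in>lists_of n (Suc (Suc (Suc m))). list_pair_sum q t) =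
     (\<Sum>x\<in>{1..n}. (\<Sum>s\<in>lists_of n (Suc (Suc m)). \<Sum>y\<leftarrow>s. q x y)) +
     real n * (\<Sum>s\<in>lists_of n (Suc (Suc m)). list_pair_sum q s)"
    by (subst sum_lists_of_Suc) (simp add: sum.distrib)
  also have "(\<Sum>x\<in>{1..n}. (\<Sum>s\<in>lists_of n (Suc (Suc m)). \<Sum>y\<leftarrow>s. q x y)) = (real m + 2) * real n ^ Suc m * ?W"
    unfolding sum_lists_sum_list by (simp add: sum_distrib_left add.commute)
  also have "real n * (\<Sum>s\<in>lists_of n (Suc (Suc m)). list_pair_sum q s) \<le> real n * ((real m + 2) ^ 2 * real n ^ m * ?W)"
    using Suc by (intro mult_left_mono) auto
  also have "(real m + 2) * real n ^ Suc m * ?W + real n * ((real m + 2) ^ 2 * real n ^ m * ?W) =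
     ((real m + 2) + (real m + 2) ^ 2) * (real n ^ Suc m * ?W)" by (simp add: algebra_simps)
  also have "\<dots> \<le> (real (Suc m) + 2) ^ 2 * (real n ^ Suc m * ?W)"
    using W by (intro mult_right_mono) (auto simp: power2_eq_square algebra_simps)
  finally show ?case by (simp add: mult.assoc)
qed

locale perm_on =
  fixes n :: nat and \<sigma> :: "nat \<Rightarrow> nat"
  assumes perm: "\<sigma> permutes {1..n}"
begin

definition len :: "nat \<Rightarrow> nat" where "len x = card (orbit \<sigma> x)"

text \<open>
  Every cycle length is at most \<open>n\<close> and so divides \<open>n!\<close>.
\<close>

lemma funpow_fact: "(\<sigma> ^^ fact n) x = x"
proof (cases "x \<in> {1..n}")
  case True
  have p: "permutation \<sigma>" using perm by (auto simp: permutation_permutes)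
  then have self: "x \<in> orbit \<sigma> x" by (rule permutation_self_in_orbit)
  then obtain N where "x = (\<sigma> ^^ N) x" "N > 0" unfolding orbit_altdef by auto
  then have N: "(\<sigma> ^^ N) x = x" "N > 0" by simp_all
  have "card (orbit \<sigma> x) \<le> n"
    using card_mono[OF _ permutes_orbit_subset[OF perm True]] by simp
  then have "card (orbit \<sigma> x) dvd fact n" using orbit_period(1)[OF N] by (intro dvd_fact) auto
  then show ?thesis using orbit_period(2)[OF N] by simp
next
  case False
  then have "\<sigma> x = x" using perm by (intro permutes_not_in)
  then have "(\<sigma> ^^ m) x = x" for m by (induction m) auto
  then show ?thesis .
qed

lemma funpow_fact_id: "\<sigma> ^^ fact n = id" using funpow_fact by auto

lemmas period_facts = orbit_period[OF funpow_fact fact_gt_zero, folded len_def]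

lemma len_dvd_iff: "(\<sigma> ^^ m) x = x \<longleftrightarrow> len x dvd m" by (rule period_facts(2))

lemma orbit_of_mem: "y \<in> orbit \<sigma> x \<Longrightarrow> orbit \<sigma> y = orbit \<sigma> x"
  by (rule orbit_eq_of_mem[OF funpow_fact fact_gt_zero])

lemma orbit_subset: "x \<in> {1..n} \<Longrightarrow> orbit \<sigma> x \<subseteq> {1..n}"
  by (rule permutes_orbit_subset[OF perm])

text \<open>
  Good pairs are those for which the list behaves like a generic one: distinct points of one cycle such that no power of \<open>\<sigma>\<close>
  that moves \<open>x\<close> to \<open>y\<close> has order dividing \<open>K\<close> on the cycle. With \<open>K = k!\<close> the last condition prevents a
  \<open>k\<close>-subset of a cycle from having a smaller period than the cycle.
\<close>

definition bad_pair :: "nat \<Rightarrow> nat \<Rightarrow> nat \<Rightarrow> bool" where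
  "bad_pair K x y \<longleftrightarrow> x = y \<or> y \<notin> orbit \<sigma> x \<or> (\<exists>i. y = (\<sigma> ^^ i) x \<and> len x dvd i * K)"

definition bad_weight :: "nat \<Rightarrow> nat \<Rightarrow> nat \<Rightarrow> real" where
  "bad_weight K x y = (if bad_pair K x y then 1 / real (lcm (len x) (len y)) else 0)"

lemma bad_weight_nonneg: "0 \<le> bad_weight K x y" by (simp add: bad_weight_def)

definition inv_len_sum :: real where "inv_len_sum = (\<Sum>x\<in>{1..n}. 1 / real (len x))"

definition inv_lcm_sum :: real where
  "inv_lcm_sum = (\<Sum>x\<in>{1..n}. \<Sum>y\<in>{1..n} - orbit \<sigma> x. 1 / real (lcm (len x) (len y)))"

text \<open>
  Any common multiple \<open>D\<close> of the cycle lengths of the entries is at least the least common multiple for the bad pair.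
  This turns a bound \<open>1 / D\<close> for the contribution of a bad list into a sum over its pairs.
\<close>

lemma bad_weight_list_pair_sum:
  assumes h: "has_pair (bad_pair K) t" and D: "D > 0" "\<And>y. y \<in> set t \<Longrightarrow> len y dvd D"
  shows "1 / real D \<le> list_pair_sum (bad_weight K) t"
proof (rule list_pair_sum_ge[OF bad_weight_nonneg _ h])
  fix x y assume b: "bad_pair K x y" and xy: "x \<in> set t" "y \<in> set t"
  have "lcm (len x) (len y) dvd D" using D(2) xy by simp
  then have "lcm (len x) (len y) \<le> D" using D(1) by (rule dvd_imp_le)
  moreover have "lcm (len x) (len y) > 0" using period_facts(1) by (simp add: lcm_pos_nat)
  ultimately show "1 / real D \<le> bad_weight K x y" using b by (simp add: bad_weight_def field_simps)
qed

text \<open>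
  The exponents \<open>i\<close> below \<open>len x\<close> for which \<open>len x\<close> divides \<open>i * K\<close> are determined by the quotient, which is
  less than \<open>K\<close>.
\<close>

lemma special_card:
  assumes x: "x \<in> {1..n}" and K: "K > 0"
  shows "card {y \<in> orbit \<sigma> x. \<exists>i. y = (\<sigma> ^^ i) x \<and> len x dvd i * K} \<le> K"
proof -
  let ?S = "{i. i < len x \<and> len x dvd i * K}"
  have "{y \<in> orbit \<sigma> x. \<exists>i. y = (\<sigma> ^^ i) x \<and> len x dvd i * K} \<subseteq> (\<lambda>i. (\<sigma> ^^ i) x) ` ?S"
  proof
    fix y assume "y \<in> {y \<in> orbit \<sigma> x. \<exists>i. y = (\<sigma> ^^ i) x \<and> len x dvd i * K}"
    then obtain i where i: "y = (\<sigma> ^^ i) x" "len x dvd i * K" by auto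
    have l: "(\<sigma> ^^ len x) x = x" using len_dvd_iff by simp
    have "y = (\<sigma> ^^ (i mod len x)) x" using i(1) funpow_mod_eq[OF l, of i] by simp
    moreover have "len x dvd (i mod len x) * K" using i(2) by (metis dvd_eq_mod_eq_0 mod_mult_left_eq)
    ultimately show "y \<in> (\<lambda>i. (\<sigma> ^^ i) x) ` ?S" using period_facts(1)[of x] by auto
  qed
  then have "card {y \<in> orbit \<sigma> x. \<exists>i. y = (\<sigma> ^^ i) x \<and> len x dvd i * K} \<le> card ?S"
    by (intro surj_card_le) auto
  also have "card ?S \<le> card {..<K}"
  proof (rule card_inj_on_le[of "\<lambda>i. i * K div len x"])
    show "inj_on (\<lambda>i. i * K div len x) ?S"
    proof (rule inj_onI)
      fix i j assume ij: "i \<in> ?S" "j \<in> ?S" "i * K div len x = j * K div len x"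
      then have "i * K = j * K" by (metis (mono_tags, lifting) dvd_div_mult_self mem_Collect_eq)
      then show "i = j" using K by simp
    qed
    show "(\<lambda>i. i * K div len x) ` ?S \<subseteq> {..<K}"
    proof (rule image_subsetI)
      fix i assume "i \<in> ?S"
      then have "i * K < K * len x" using K by simp
      then show "i * K div len x \<in> {..<K}" by (simp add: less_mult_imp_div_less)
    qed
  qed simp
  finally show ?thesis by simp
qed

lemma len_orbit: "y \<in> orbit \<sigma> x \<Longrightarrow> len y = len x"
  by (simp add: len_def orbit_of_mem)

lemma sum_bad_weight_le:
  assumes K: "K > 0"
  shows "(\<Sum>x\<in>{1..n}. \<Sum>y\<in>{1..n}. bad_weight K x y) \<le> (1 + real K) * inv_len_sum + inv_lcm_sum"
proof -
  have "(\<Sum>y\<in>{1..n}. bad_weight K x y) \<le> (1 + real K) * (1 / len x) + (\<Sum>y\<in>{1..n} - orbit \<sigma> x. 1 / real (lcm (len x) (len y)))"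
    if x: "x \<in> {1..n}" for x
  proof -
    define S where "S = {y \<in> orbit \<sigma> x. \<exists>i. y = (\<sigma> ^^ i) x \<and> len x dvd i * K}"
    have cS: "card S \<le> K" unfolding S_def by (rule special_card[OF x K])
    have So: "S \<subseteq> orbit \<sigma> x" by (auto simp: S_def)
    have x0: "x \<in> orbit \<sigma> x" by (rule period_facts(5))
    have fo: "finite (orbit \<sigma> x)" using orbit_subset[OF x] finite_subset by blast
    have "(\<Sum>y\<in>{1..n}. bad_weight K x y) = (\<Sum>y\<in>{1..n} - orbit \<sigma> x. bad_weight K x y) + (\<Sum>y\<in>orbit \<sigma> x. bad_weight K x y)"
      using orbit_subset[OF x] by (intro sum.subset_diff) auto
    also have "(\<Sum>y\<in>{1..n} - orbit \<sigma> x. bad_weight K x y) = (\<Sum>y\<in>{1..n} - orbit \<sigma> x. 1 / real (lcm (len x) (len y)))"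
      by (intro sum.cong refl) (auto simp: bad_weight_def bad_pair_def)
    also have "(\<Sum>y\<in>orbit \<sigma> x. bad_weight K x y) = (\<Sum>y\<in>insert x S. bad_weight K x y)"
      using fo So x0 by (intro sum.mono_neutral_right) (auto simp: bad_weight_def bad_pair_def S_def)
    also have "\<dots> \<le> (\<Sum>y\<in>insert x S. 1 / len x)"
    proof (rule sum_mono)
      fix y assume "y \<in> insert x S"
      then have "y \<in> orbit \<sigma> x" using So x0 by blast
      then have "len y = len x" by (rule len_orbit)
      then show "bad_weight K x y \<le> 1 / len x" by (simp add: bad_weight_def)
    qed
    also have "\<dots> = card (insert x S) * (1 / len x)" by (rule sum_constant)
    also have "\<dots> \<le> (1 + real K) * (1 / len x)"
    proof (rule mult_right_mono)
      have "card (insert x S) \<le> 1 + card S" using finite_subset[OF So fo] by (simp add: card_insert_if)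
      then show "real (card (insert x S)) \<le> 1 + real K" using cS by linarith
    qed simp
    finally show ?thesis by simp
  qed
  then have "(\<Sum>x\<in>{1..n}. \<Sum>y\<in>{1..n}. bad_weight K x y) \<le>
    (\<Sum>x\<in>{1..n}. (1 + real K) * (1 / len x) + (\<Sum>y\<in>{1..n} - orbit \<sigma> x. 1 / real (lcm (len x) (len y))))"
    by (rule sum_mono)
  then show ?thesis by (simp add: sum.distrib inv_len_sum_def inv_lcm_sum_def sum_distrib_left)
qed

text \<open>
  The idealised contribution of a list, as if every list with all its entries on one cycle had the period of that cycle. The
  repeated entries are included on purpose, because then the sum over all lists is exactly a power sum of cycle
  lengths.
\<close>

definition one_cycle_value :: "(nat \<Rightarrow> real) \<Rightarrow> nat list \<Rightarrow> real" where
  "one_cycle_value h t = (if set t \<subseteq> orbit \<sigma> (hd t) then h (len (hd t)) / len (hd t) else 0)"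

lemma sum_one_cycle_value:
  "(\<Sum>t\<in>lists_of n (Suc (Suc m)). one_cycle_value h t) = (\<Sum>x\<in>{1..n}. real (len x) ^ m * h (len x))"
proof -
  have "(\<Sum>s\<in>lists_of n (Suc m). one_cycle_value h (x # s)) = real (len x) ^ m * h (len x)" if x: "x \<in> {1..n}" for x
  proof -
    have fo: "finite (orbit \<sigma> x)" using orbit_subset[OF x] finite_subset by blast
    have "(\<Sum>s\<in>lists_of n (Suc m). one_cycle_value h (x # s)) =
       (\<Sum>s\<in>{s. set s \<subseteq> orbit \<sigma> x \<and> length s = Suc m}. h (len x) / len x)"
      using period_facts(5)[of x] orbit_subset[OF x] by (intro sum.mono_neutral_cong_right) (auto simp: one_cycle_value_def lists_of_def finite_lists_length_eq)
    also have "\<dots> = real (len x ^ Suc m) * (h (len x) / len x)"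
      using fo by (simp add: card_lists_length_eq len_def)
    also have "\<dots> = real (len x) ^ m * h (len x)" using period_facts(1)[of x] by simp
    finally show ?thesis .
  qed
  then show ?thesis by (subst sum_lists_of_Suc) (rule sum.cong[OF refl])
qed

lemma good_list:
  assumes "\<not> has_pair (bad_pair K) t"
  shows "distinct t" "\<And>y. t \<noteq> [] \<Longrightarrow> y \<in> set t \<Longrightarrow> y \<in> orbit \<sigma> (hd t)"
    "\<And>y i. t \<noteq> [] \<Longrightarrow> y \<in> set t \<Longrightarrow> y = (\<sigma> ^^ i) (hd t) \<Longrightarrow> len (hd t) dvd i * K \<Longrightarrow> y = hd t"
proof -
  show "distinct t" using assms by (induction t) (auto simp: bad_pair_def)
  show "y \<in> orbit \<sigma> (hd t)" if "t \<noteq> []" "y \<in> set t" for y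
    using that assms period_facts(5) by (cases t) (auto simp: bad_pair_def)
  show "y = hd t" if "t \<noteq> []" "y \<in> set t" "y = (\<sigma> ^^ i) (hd t)" "len (hd t) dvd i * K" for y i
  proof (rule ccontr)
    assume "y \<noteq> hd t"
    then have "bad_pair K (hd t) y" "y \<in> set (tl t)" using that by (cases t; auto simp: bad_pair_def)+
    then show False using assms that(1) by (cases t) auto
  qed
qed

text \<open>
  On lists without bad pair the function \<open>\<phi>\<close> agrees with \<open>one_cycle_value\<close>, and on the others both are bounded, up to a constant,
  by the weights of the pairs.
\<close>

lemma list_sum_comparison:
  fixes \<phi> :: "nat list \<Rightarrow> real"
  assumes h: "\<And>j. \<bar>h j\<bar> \<le> 1" and K: "K > 0" and C: "C \<ge> 0"
    and good: "\<And>t. t \<in> lists_of n (Suc (Suc m)) \<Longrightarrow> \<not> has_pair (bad_pair K) t \<Longrightarrow> \<phi> t = h (len (hd t)) / len (hd t)"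
    and badt: "\<And>t. t \<in> lists_of n (Suc (Suc m)) \<Longrightarrow> has_pair (bad_pair K) t \<Longrightarrow> \<bar>\<phi> t\<bar> \<le> C * list_pair_sum (bad_weight K) t"
  shows "\<bar>(\<Sum>t\<in>lists_of n (Suc (Suc m)). \<phi> t) - (\<Sum>x\<in>{1..n}. real (len x) ^ m * h (len x))\<bar> \<le>
    (C + 1) * ((real m + 2) ^ 2 * real n ^ m * ((1 + real K) * inv_len_sum + inv_lcm_sum))"
proof -
  let ?L = "lists_of n (Suc (Suc m))"
  have term_bound: "\<bar>\<phi> t - one_cycle_value h t\<bar> \<le> (C + 1) * list_pair_sum (bad_weight K) t" if t: "t \<in> ?L" for t
  proof (cases "has_pair (bad_pair K) t")
    case True
    have "\<bar>one_cycle_value h t\<bar> \<le> list_pair_sum (bad_weight K) t"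
    proof (cases "set t \<subseteq> orbit \<sigma> (hd t)")
      case mono: True
      have "\<bar>one_cycle_value h t\<bar> \<le> 1 / real (len (hd t))"
        using h[of "len (hd t)"] period_facts(1)[of "hd t"] mono by (simp add: one_cycle_value_def abs_divide divide_right_mono)
      also have "\<dots> \<le> list_pair_sum (bad_weight K) t"
        using period_facts(1)[of "hd t"] mono len_orbit by (intro bad_weight_list_pair_sum[OF True]) auto
      finally show ?thesis .
    next
      case False
      then show ?thesis using list_pair_sum_nonneg[OF bad_weight_nonneg] by (simp add: one_cycle_value_def)
    qed
    moreover have "\<bar>\<phi> t\<bar> \<le> C * list_pair_sum (bad_weight K) t" by (rule badt[OF t True])
    ultimately have "\<bar>\<phi> t - one_cycle_value h t\<bar> \<le> C * list_pair_sum (bad_weight K) t + list_pair_sum (bad_weight K) t" by linarith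
    then show ?thesis by (simp add: algebra_simps)
  next
    case False
    have "t \<noteq> []" using t by (auto simp: lists_of_def)
    then have "one_cycle_value h t = h (len (hd t)) / len (hd t)" using good_list(2)[OF False] by (auto simp: one_cycle_value_def)
    then have "\<bar>\<phi> t - one_cycle_value h t\<bar> = 0" using good[OF t False] by simp
    moreover have "0 \<le> (C + 1) * list_pair_sum (bad_weight K) t" using list_pair_sum_nonneg[OF bad_weight_nonneg] C by (intro mult_nonneg_nonneg) auto
    ultimately show ?thesis by simp
  qed
  have "\<bar>(\<Sum>t\<in>?L. \<phi> t) - (\<Sum>x\<in>{1..n}. real (len x) ^ m * h (len x))\<bar> = \<bar>\<Sum>t\<in>?L. \<phi> t - one_cycle_value h t\<bar>"
    by (simp add: sum_subtractf sum_one_cycle_value)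
  also have "\<dots> \<le> (\<Sum>t\<in>?L. \<bar>\<phi> t - one_cycle_value h t\<bar>)" by (rule sum_abs)
  also have "\<dots> \<le> (\<Sum>t\<in>?L. (C + 1) * list_pair_sum (bad_weight K) t)" using term_bound by (rule sum_mono)
  also have "\<dots> = (C + 1) * (\<Sum>t\<in>?L. list_pair_sum (bad_weight K) t)" by (simp add: sum_distrib_left)
  also have "\<dots> \<le> (C + 1) * ((real m + 2) ^ 2 * real n ^ m * (\<Sum>x\<in>{1..n}. \<Sum>y\<in>{1..n}. bad_weight K x y))"
    using sum_list_pair_sum_le[OF bad_weight_nonneg] C by (intro mult_left_mono) auto
  also have "\<dots> \<le> (C + 1) * ((real m + 2) ^ 2 * real n ^ m * ((1 + real K) * inv_len_sum + inv_lcm_sum))"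
    using sum_bad_weight_le[OF K] C by (intro mult_left_mono) auto
  finally show ?thesis .
qed

end

section \<open>Eigenangle counts in terms of cycle lengths\<close>

lemma abs_frac_diff_le: "\<bar>frac_diff \<alpha> \<beta> j\<bar> \<le> 1"
  unfolding frac_diff_def using frac_ge_0[of "j * \<alpha>"] frac_lt_1[of "j * \<alpha>"]
    frac_ge_0[of "j * \<beta>"] frac_lt_1[of "j * \<beta>"] by linarith

lemma finite_tuples: "finite (tuples n k)"
  by (rule finite_subset[OF _ finite_lists_of[of n k]]) (auto simp: tuples_def lists_of_def)

lemma sum_ksubsets_tuples:
  fixes f :: "nat set \<Rightarrow> real"
  shows "(\<Sum>t\<in>tuples n k. f (set t)) = fact k * (\<Sum>A\<in>ksubsets n k. f A)"
proof -
  have "(\<Sum>t\<in>tuples n k. f (set t)) = (\<Sum>A\<in>ksubsets n k. \<Sum>t | t \<in> tuples n k \<and> set t = A. f (set t))"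
    using finite_tuples by (intro sum.group[symmetric]) (auto simp: tuples_def ksubsets_def distinct_card)
  also have "\<dots> = (\<Sum>A\<in>ksubsets n k. fact k * f A)"
  proof (rule sum.cong[OF refl])
    fix A assume A: "A \<in> ksubsets n k"
    have fA: "finite A" using A finite_subset[of A "{1..n}"] by (auto simp: ksubsets_def)
    have "{t. t \<in> tuples n k \<and> set t = A} = permutations_of_set A"
      using A by (auto simp: tuples_def ksubsets_def permutations_of_set_def distinct_card)
    then have "card {t. t \<in> tuples n k \<and> set t = A} = fact k"
      using A fA by (simp add: ksubsets_def)
    moreover have "(\<Sum>t | t \<in> tuples n k \<and> set t = A. f (set t)) = (\<Sum>t | t \<in> tuples n k \<and> set t = A. f A)"
      by (rule sum.cong) auto
    ultimately show "(\<Sum>t | t \<in> tuples n k \<and> set t = A. f (set t)) = fact k * f A" by simp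
  qed
  finally show ?thesis by (simp add: sum_distrib_left)
qed

lemma subset_sign_comp:
  assumes "finite A" "inj_on f A"
  shows "subset_sign (g \<circ> f) A = subset_sign g (f ` A) * subset_sign f A"
proof -
  let ?l = "sorted_list_of_set A"
  have d: "distinct ?l" "distinct (map f ?l)" "set ?l = A" using assms by (auto simp: distinct_map)
  have "subset_sign (g \<circ> f) A = list_sign (map g (map f ?l)) * list_sign ?l" by (simp add: subset_sign_def)
  also have "list_sign (map g (map f ?l)) = subset_sign g (set (map f ?l)) * list_sign (map f ?l)" by (rule list_sign_map[OF d(2)])
  also have "set (map f ?l) = f ` A" using d(3) by simp
  finally show ?thesis by (simp only: subset_sign_def[of f A] mult.assoc)
qed

lemma subset_sign_fixed:
  assumes "finite A" "\<And>x. x \<in> A \<Longrightarrow> f x = x"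
  shows "subset_sign f A = 1"
proof -
  let ?l = "sorted_list_of_set A"
  have "map f ?l = ?l" using assms by (intro map_idI) auto
  then show ?thesis using list_sign_sq[of ?l] by (simp add: subset_sign_def)
qed

context perm_on begin

definition tuple_period :: "nat list \<Rightarrow> nat" where "tuple_period t = card (orbit (map \<sigma>) t)"
definition set_period :: "nat set \<Rightarrow> nat" where "set_period A = card (orbit ((`) \<sigma>) A)"

lemma map_fact: "(map \<sigma> ^^ fact n) t = t"
  by (simp add: map_funpow funpow_fact_id)

lemma image_fact: "((`) \<sigma> ^^ fact n) A = A"
  by (simp add: image_funpow funpow_fact_id)

lemmas tuple_period_facts = orbit_period[OF map_fact fact_gt_zero, folded tuple_period_def]
lemmas set_period_facts = orbit_period[OF image_fact fact_gt_zero, folded set_period_def]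

lemma tuple_period_dvd_iff: "tuple_period t dvd m \<longleftrightarrow> (\<forall>y\<in>set t. len y dvd m)"
proof -
  have "tuple_period t dvd m \<longleftrightarrow> map (\<sigma> ^^ m) t = map id t" unfolding tuple_period_facts(2)[symmetric] map_funpow by simp
  also have "\<dots> \<longleftrightarrow> (\<forall>y\<in>set t. (\<sigma> ^^ m) y = y)" unfolding map_eq_conv by simp
  finally show ?thesis by (simp only: len_dvd_iff)
qed

lemma set_period_image: "(\<sigma> ^^ set_period A) ` A = A"
  using set_period_facts(2)[of "set_period A" A] by (simp add: image_funpow)

lemma set_period_dvd: "(\<forall>y\<in>A. len y dvd m) \<Longrightarrow> set_period A dvd m"
proof -
  assume "\<forall>y\<in>A. len y dvd m"
  then have "(\<sigma> ^^ m) y = y" if "y \<in> A" for y using that by (simp add: len_dvd_iff)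
  then have "(\<sigma> ^^ m) ` A = A" by force
  then show ?thesis using set_period_facts(2)[of m A] by (simp add: image_funpow)
qed

text \<open>
  The power of \<open>\<sigma>\<close> with exponent \<open>set_period A\<close> permutes \<open>A\<close>, so its \<open>(card A)!\<close>-th power fixes \<open>A\<close> pointwise.
\<close>

lemma len_dvd_set_period:
  assumes A: "finite A" "y \<in> A"
  shows "len y dvd set_period A * fact (card A)"
proof -
  define f where "f = \<sigma> ^^ set_period A"
  have fA: "f x \<in> A" if "x \<in> A" for x using set_period_image[of A] that unfolding f_def by blast
  \<comment> \<open>this makes \<open>y\<close> periodic under \<open>f\<close>\<close>
  have N: "(f ^^ fact n) y = y"
  proof -
    have "f ^^ fact n = (\<sigma> ^^ fact n) ^^ set_period A" unfolding f_def by (simp add: funpow_mult mult.commute)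
    then show ?thesis by (simp add: funpow_fact_id)
  qed
  note pf = orbit_period[OF N fact_gt_zero]
  have "card (orbit f y) \<le> card A" using A fA by (intro card_mono orbit_subset_invariant) auto
  then have "card (orbit f y) dvd fact (card A)" using pf(1) by (intro dvd_fact) auto
  then have "(f ^^ fact (card A)) y = y" using pf(2) by simp
  then have "(\<sigma> ^^ (set_period A * fact (card A))) y = y" unfolding f_def by (simp add: funpow_mult)
  then show ?thesis by (simp add: len_dvd_iff)
qed

lemma hd_in_tuple: "t \<in> lists_of n (Suc m) \<Longrightarrow> hd t \<in> set t \<and> t \<noteq> []"
  by (cases t) (auto simp: lists_of_def)

text \<open>
  For the period \<open>p\<close> of the set, \<open>\<sigma>^p\<close> maps \<open>hd t\<close> to an element of the set, and \<open>k!\<close> times \<open>p\<close> is a multiple of the cycle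
  length. As there is no bad pair, that element is \<open>hd t\<close> itself, so \<open>p\<close> is a multiple of the cycle length.
\<close>

lemma good_periods:
  assumes t: "t \<in> lists_of n (Suc m)" and g: "\<not> has_pair (bad_pair (fact (Suc m))) t"
  shows "t \<in> tuples n (Suc m)" "tuple_period t = len (hd t)" "set_period (set t) = len (hd t)"
    "\<And>y. y \<in> set t \<Longrightarrow> len y = len (hd t)"
proof -
  note h = hd_in_tuple[OF t]
  note gl = good_list[OF g]
  show tt: "t \<in> tuples n (Suc m)" using t gl(1) by (auto simp: tuples_def lists_of_def)
  show l: "len y = len (hd t)" if "y \<in> set t" for y using len_orbit[OF gl(2)] h that by blast
  have "tuple_period t dvd m \<longleftrightarrow> len (hd t) dvd m" for m unfolding tuple_period_dvd_iff using l h by metis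
  then show "tuple_period t = len (hd t)" by (meson dvd_antisym dvd_refl)
  have "\<forall>y\<in>set t. len y dvd len (hd t)" using l by (metis dvd_refl)
  then have "set_period (set t) dvd len (hd t)" by (rule set_period_dvd)
  moreover have "len (hd t) dvd set_period (set t)"
  proof -
    have "(\<sigma> ^^ set_period (set t)) (hd t) \<in> set t" using set_period_image[of "set t"] h by blast
    moreover have "len (hd t) dvd set_period (set t) * fact (Suc m)"
      using len_dvd_set_period[of "set t" "hd t"] h tt by (simp add: tuples_def distinct_card)
    ultimately have "(\<sigma> ^^ set_period (set t)) (hd t) = hd t" using gl(3)[OF _ _ refl] h by blast
    then show ?thesis by (simp add: len_dvd_iff)
  qed
  ultimately show "set_period (set t) = len (hd t)" by (rule dvd_antisym)
qed

lemma sum_tuples_lists: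
  "(\<Sum>t\<in>tuples n k. f t) = (\<Sum>t\<in>lists_of n k. if t \<in> tuples n k then f t else (0::real))"
  by (intro sum.mono_neutral_cong_left) (auto simp: tuples_def lists_of_def finite_lists_length_eq)

definition pair_error :: "nat \<Rightarrow> real" where
  "pair_error m = (real m + 2) ^ 2 * real n ^ m * ((1 + real (fact (m + 2))) * inv_len_sum + inv_lcm_sum)"

lemma tuple_comparison:
  "\<bar>(\<Sum>t\<in>tuples n (Suc (Suc m)). frac_diff \<alpha> \<beta> (tuple_period t) / tuple_period t) - (\<Sum>x\<in>{1..n}. real (len x) ^ m * frac_diff \<alpha> \<beta> (len x))\<bar>
    \<le> 2 * pair_error m"
proof -
  let ?h = "frac_diff \<alpha> \<beta>" and ?K = "fact (Suc (Suc m)) :: nat"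
  let ?\<phi> = "\<lambda>t. if t \<in> tuples n (Suc (Suc m)) then ?h (tuple_period t) / tuple_period t else 0"
  have "\<bar>(\<Sum>t\<in>lists_of n (Suc (Suc m)). ?\<phi> t) - (\<Sum>x\<in>{1..n}. real (len x) ^ m * ?h (len x))\<bar> \<le>
    (1 + 1) * ((real m + 2) ^ 2 * real n ^ m * ((1 + real ?K) * inv_len_sum + inv_lcm_sum))"
  proof (rule list_sum_comparison[OF abs_frac_diff_le])
    fix t assume t: "t \<in> lists_of n (Suc (Suc m))" and g: "\<not> has_pair (bad_pair ?K) t"
    show "?\<phi> t = ?h (len (hd t)) / len (hd t)" using good_periods[OF t g] by simp
  next
    fix t assume t: "t \<in> lists_of n (Suc (Suc m))" and b: "has_pair (bad_pair ?K) t"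
    have p: "tuple_period t > 0" by (rule tuple_period_facts(1))
    have "1 / real (tuple_period t) \<le> list_pair_sum (bad_weight ?K) t"
    proof (rule bad_weight_list_pair_sum[OF b p])
      show "len y dvd tuple_period t" if "y \<in> set t" for y using tuple_period_dvd_iff[of t "tuple_period t"] that by simp
    qed
    moreover have "\<bar>?\<phi> t\<bar> \<le> 1 / real (tuple_period t)"
      using abs_frac_diff_le[of \<alpha> \<beta> "tuple_period t"] p by (simp add: abs_divide divide_right_mono)
    ultimately show "\<bar>?\<phi> t\<bar> \<le> 1 * list_pair_sum (bad_weight ?K) t" by linarith
  qed simp_all
  then show ?thesis unfolding sum_tuples_lists pair_error_def by simp
qed

text \<open>
  The function \<open>\<eta>\<close> is arbitrary (but bounded) on the sets that are not fixed pointwise by the power of \<open>\<sigma>\<close> that first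
  fixes them as sets. This covers both the permutation representation on sets and the exterior power, where
  the orbits of such sets may have sign \<open>-1\<close>.
\<close>

lemma set_comparison:
  assumes \<eta>: "\<And>A. A \<in> ksubsets n (Suc (Suc m)) \<Longrightarrow> \<bar>\<eta> A\<bar> \<le> 1"
    and \<eta>h: "\<And>A. A \<in> ksubsets n (Suc (Suc m)) \<Longrightarrow> (\<forall>y\<in>A. len y dvd set_period A) \<Longrightarrow> \<eta> A = frac_diff \<alpha> \<beta> (set_period A)"
  shows "\<bar>fact (Suc (Suc m)) * (\<Sum>A\<in>ksubsets n (Suc (Suc m)). \<eta> A / set_period A) -
      (\<Sum>x\<in>{1..n}. real (len x) ^ m * frac_diff \<alpha> \<beta> (len x))\<bar> \<le> (fact (Suc (Suc m)) + 1) * pair_error m"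
proof -
  let ?h = "frac_diff \<alpha> \<beta>" and ?K = "fact (Suc (Suc m)) :: nat"
  let ?\<phi> = "\<lambda>t. if t \<in> tuples n (Suc (Suc m)) then \<eta> (set t) / set_period (set t) else 0"
  have ks: "set t \<in> ksubsets n (Suc (Suc m))" "card (set t) = Suc (Suc m)" if "t \<in> tuples n (Suc (Suc m))" for t
    using that by (auto simp: tuples_def ksubsets_def distinct_card)
  have "\<bar>(\<Sum>t\<in>lists_of n (Suc (Suc m)). ?\<phi> t) - (\<Sum>x\<in>{1..n}. real (len x) ^ m * ?h (len x))\<bar> \<le>
    (real ?K + 1) * ((real m + 2) ^ 2 * real n ^ m * ((1 + real ?K) * inv_len_sum + inv_lcm_sum))"
  proof (rule list_sum_comparison[OF abs_frac_diff_le])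
    fix t assume t: "t \<in> lists_of n (Suc (Suc m))" and g: "\<not> has_pair (bad_pair ?K) t"
    note gp = good_periods[OF t g]
    have "\<forall>y\<in>set t. len y dvd set_period (set t)" using gp(3,4) by simp
    then have "\<eta> (set t) = ?h (set_period (set t))" using ks(1)[OF gp(1)] by (intro \<eta>h)
    then show "?\<phi> t = ?h (len (hd t)) / len (hd t)" using gp(1,3) by simp
  next
    fix t assume t: "t \<in> lists_of n (Suc (Suc m))" and b: "has_pair (bad_pair ?K) t"
    show "\<bar>?\<phi> t\<bar> \<le> real ?K * list_pair_sum (bad_weight ?K) t"
    proof (cases "t \<in> tuples n (Suc (Suc m))")
      case True
      have p: "set_period (set t) > 0" by (rule set_period_facts(1))
      have "1 / real (set_period (set t) * ?K) \<le> list_pair_sum (bad_weight ?K) t"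
      proof (rule bad_weight_list_pair_sum[OF b])
        show "set_period (set t) * ?K > 0" using p by simp
        show "len y dvd set_period (set t) * ?K" if "y \<in> set t" for y
          using len_dvd_set_period[of "set t" y] that ks(2)[OF True] by simp
      qed
      then have "real ?K * (1 / real (set_period (set t) * ?K)) \<le> real ?K * list_pair_sum (bad_weight ?K) t"
        by (intro mult_left_mono) auto
      moreover have "real ?K * (1 / real (set_period (set t) * ?K)) = 1 / real (set_period (set t))"
        using fact_nonzero[of "Suc (Suc m)", where 'a = real] by (simp del: fact_Suc add: field_simps)
      moreover have "\<bar>?\<phi> t\<bar> \<le> 1 / real (set_period (set t))"
        using \<eta>[OF ks(1)[OF True]] p by (simp add: abs_divide divide_right_mono)
      ultimately show ?thesis by linarith
    next
      case False
      then show ?thesis using list_pair_sum_nonneg[OF bad_weight_nonneg] by simp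
    qed
  qed simp_all
  moreover have "(\<Sum>t\<in>lists_of n (Suc (Suc m)). ?\<phi> t) = fact (Suc (Suc m)) * (\<Sum>A\<in>ksubsets n (Suc (Suc m)). \<eta> A / set_period A)"
    unfolding sum_tuples_lists[symmetric] by (rule sum_ksubsets_tuples)
  ultimately show ?thesis unfolding pair_error_def by (simp del: fact_Suc)
qed

lemma inv_len_sum_ge_1: assumes "n > 0" shows "inv_len_sum \<ge> 1"
proof -
  have "1 = (\<Sum>x\<in>{1..n}. 1 / real n)" using assms by simp
  also have "\<dots> \<le> inv_len_sum" unfolding inv_len_sum_def
  proof (rule sum_mono)
    fix x assume x: "x \<in> {1..n}"
    have "len x \<le> n" using card_mono[OF _ orbit_subset[OF x]] by (simp add: len_def)
    then show "1 / real n \<le> 1 / real (len x)" using period_facts(1)[of x] by (intro divide_left_mono) auto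
  qed
  finally show ?thesis .
qed

text \<open>
  Order the set and use that its period is at least \<open>1 / i!\<close> times the cycle length of the first entry; the other \<open>i - 1\<close>
  entries are arbitrary. For \<open>i = 0\<close> the truncated subtraction gives \<open>n^0\<close>, and the single term is at most \<open>1\<close>, hence at
  most \<open>inv_len_sum\<close>.
\<close>

lemma sum_inverse_set_period_le:
  assumes n: "n > 0"
  shows "(\<Sum>A\<in>ksubsets n i. 1 / real (set_period A)) \<le> real n ^ (i - 1) * inv_len_sum"
proof (cases i)
  case 0
  have "ksubsets n 0 = {{}}" using finite_subset[of _ "{1..n}"] by (auto simp: ksubsets_def card_eq_0_iff)
  moreover have "1 / real (set_period {}) \<le> 1" using set_period_facts(1)[of "{}"] by simp
  ultimately show ?thesis using inv_len_sum_ge_1[OF n] 0 by simp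
next
  case (Suc m)
  have "fact i * (\<Sum>A\<in>ksubsets n i. 1 / real (set_period A)) = (\<Sum>t\<in>tuples n i. 1 / real (set_period (set t)))"
    by (rule sum_ksubsets_tuples[symmetric])
  also have "\<dots> \<le> (\<Sum>t\<in>tuples n i. fact i * (1 / real (len (hd t))))"
  proof (rule sum_mono)
    fix t assume t: "t \<in> tuples n i"
    then have ht: "hd t \<in> set t" using Suc by (cases t) (auto simp: tuples_def)
    have "len (hd t) dvd set_period (set t) * fact i" using len_dvd_set_period[OF _ ht] t by (simp add: tuples_def distinct_card)
    then have "len (hd t) \<le> set_period (set t) * fact i" using set_period_facts(1)[of "set t"] by (intro dvd_imp_le) auto
    then have "real (len (hd t)) \<le> real (set_period (set t)) * fact i"
      by (metis of_nat_fact of_nat_le_iff of_nat_mult)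
    then show "1 / real (set_period (set t)) \<le> fact i * (1 / real (len (hd t)))"
      using set_period_facts(1)[of "set t"] period_facts(1)[of "hd t"] by (simp add: field_simps)
  qed
  also have "\<dots> \<le> (\<Sum>t\<in>lists_of n i. fact i * (1 / real (len (hd t))))"
    by (intro sum_mono2) (auto simp: tuples_def lists_of_def finite_lists_length_eq)
  also have "\<dots> = fact i * (real n ^ m * inv_len_sum)"
    unfolding Suc sum_lists_of_Suc inv_len_sum_def by (simp add: card_lists_of sum_distrib_left mult_ac del: fact_Suc)
  finally show ?thesis using Suc by (simp del: fact_Suc)
qed

lemma X_tuple_eq:
  assumes ab: "0 < \<alpha>" "\<alpha> < \<beta>" "\<beta> < 1" "\<beta> \<notin> \<rat>"
  shows "X_tuple \<alpha> \<beta> n k \<sigma> = (\<beta> - \<alpha>) * card (tuples n k) + (\<Sum>t\<in>tuples n k. frac_diff \<alpha> \<beta> (tuple_period t) / tuple_period t)"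
  unfolding X_tuple_def rho_tuple_def tuple_period_def
  by (rule count_eigenangles_permutation[OF finite_tuples tuples_map[OF perm] map_fact fact_gt_zero ab])

lemma X_set_eq:
  assumes ab: "0 < \<alpha>" "\<alpha> < \<beta>" "\<beta> < 1" "\<beta> \<notin> \<rat>"
  shows "X_set \<alpha> \<beta> n k \<sigma> = (\<beta> - \<alpha>) * card (ksubsets n k) + (\<Sum>A\<in>ksubsets n k. frac_diff \<alpha> \<beta> (set_period A) / set_period A)"
  unfolding X_set_def rho_set_def set_period_def
  by (rule count_eigenangles_permutation[OF finite_ksubsets ksubsets_image[OF perm] image_fact fact_gt_zero ab])

text \<open>
  All eigenvalues that occur are roots of unity of order dividing \<open>2 * n!\<close>; the factor \<open>2\<close> accounts for orbits of sign \<open>-1\<close>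
  in the exterior powers.
\<close>

definition arc_indices :: "real \<Rightarrow> real \<Rightarrow> nat set" where
  "arc_indices \<alpha> \<beta> = {j::nat. j < 2 * fact n \<and> \<alpha> < j / (2 * fact n :: nat) \<and> j / (2 * fact n :: nat) < \<beta>}"

definition arc_root :: "nat \<Rightarrow> complex" where "arc_root j = e2pi (j / (2 * fact n :: nat))"

text \<open>
  The numbers of eigenangles in \<open>(\<alpha>, \<beta>)\<close> on the exterior power \<open>\<Lambda>^i\<close> and on the kernel of the boundary in it.
\<close>

definition ext_count :: "real \<Rightarrow> real \<Rightarrow> nat \<Rightarrow> real" where
  "ext_count \<alpha> \<beta> i = (\<Sum>j\<in>arc_indices \<alpha> \<beta>. real (cfun.dim (ext_eigenspace n i \<sigma> (arc_root j))))"

definition ker_count :: "real \<Rightarrow> real \<Rightarrow> nat \<Rightarrow> real" where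
  "ker_count \<alpha> \<beta> i = (\<Sum>j\<in>arc_indices \<alpha> \<beta>. real (cfun.dim {F \<in> ext_eigenspace n i \<sigma> (arc_root j). bdry n F = 0}))"

lemma ext_count_Suc: "n > 0 \<Longrightarrow> ext_count \<alpha> \<beta> (Suc i) = ker_count \<alpha> \<beta> (Suc i) + ker_count \<alpha> \<beta> i"
  by (simp add: ext_count_def ker_count_def dim_ext_eigenspace_split[OF _ perm] sum.distrib)

lemma ext_count_0: "ext_count \<alpha> \<beta> 0 = ker_count \<alpha> \<beta> 0"
  by (simp add: ext_count_def ker_count_def dim_ext_eigenspace_0)

lemma X_irrep_eq: "k < n \<Longrightarrow> X_irrep \<alpha> \<beta> n k \<sigma> = ker_count \<alpha> \<beta> k"
proof -
  assume k: "k < n"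
  have N: "\<sigma> ^^ (2 * fact n) = id" by (simp add: mult_2 funpow_add funpow_fact_id)
  show ?thesis unfolding X_irrep_def ker_count_def arc_indices_def arc_root_def
    by (subst count_eigenangles_specht_hook[OF k perm N]) (simp_all only: of_nat_sum, simp)
qed

text \<open>
  By multiplicativity the product of the signs around the orbit is the sign on \<open>A\<close> of the power of \<open>\<sigma>\<close> that first returns to
  \<open>A\<close>, and this power fixes \<open>A\<close> pointwise.
\<close>

lemma prod_subset_sign_orbit:
  assumes A: "finite A" and fixd: "\<forall>y\<in>A. len y dvd set_period A"
  shows "(\<Prod>B\<in>orbit ((`) \<sigma>) A. subset_sign \<sigma> B) = 1"
proof -
  have inj: "inj_on (\<sigma> ^^ i) B" for i B
    using inj_fn[OF permutes_inj[OF perm]] by (rule inj_on_subset) simp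
  have "(\<Prod>i<l. subset_sign \<sigma> (((`) \<sigma> ^^ i) A)) = subset_sign (\<sigma> ^^ l) A" for l
  proof (induction l)
    case 0 then show ?case using subset_sign_fixed[OF A, of "\<lambda>x. x"] by (simp add: id_def)
  next
    case (Suc l)
    have IH: "(\<Prod>i<l. subset_sign \<sigma> ((\<sigma> ^^ i) ` A)) = subset_sign (\<sigma> ^^ l) A" using Suc unfolding image_funpow .
    have "subset_sign (\<sigma> ^^ Suc l) A = subset_sign \<sigma> ((\<sigma> ^^ l) ` A) * subset_sign (\<sigma> ^^ l) A"
      unfolding funpow.simps by (rule subset_sign_comp[OF A inj])
    then show ?case unfolding prod.lessThan_Suc image_funpow IH by (simp only: mult.commute)
  qed
  then have "(\<Prod>B\<in>orbit ((`) \<sigma>) A. subset_sign \<sigma> B) = subset_sign (\<sigma> ^^ set_period A) A"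
    by (subst prod_orbit[OF image_fact fact_gt_zero]) (simp add: set_period_def)
  also have "\<dots> = 1" using fixd by (intro subset_sign_fixed[OF A]) (simp add: len_dvd_iff)
  finally show ?thesis .
qed

lemma ext_count_eq:
  assumes ab: "0 < \<alpha>" "\<alpha> < \<beta>" "\<beta> < 1" "\<beta> \<notin> \<rat>"
  obtains \<eta> where "\<And>A. A \<in> ksubsets n k \<Longrightarrow> \<bar>\<eta> A\<bar> \<le> 1"
    "\<And>A. A \<in> ksubsets n k \<Longrightarrow> \<forall>y\<in>A. len y dvd set_period A \<Longrightarrow> \<eta> A = frac_diff \<alpha> \<beta> (set_period A)"
    "ext_count \<alpha> \<beta> k = (\<beta> - \<alpha>) * card (ksubsets n k) + (\<Sum>A\<in>ksubsets n k. \<eta> A / set_period A)"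
proof -
  have inv: "(`) \<sigma> A \<in> ksubsets n k" if "A \<in> ksubsets n k" for A by (rule ksubsets_image[OF perm that])
  have fA: "finite A" if "A \<in> ksubsets n k" for A using that finite_subset[of A "{1..n}"] by (auto simp: ksubsets_def)
  have pm: "subset_sign \<sigma> A = 1 \<or> subset_sign \<sigma> A = -1" if "A \<in> ksubsets n k" for A
    using fA[OF that] permutes_inj_on[OF perm] by (rule subset_sign_pm1)
  obtain \<eta> where \<eta>: "\<And>x. x \<in> ksubsets n k \<Longrightarrow> \<bar>\<eta> x\<bar> \<le> 1"
    "\<And>x. x \<in> ksubsets n k \<Longrightarrow> (\<Prod>y\<in>orbit ((`) \<sigma>) x. subset_sign \<sigma> y) = 1 \<Longrightarrow> \<eta> x = frac_diff \<alpha> \<beta> (card (orbit ((`) \<sigma>) x))"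
    "(\<Sum>j\<in>{j::nat. j < 2 * fact n \<and> \<alpha> < j / (2 * fact n :: nat) \<and> j / (2 * fact n :: nat) < \<beta>}.
       real (cfun.dim (signed_eigenspace (ksubsets n k) ((`) \<sigma>) (subset_sign \<sigma>) (e2pi (j / (2 * fact n :: nat)))))) =
      (\<beta> - \<alpha>) * card (ksubsets n k) + (\<Sum>x\<in>ksubsets n k. \<eta> x / card (orbit ((`) \<sigma>) x))"
    by (rule signed_eigenangle_count[of "ksubsets n k" "(`) \<sigma>" "fact n" "subset_sign \<sigma>" \<alpha> \<beta>, OF finite_ksubsets inv image_fact fact_gt_zero pm ab]) auto
  show ?thesis
  proof (rule that[of \<eta>])
    show "\<eta> A = frac_diff \<alpha> \<beta> (set_period A)" if "A \<in> ksubsets n k" "\<forall>y\<in>A. len y dvd set_period A" for A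
      using \<eta>(2)[OF that(1) prod_subset_sign_orbit[OF fA[OF that(1)] that(2)]] by (simp add: set_period_def)
    show "ext_count \<alpha> \<beta> k = (\<beta> - \<alpha>) * card (ksubsets n k) + (\<Sum>A\<in>ksubsets n k. \<eta> A / set_period A)"
      using \<eta>(3) unfolding ext_count_def arc_indices_def arc_root_def ext_eigenspace_def set_period_def .
  qed (rule \<eta>(1))
qed

lemma ext_count_bound:
  assumes ab: "0 < \<alpha>" "\<alpha> < \<beta>" "\<beta> < 1" "\<beta> \<notin> \<rat>" and n: "n > 0"
  shows "\<bar>ext_count \<alpha> \<beta> i - (\<beta> - \<alpha>) * card (ksubsets n i)\<bar> \<le> real n ^ (i - 1) * inv_len_sum"
proof -
  obtain \<eta> where \<eta>: "\<And>A. A \<in> ksubsets n i \<Longrightarrow> \<bar>\<eta> A\<bar> \<le> 1"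
    "ext_count \<alpha> \<beta> i = (\<beta> - \<alpha>) * card (ksubsets n i) + (\<Sum>A\<in>ksubsets n i. \<eta> A / set_period A)"
    using ext_count_eq[OF ab, of i] by metis
  have "\<bar>\<Sum>A\<in>ksubsets n i. \<eta> A / set_period A\<bar> \<le> (\<Sum>A\<in>ksubsets n i. \<bar>\<eta> A / set_period A\<bar>)" by (rule sum_abs)
  also have "\<dots> \<le> (\<Sum>A\<in>ksubsets n i. 1 / set_period A)"
    using \<eta>(1) by (intro sum_mono) (simp add: abs_divide divide_right_mono)
  also have "\<dots> \<le> real n ^ (i - 1) * inv_len_sum" by (rule sum_inverse_set_period_le[OF n])
  finally show ?thesis unfolding \<eta>(2) by simp
qed

end

text \<open>
  The main term \<open>\<gamma> ((n choose i) - (n choose (i - 1)) + ...)\<close>, that is, \<open>\<gamma>\<close> times the dimension of the hook module. Only its independence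
  of the permutation matters, since it disappears in the centring.
\<close>

primrec ker_const :: "real \<Rightarrow> nat \<Rightarrow> nat \<Rightarrow> real" where
  "ker_const \<gamma> n 0 = \<gamma> * card (ksubsets n 0)"
| "ker_const \<gamma> n (Suc i) = \<gamma> * card (ksubsets n (Suc i)) - ker_const \<gamma> n i"

context perm_on begin

text \<open>
  Alternating sums over \<open>dim_ext_eigenspace_split\<close>: each of the \<open>i + 1\<close> terms deviates from its main term by at most
  \<open>n^(i-1) * inv_len_sum\<close>.
\<close>

lemma ker_count_bound:
  assumes ab: "0 < \<alpha>" "\<alpha> < \<beta>" "\<beta> < 1" "\<beta> \<notin> \<rat>" and n: "n > 0"
  shows "\<bar>ker_count \<alpha> \<beta> i - ker_const (\<beta> - \<alpha>) n i\<bar> \<le> (real i + 1) * (real n ^ (i - 1) * inv_len_sum)"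
proof (induction i)
  case 0 then show ?case using ext_count_bound[OF ab n, of 0] by (simp add: ext_count_0)
next
  case (Suc i)
  have k0: "inv_len_sum \<ge> 0" using inv_len_sum_ge_1[OF n] by simp
  have "\<bar>ker_count \<alpha> \<beta> (Suc i) - ker_const (\<beta> - \<alpha>) n (Suc i)\<bar> \<le>
    \<bar>ext_count \<alpha> \<beta> (Suc i) - (\<beta> - \<alpha>) * card (ksubsets n (Suc i))\<bar> + \<bar>ker_count \<alpha> \<beta> i - ker_const (\<beta> - \<alpha>) n i\<bar>"
    using ext_count_Suc[OF n, of \<alpha> \<beta> i] by simp
  also have "\<dots> \<le> real n ^ i * inv_len_sum + (real i + 1) * (real n ^ (i - 1) * inv_len_sum)"
    using ext_count_bound[OF ab n, of "Suc i"] Suc by simp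
  also have "(real i + 1) * (real n ^ (i - 1) * inv_len_sum) \<le> (real i + 1) * (real n ^ i * inv_len_sum)"
    using n k0 by (intro mult_left_mono mult_right_mono power_increasing) auto
  finally show ?case by (simp add: algebra_simps)
qed

text \<open>
  The module for \<open>m + 2\<close> is \<open>\<Lambda>^(m+2)\<close> minus the module for \<open>m + 1\<close>. The former is treated like the representation on
  sets, and the deviation of the latter has only the order \<open>n^m * inv_len_sum\<close>.
\<close>

lemma X_irrep_comparison:
  assumes ab: "0 < \<alpha>" "\<alpha> < \<beta>" "\<beta> < 1" "\<beta> \<notin> \<rat>" and n: "Suc (Suc m) < n"
  shows "\<bar>fact (Suc (Suc m)) * (X_irrep \<alpha> \<beta> n (Suc (Suc m)) \<sigma> - ker_const (\<beta> - \<alpha>) n (Suc (Suc m))) -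
     (\<Sum>x\<in>{1..n}. real (len x) ^ m * frac_diff \<alpha> \<beta> (len x))\<bar> \<le>
    (fact (Suc (Suc m)) + 1) * pair_error m + fact (Suc (Suc m)) * ((real m + 2) * (real n ^ m * inv_len_sum))"
proof -
  let ?k = "Suc (Suc m)"
  let ?S = "\<Sum>x\<in>{1..n}. real (len x) ^ m * frac_diff \<alpha> \<beta> (len x)"
  have n0: "n > 0" using n by simp
  obtain \<eta> where \<eta>: "\<And>A. A \<in> ksubsets n ?k \<Longrightarrow> \<bar>\<eta> A\<bar> \<le> 1"
    "\<And>A. A \<in> ksubsets n ?k \<Longrightarrow> \<forall>y\<in>A. len y dvd set_period A \<Longrightarrow> \<eta> A = frac_diff \<alpha> \<beta> (set_period A)"
    "ext_count \<alpha> \<beta> ?k = (\<beta> - \<alpha>) * card (ksubsets n ?k) + (\<Sum>A\<in>ksubsets n ?k. \<eta> A / set_period A)"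
    by (rule ext_count_eq[OF ab, of ?k]) auto
  define E where "E = (\<Sum>A\<in>ksubsets n ?k. \<eta> A / set_period A)"
  \<comment> \<open>the deviation of the module for \<open>m + 1\<close>\<close>
  define D where "D = ker_count \<alpha> \<beta> (Suc m) - ker_const (\<beta> - \<alpha>) n (Suc m)"
  have eq: "X_irrep \<alpha> \<beta> n ?k \<sigma> - ker_const (\<beta> - \<alpha>) n ?k = E - D"
    using X_irrep_eq[OF n] ext_count_Suc[OF n0, of \<alpha> \<beta> "Suc m"] \<eta>(3) by (simp add: E_def D_def)
  have "fact ?k * (X_irrep \<alpha> \<beta> n ?k \<sigma> - ker_const (\<beta> - \<alpha>) n ?k) - ?S = (fact ?k * E - ?S) - fact ?k * D"
    unfolding eq right_diff_distrib by (simp del: fact_Suc)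
  moreover have "\<bar>fact ?k * E - ?S\<bar> \<le> (fact ?k + 1) * pair_error m"
    unfolding E_def using \<eta>(1,2) by (rule set_comparison)
  moreover have "\<bar>D\<bar> \<le> (real m + 2) * (real n ^ m * inv_len_sum)"
    using ker_count_bound[OF ab n0, of "Suc m"] by (simp add: D_def add.commute)
  then have "\<bar>fact ?k * D\<bar> \<le> fact ?k * ((real m + 2) * (real n ^ m * inv_len_sum))"
    by (simp add: abs_mult del: fact_Suc)
  ultimately show ?thesis by linarith
qed

lemma X_set_comparison:
  assumes ab: "0 < \<alpha>" "\<alpha> < \<beta>" "\<beta> < 1" "\<beta> \<notin> \<rat>"
  shows "\<bar>fact (Suc (Suc m)) * (X_set \<alpha> \<beta> n (Suc (Suc m)) \<sigma> - (\<beta> - \<alpha>) * card (ksubsets n (Suc (Suc m)))) -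
     (\<Sum>x\<in>{1..n}. real (len x) ^ m * frac_diff \<alpha> \<beta> (len x))\<bar> \<le> (fact (Suc (Suc m)) + 1) * pair_error m"
  using set_comparison[of m "\<lambda>A. frac_diff \<alpha> \<beta> (set_period A)" \<alpha> \<beta>, OF abs_frac_diff_le refl]
  unfolding X_set_eq[OF ab] by (simp del: fact_Suc)

lemma X_tuple_comparison:
  assumes ab: "0 < \<alpha>" "\<alpha> < \<beta>" "\<beta> < 1" "\<beta> \<notin> \<rat>"
  shows "\<bar>(X_tuple \<alpha> \<beta> n (Suc (Suc m)) \<sigma> - (\<beta> - \<alpha>) * card (tuples n (Suc (Suc m)))) -
     (\<Sum>x\<in>{1..n}. real (len x) ^ m * frac_diff \<alpha> \<beta> (len x))\<bar> \<le> 2 * pair_error m"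
  using tuple_comparison[of \<alpha> \<beta> m] unfolding X_tuple_eq[OF ab] by simp

lemma Y_eq:
  "Y \<alpha> \<beta> n (Suc (Suc m)) \<sigma> = (\<Sum>x\<in>{1..n}. real (len x) ^ m * frac_diff \<alpha> \<beta> (len x)) / real n ^ Suc m"
proof -
  let ?C = "perm_cycles n \<sigma>"
  let ?g = "\<lambda>j. real j ^ Suc m * frac_diff \<alpha> \<beta> j"
  have fC: "finite ?C" by (simp add: perm_cycles_def)
  have cC: "card c \<in> {1..n}" if c: "c \<in> ?C" for c
  proof -
    obtain x where x: "x \<in> {1..n}" "c = orbit \<sigma> x" using c unfolding perm_cycles_def by blast
    then show ?thesis using card_mono[OF _ orbit_subset[OF x(1)]] period_facts(1)[of x] by (simp add: len_def)
  qed
  have "(\<Sum>x\<in>{1..n}. real (len x) ^ m * frac_diff \<alpha> \<beta> (len x)) = (\<Sum>x\<in>{1..n}. ?g (card (orbit \<sigma> x)) / card (orbit \<sigma> x))"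
  proof (rule sum.cong[OF refl])
    fix x
    show "real (len x) ^ m * frac_diff \<alpha> \<beta> (len x) = ?g (card (orbit \<sigma> x)) / card (orbit \<sigma> x)"
      unfolding len_def[symmetric] using period_facts(1)[of x] by simp
  qed
  also have "\<dots> = (\<Sum>c\<in>?C. ?g (card c))"
    unfolding perm_cycles_def
    using sum_orbits[of "{1..n}" \<sigma> "fact n" "\<lambda>c. ?g (card c)"] funpow_fact permutes_in_image[OF perm] by simp
  also have "\<dots> = (\<Sum>j\<in>{1..n}. \<Sum>c | c \<in> ?C \<and> card c = j. ?g (card c))"
    using fC cC by (intro sum.group[symmetric]) auto
  also have "\<dots> = (\<Sum>j\<in>{1..n}. real (num_cycles_of_length n j \<sigma>) * ?g j)"
    by (intro sum.cong refl) (simp add: num_cycles_of_length_def)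
  finally show ?thesis unfolding Y_def frac_diff_def
    by (simp add: sum_divide_distrib mult_ac)
qed

end

section \<open>Means of sums over cycles\<close>

lemma perm_cycles_facts:
  assumes \<tau>: "\<tau> permutes {1..n}"
  shows "finite (perm_cycles n \<tau>)"
    and "\<And>c. c \<in> perm_cycles n \<tau> \<Longrightarrow> c \<subseteq> {1..n} \<and> c \<noteq> {}"
    and "\<And>x. x \<in> {1..n} \<Longrightarrow> x \<in> orbit \<tau> x"
    and "\<And>c x. c \<in> perm_cycles n \<tau> \<Longrightarrow> x \<in> c \<Longrightarrow> orbit \<tau> x = c"
proof -
  have p: "permutation \<tau>" using \<tau> by (auto simp: permutation_permutes)
  show "finite (perm_cycles n \<tau>)" by (simp add: perm_cycles_def)
  show "c \<subseteq> {1..n} \<and> c \<noteq> {}" if "c \<in> perm_cycles n \<tau>" for c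
    using that permutes_orbit_subset[OF \<tau>] orbit_nonempty[of \<tau>] unfolding perm_cycles_def by blast
  show "x \<in> orbit \<tau> x" for x by (rule permutation_self_in_orbit[OF p])
  show "orbit \<tau> x = c" if "c \<in> perm_cycles n \<tau>" "x \<in> c" for c x
    using that orbit_cyclic_eq3[OF cyclic_on_orbit'[OF p]] by (auto simp: perm_cycles_def)
qed

lemma sum_points_cycles:
  fixes g :: "nat set \<Rightarrow> real"
  assumes \<tau>: "\<tau> permutes {1..n}"
  shows "(\<Sum>x\<in>{1..n}. g (orbit \<tau> x)) = (\<Sum>c\<in>perm_cycles n \<tau>. card c * g c)"
proof -
  note pf = perm_cycles_facts[OF \<tau>]
  have "(\<Sum>x\<in>{1..n}. g (orbit \<tau> x)) = (\<Sum>c\<in>orbit \<tau> ` {1..n}. \<Sum>x | x \<in> {1..n} \<and> orbit \<tau> x = c. g (orbit \<tau> x))"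
    by (rule sum.image_gen) simp
  also have "\<dots> = (\<Sum>c\<in>perm_cycles n \<tau>. card c * g c)"
    unfolding perm_cycles_def[symmetric]
  proof (rule sum.cong[OF refl])
    fix c assume c: "c \<in> perm_cycles n \<tau>"
    have "{x. x \<in> {1..n} \<and> orbit \<tau> x = c} = c" using pf(2)[OF c] pf(3) pf(4)[OF c] by blast
    then have "(\<Sum>x | x \<in> {1..n} \<and> orbit \<tau> x = c. g (orbit \<tau> x)) = (\<Sum>x\<in>c. g c)"
      using pf(4)[OF c] by (intro sum.cong) auto
    then show "(\<Sum>x | x \<in> {1..n} \<and> orbit \<tau> x = c. g (orbit \<tau> x)) = card c * g c" by simp
  qed
  finally show ?thesis .
qed

text \<open>
  Composing with the transposition of \<open>n + 1\<close> and \<open>b\<close> inserts the new point into the cycle of \<open>b\<close>, just in front of \<open>b\<close>.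
\<close>

lemma perm_cycles_transpose:
  assumes \<tau>: "\<tau> permutes {1..n}" and b: "b \<in> {1..n}"
  shows "perm_cycles (Suc n) (Transposition.transpose (Suc n) b \<circ> \<tau>) =
    insert (insert (Suc n) (orbit \<tau> b)) (perm_cycles n \<tau> - {orbit \<tau> b})"
proof -
  define a where "a = Suc n"
  define \<sigma> where "\<sigma> = Transposition.transpose a b \<circ> \<tau>"
  define Q where "Q = orbit \<tau> b"
  note pf = perm_cycles_facts[OF \<tau>]
  have Qc: "Q \<in> perm_cycles n \<tau>" using b by (simp add: perm_cycles_def Q_def)
  have aQ: "a \<notin> Q" using pf(2)[OF Qc] by (auto simp: a_def)
  have bQ: "b \<in> Q" using pf(3)[OF b] by (simp add: Q_def)
  have \<tau>a: "\<tau> a = a" using \<tau> by (intro permutes_not_in) (auto simp: a_def)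
  have \<tau>na: "\<tau> s \<noteq> a" if "s \<noteq> a" for s using that \<tau>a permutes_inj[OF \<tau>] by (metis injD)
  have p\<tau>: "\<tau> permutes {1..Suc n}" by (rule permutes_subset[OF \<tau>]) auto
  have p\<sigma>: "\<sigma> permutes {1..Suc n}" unfolding \<sigma>_def a_def
    using b by (intro permutes_compose[OF p\<tau>] permutes_swap_id) auto
  have perm: "permutation \<sigma>" using p\<sigma> by (auto simp: permutation_permutes)
  have \<sigma>s: "\<sigma> s = \<tau> s" if "s \<noteq> a" "\<tau> s \<noteq> b" for s
    using that \<tau>na[of s] by (simp add: \<sigma>_def)
  have \<sigma>b: "\<sigma> s = a" if "\<tau> s = b" for s using that by (simp add: \<sigma>_def)
  have \<sigma>a: "\<sigma> a = b" using \<tau>a by (simp add: \<sigma>_def)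
  have \<tau>Q: "\<tau> s \<in> Q" if "s \<in> Q" for s using that unfolding Q_def by (rule orbit.step)
  have oa: "orbit \<sigma> a = insert a Q"
  proof
    show "orbit \<sigma> a \<subseteq> insert a Q"
    proof (rule orbit_subset_invariant)
      fix y assume y: "y \<in> insert a Q"
      show "\<sigma> y \<in> insert a Q"
      proof (cases "y = a")
        case True then show ?thesis using \<sigma>a bQ by simp
      next
        case False
        then have "y \<in> Q" using y by simp
        then show ?thesis using \<sigma>s[OF False] \<sigma>b[of y] \<tau>Q[of y] by (cases "\<tau> y = b") auto
      qed
    qed simp
    have ba: "b \<in> orbit \<sigma> a" using orbit.base[of \<sigma> a] unfolding \<sigma>a .
    have "y \<in> orbit \<sigma> a \<and> y \<noteq> a" if "y \<in> orbit \<tau> b" for y using that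
    proof induction
      case base
      have "b \<noteq> a" using bQ aQ by auto
      then show ?case using ba \<sigma>s[of b] \<tau>na[of b] orbit.step[OF ba] by (cases "\<tau> b = b") auto
    next
      case (step y)
      then show ?case using ba \<sigma>s[of y] \<tau>na[of y] orbit.step[of y \<sigma> a] by (cases "\<tau> y = b") auto
    qed
    then show "insert a Q \<subseteq> orbit \<sigma> a" using permutation_self_in_orbit[OF perm, of a] by (auto simp: Q_def)
  qed
  have oQ: "orbit \<sigma> x = insert a Q" if "x \<in> Q" for x
  proof -
    have "x \<in> orbit \<sigma> a" using that oa by simp
    then show ?thesis using orbit_cyclic_eq3[OF cyclic_on_orbit'[OF perm, of a]] oa by simp
  qed
  have oo: "orbit \<sigma> x = orbit \<tau> x" if x: "x \<in> {1..n} - Q" for x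
  proof (rule orbit_cong)
    have xc: "orbit \<tau> x \<in> perm_cycles n \<tau>" using x by (simp add: perm_cycles_def)
    show "x \<in> orbit \<tau> x" using pf(3) x by simp
    fix s assume s: "s \<in> orbit \<tau> x"
    have "s \<noteq> a" using s pf(2)[OF xc] by (auto simp: a_def)
    moreover have "\<tau> s \<noteq> b"
    proof
      assume "\<tau> s = b"
      then have "b \<in> orbit \<tau> x" using orbit.step[OF s] by simp
      then have "orbit \<tau> b = orbit \<tau> x" using pf(4)[OF xc] by simp
      then show False using x pf(3)[of x] by (simp add: Q_def)
    qed
    ultimately show "\<sigma> s = \<tau> s" by (rule \<sigma>s)
  qed
  have "orbit \<tau> ` ({1..n} - Q) = perm_cycles n \<tau> - {Q}"
  proof
    show "orbit \<tau> ` ({1..n} - Q) \<subseteq> perm_cycles n \<tau> - {Q}"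
      using pf(3) by (auto simp: perm_cycles_def)
    show "perm_cycles n \<tau> - {Q} \<subseteq> orbit \<tau> ` ({1..n} - Q)"
      using pf(4)[OF Qc] by (auto simp: perm_cycles_def)
  qed
  moreover have un: "{1..Suc n} = insert a (Q \<union> ({1..n} - Q))" using pf(2)[OF Qc] by (auto simp: a_def)
  have "perm_cycles (Suc n) \<sigma> = insert (orbit \<sigma> a) (orbit \<sigma> ` Q \<union> orbit \<sigma> ` ({1..n} - Q))"
    unfolding perm_cycles_def un by (simp only: image_Un image_insert)
  moreover have "orbit \<sigma> ` Q = {insert a Q}" using oQ bQ by auto
  moreover have "orbit \<sigma> ` ({1..n} - Q) = orbit \<tau> ` ({1..n} - Q)" using oo by (intro image_cong) auto
  ultimately have "perm_cycles (Suc n) \<sigma> = insert (insert a Q) (perm_cycles n \<tau> - {Q})"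
    using oa by auto
  then show ?thesis unfolding \<sigma>_def a_def Q_def .
qed

lemma perm_cycles_Suc_fixed:
  assumes \<tau>: "\<tau> permutes {1..n}"
  shows "perm_cycles (Suc n) \<tau> = insert {Suc n} (perm_cycles n \<tau>)"
proof -
  have "\<tau> (Suc n) = Suc n" using \<tau> by (intro permutes_not_in) auto
  then have "orbit \<tau> (Suc n) = {Suc n}" by (simp add: orbit_eq_singleton_iff)
  moreover have "{1..Suc n} = insert (Suc n) {1..n}" by auto
  ultimately show ?thesis by (simp add: perm_cycles_def)
qed

text \<open>
  The unnormalised mean under the Ewens distribution of a function of the set of cycles.
\<close>

definition ewens_sum :: "real \<Rightarrow> nat \<Rightarrow> (nat set set \<Rightarrow> real) \<Rightarrow> real" where
  "ewens_sum \<theta> n F = (\<Sum>\<sigma> | \<sigma> permutes {1..n}. \<theta> ^ num_cycles n \<sigma> * F (perm_cycles n \<sigma>))"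

lemma ewens_sum_add: "ewens_sum \<theta> n (\<lambda>C. F C + G C) = ewens_sum \<theta> n F + ewens_sum \<theta> n G"
  by (simp add: ewens_sum_def distrib_left sum.distrib)

lemma ewens_sum_mult: "ewens_sum \<theta> n (\<lambda>C. a * F C) = a * ewens_sum \<theta> n F"
  by (simp add: ewens_sum_def sum_distrib_left mult_ac)

lemma ewens_sum_cong:
  assumes "\<And>\<sigma>. \<sigma> permutes {1..n} \<Longrightarrow> F (perm_cycles n \<sigma>) = G (perm_cycles n \<sigma>)"
  shows "ewens_sum \<theta> n F = ewens_sum \<theta> n G"
  unfolding ewens_sum_def using assms by (intro sum.cong) auto

text \<open>
  The recursion of the Chinese restaurant process: the point \<open>n + 1\<close> either forms a cycle of its own, with weight \<open>\<theta>\<close>, or is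
  inserted into an existing cycle \<open>c\<close>, in \<open>card c\<close> ways.
\<close>

lemma ewens_sum_Suc:
  fixes F :: "nat set set \<Rightarrow> real"
  shows "ewens_sum \<theta> (Suc n) F = \<theta> * ewens_sum \<theta> n (\<lambda>C. F (insert {Suc n} C)) +
    ewens_sum \<theta> n (\<lambda>C. \<Sum>c\<in>C. card c * F (insert (insert (Suc n) c) (C - {c})))"
proof -
  have i: "{1..Suc n} = insert (Suc n) {1..n}" by auto
  let ?w = "\<lambda>\<sigma>. \<theta> ^ num_cycles (Suc n) \<sigma> * F (perm_cycles (Suc n) \<sigma>)"
  let ?P = "{\<tau>. \<tau> permutes {1..n}}"
  have fix1: "?w \<tau> = \<theta> * (\<theta> ^ num_cycles n \<tau> * F (insert {Suc n} (perm_cycles n \<tau>)))" if "\<tau> \<in> ?P" for \<tau>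
  proof -
    have t: "\<tau> permutes {1..n}" using that by simp
    have "{Suc n} \<notin> perm_cycles n \<tau>" using perm_cycles_facts(2)[OF t, of "{Suc n}"] by auto
    then have "num_cycles (Suc n) \<tau> = Suc (num_cycles n \<tau>)"
      using perm_cycles_facts(1)[OF t] by (simp add: num_cycles_def perm_cycles_Suc_fixed[OF t])
    then show ?thesis by (simp add: perm_cycles_Suc_fixed[OF t])
  qed
  have ins: "?w (Transposition.transpose (Suc n) b \<circ> \<tau>) = \<theta> ^ num_cycles n \<tau> *
      F (insert (insert (Suc n) (orbit \<tau> b)) (perm_cycles n \<tau> - {orbit \<tau> b}))"
    if "\<tau> \<in> ?P" "b \<in> {1..n}" for \<tau> b
  proof -
    have t: "\<tau> permutes {1..n}" using that by simp
    have c: "orbit \<tau> b \<in> perm_cycles n \<tau>" using that by (simp add: perm_cycles_def)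
    have "insert (Suc n) (orbit \<tau> b) \<notin> perm_cycles n \<tau> - {orbit \<tau> b}"
      using perm_cycles_facts(2)[OF t, of "insert (Suc n) (orbit \<tau> b)"] by auto
    then have "num_cycles (Suc n) (Transposition.transpose (Suc n) b \<circ> \<tau>) = num_cycles n \<tau>"
      using perm_cycles_facts(1)[OF t] c card_Suc_Diff1[of "perm_cycles n \<tau>" "orbit \<tau> b"]
      by (simp add: num_cycles_def perm_cycles_transpose[OF t that(2)])
    then show ?thesis by (simp only: perm_cycles_transpose[OF t that(2)])
  qed
  have "ewens_sum \<theta> (Suc n) F = (\<Sum>b\<in>insert (Suc n) {1..n}. \<Sum>\<tau>\<in>?P. ?w (Transposition.transpose (Suc n) b \<circ> \<tau>))"
    unfolding ewens_sum_def i by (subst sum_over_permutations_insert) auto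
  also have "\<dots> = (\<Sum>\<tau>\<in>?P. ?w \<tau>) + (\<Sum>b\<in>{1..n}. \<Sum>\<tau>\<in>?P. ?w (Transposition.transpose (Suc n) b \<circ> \<tau>))"
    by simp
  also have "(\<Sum>\<tau>\<in>?P. ?w \<tau>) = (\<Sum>\<tau>\<in>?P. \<theta> * (\<theta> ^ num_cycles n \<tau> * F (insert {Suc n} (perm_cycles n \<tau>))))"
    by (rule sum.cong[OF refl fix1])
  also have "\<dots> = \<theta> * ewens_sum \<theta> n (\<lambda>C. F (insert {Suc n} C))"
    by (simp add: ewens_sum_def sum_distrib_left)
  also have "(\<Sum>b\<in>{1..n}. \<Sum>\<tau>\<in>?P. ?w (Transposition.transpose (Suc n) b \<circ> \<tau>)) =
     (\<Sum>\<tau>\<in>?P. \<Sum>b\<in>{1..n}. \<theta> ^ num_cycles n \<tau> *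
      F (insert (insert (Suc n) (orbit \<tau> b)) (perm_cycles n \<tau> - {orbit \<tau> b})))"
    by (subst sum.swap) (intro sum.cong refl ins)
  also have "\<dots> = ewens_sum \<theta> n (\<lambda>C. \<Sum>c\<in>C. card c * F (insert (insert (Suc n) c) (C - {c})))"
    unfolding ewens_sum_def
  proof (rule sum.cong[OF refl])
    fix \<tau> assume "\<tau> \<in> ?P"
    then have t: "\<tau> permutes {1..n}" by simp
    show "(\<Sum>b\<in>{1..n}. \<theta> ^ num_cycles n \<tau> * F (insert (insert (Suc n) (orbit \<tau> b)) (perm_cycles n \<tau> - {orbit \<tau> b}))) =
      \<theta> ^ num_cycles n \<tau> * (\<Sum>c\<in>perm_cycles n \<tau>. card c * F (insert (insert (Suc n) c) (perm_cycles n \<tau> - {c})))"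
      using sum_points_cycles[OF t, of "\<lambda>c. F (insert (insert (Suc n) c) (perm_cycles n \<tau> - {c}))"]
      by (simp only: sum_distrib_left[symmetric])
  qed
  finally show ?thesis .
qed

lemma sum_card_cycles:
  assumes "\<tau> permutes {1..n}"
  shows "(\<Sum>c\<in>perm_cycles n \<tau>. real (card c)) = n"
  using sum_points_cycles[OF assms, of "\<lambda>_. 1"] by simp

lemma ewens_sum_1: "ewens_sum \<theta> n (\<lambda>_. 1) = pochhammer \<theta> n"
proof (induction n)
  case 0
  have "{\<sigma>::nat \<Rightarrow> nat. \<sigma> permutes {1..0}} = {id}" by (auto simp: permutes_empty)
  then show ?case by (simp add: ewens_sum_def num_cycles_def perm_cycles_def)
next
  case (Suc n)
  have "ewens_sum \<theta> n (\<lambda>C. \<Sum>c\<in>C. real (card c) * 1) = ewens_sum \<theta> n (\<lambda>_. real n * 1)"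
    by (rule ewens_sum_cong) (simp add: sum_card_cycles)
  then show ?case unfolding ewens_sum_Suc Suc using ewens_sum_mult[of \<theta> n "real n" "\<lambda>_. 1"]
    by (simp add: Suc pochhammer_Suc algebra_simps)
qed

text \<open>
  The total Ewens weight of the permutations of \<open>[n]\<close> for which a given point lies on a cycle of length \<open>j\<close>, multiplied
  by \<open>n\<close> (for \<open>j > 0\<close>): choose the other elements of the cycle in order, and permute the remaining \<open>n - j\<close> points.
\<close>

definition len_weight :: "real \<Rightarrow> nat \<Rightarrow> nat \<Rightarrow> real" where
  "len_weight \<theta> n j = (if j \<le> n then \<theta> * (fact n / fact (n - j)) * pochhammer \<theta> (n - j) else 0)"

lemma len_weight_rec:
  fixes \<theta> :: real and n j :: nat
  shows "len_weight \<theta> (Suc n) (Suc j) = len_weight \<theta> n (Suc j) * (\<theta> + n - Suc j) + Suc j * len_weight \<theta> n j"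
proof -
  consider "j > n" | "j = n" | "j < n" by linarith
  then show ?thesis
  proof cases
    case 3
    then obtain m where m: "n = j + Suc m" using less_iff_Suc_add by auto
    have e: "n - j = Suc m" "n - Suc j = m" "Suc n - Suc j = Suc m" using m by auto
    have f: "fact (Suc m) = (1 + real m) * fact m" "fact (Suc n) = (1 + real n) * fact n" by simp_all
    have r: "real n = real j + 1 + real m" using m by simp
    have le: "Suc j \<le> n" "j \<le> n" "Suc j \<le> Suc n" using 3 by auto
    have "real m + 1 \<noteq> 0" by linarith
    then show ?thesis unfolding len_weight_def using le
      by (simp add: e f pochhammer_Suc r divide_simps del: fact_Suc of_nat_Suc) (simp add: algebra_simps)
  qed (simp_all add: len_weight_def)
qed

definition ewens_cycle_sum :: "real \<Rightarrow> nat \<Rightarrow> (nat \<Rightarrow> real) \<Rightarrow> real" where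
  "ewens_cycle_sum \<theta> n g = ewens_sum \<theta> n (\<lambda>C. \<Sum>c\<in>C. g (card c))"

definition cycle_pair_sum :: "(nat \<Rightarrow> nat \<Rightarrow> real) \<Rightarrow> nat set set \<Rightarrow> real" where
  "cycle_pair_sum g C = (\<Sum>c\<in>C. \<Sum>d\<in>C - {c}. g (card c) (card d))"

lemma cycle_pair_sum_insert:
  assumes "finite D" "x \<notin> D"
  shows "cycle_pair_sum g (insert x D) = cycle_pair_sum g D + (\<Sum>d\<in>D. g (card x) (card d) + g (card d) (card x))"
proof -
  have "cycle_pair_sum g (insert x D) = (\<Sum>d\<in>D. g (card x) (card d)) + (\<Sum>c\<in>D. \<Sum>d\<in>insert x D - {c}. g (card c) (card d))"
    using assms by (simp add: cycle_pair_sum_def)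
  also have "(\<Sum>c\<in>D. \<Sum>d\<in>insert x D - {c}. g (card c) (card d)) = (\<Sum>c\<in>D. g (card c) (card x) + (\<Sum>d\<in>D - {c}. g (card c) (card d)))"
  proof (rule sum.cong[OF refl])
    fix c assume "c \<in> D"
    then have "insert x D - {c} = insert x (D - {c})" using assms by auto
    then show "(\<Sum>d\<in>insert x D - {c}. g (card c) (card d)) = g (card c) (card x) + (\<Sum>d\<in>D - {c}. g (card c) (card d))"
      using assms by simp
  qed
  finally show ?thesis by (simp add: cycle_pair_sum_def sum.distrib)
qed

lemma cycle_pair_sum_swap: "finite C \<Longrightarrow> cycle_pair_sum (\<lambda>x y. g y x) C = cycle_pair_sum g C"
proof -
  assume f: "finite C"
  have "cycle_pair_sum h C = (\<Sum>c\<in>C. \<Sum>d\<in>C. if d = c then 0 else h (card c) (card d))" for h :: "nat \<Rightarrow> nat \<Rightarrow> real"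
    unfolding cycle_pair_sum_def using f
    by (intro sum.cong refl sum.mono_neutral_cong_left) auto
  then have "cycle_pair_sum (\<lambda>x y. g y x) C = (\<Sum>c\<in>C. \<Sum>d\<in>C. if d = c then 0 else g (card d) (card c))"
    "cycle_pair_sum g C = (\<Sum>d\<in>C. \<Sum>c\<in>C. if c = d then 0 else g (card d) (card c))" by auto
  then show ?thesis by (subst (asm) sum.swap) (simp add: eq_commute)
qed

definition ewens_pair_sum :: "real \<Rightarrow> nat \<Rightarrow> (nat \<Rightarrow> nat \<Rightarrow> real) \<Rightarrow> real" where
  "ewens_pair_sum \<theta> n g = ewens_sum \<theta> n (cycle_pair_sum g)"

lemma cycles_insert_facts:
  assumes t: "\<tau> permutes {1..n}"
  shows "{Suc n} \<notin> perm_cycles n \<tau>"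
    and "c \<in> perm_cycles n \<tau> \<Longrightarrow> insert (Suc n) c \<notin> perm_cycles n \<tau> - {c}"
    and "c \<in> perm_cycles n \<tau> \<Longrightarrow> card (insert (Suc n) c) = Suc (card c)"
  using perm_cycles_facts(2)[OF t, of "{Suc n}"] perm_cycles_facts(2)[OF t, of "insert (Suc n) c"]
    perm_cycles_facts(2)[OF t, of c] finite_subset[of c "{1..n}"]
  by (auto intro!: card_insert_disjoint)

text \<open>
  Inserting the new point into a cycle of length \<open>j\<close> replaces \<open>g j\<close> by \<open>g (j + 1)\<close>; there are \<open>j\<close> ways to do so.
\<close>

lemma ewens_cycle_sum_Suc:
  fixes g :: "nat \<Rightarrow> real"
  shows "ewens_cycle_sum \<theta> (Suc n) g = (\<theta> + n) * ewens_cycle_sum \<theta> n g + \<theta> * pochhammer \<theta> n * g 1 + ewens_cycle_sum \<theta> n (\<lambda>j. j * (g (Suc j) - g j))"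
proof -
  let ?F = "\<lambda>C. \<Sum>c\<in>C. g (card c)"
  have 1: "ewens_sum \<theta> n (\<lambda>C. ?F (insert {Suc n} C)) = g 1 * pochhammer \<theta> n + ewens_cycle_sum \<theta> n g"
  proof -
    have "ewens_sum \<theta> n (\<lambda>C. ?F (insert {Suc n} C)) = ewens_sum \<theta> n (\<lambda>C. g 1 * 1 + ?F C)"
      by (rule ewens_sum_cong) (simp add: perm_cycles_facts cycles_insert_facts)
    then show ?thesis unfolding ewens_sum_add ewens_sum_mult ewens_sum_1 ewens_cycle_sum_def .
  qed
  have 2: "ewens_sum \<theta> n (\<lambda>C. \<Sum>c\<in>C. card c * ?F (insert (insert (Suc n) c) (C - {c}))) =
     n * ewens_cycle_sum \<theta> n g + ewens_cycle_sum \<theta> n (\<lambda>j. j * (g (Suc j) - g j))"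
  proof -
    have "ewens_sum \<theta> n (\<lambda>C. \<Sum>c\<in>C. card c * ?F (insert (insert (Suc n) c) (C - {c}))) =
       ewens_sum \<theta> n (\<lambda>C. n * ?F C + (\<Sum>c\<in>C. card c * (g (Suc (card c)) - g (card c))))"
    proof (rule ewens_sum_cong)
      fix \<tau> assume t: "\<tau> permutes {1..n}"
      let ?C = "perm_cycles n \<tau>"
      have fC: "finite ?C" by (rule perm_cycles_facts(1)[OF t])
      have "card c * ?F (insert (insert (Suc n) c) (?C - {c})) = card c * ?F ?C + card c * (g (Suc (card c)) - g (card c))"
        if c: "c \<in> ?C" for c
      proof -
        have "?F (insert (insert (Suc n) c) (?C - {c})) = g (Suc (card c)) + ?F (?C - {c})"
          using fC cycles_insert_facts(2,3)[OF t c] by (subst sum.insert) auto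
        moreover have "?F ?C = g (card c) + ?F (?C - {c})" using fC c by (rule sum.remove)
        ultimately show ?thesis by (simp add: algebra_simps)
      qed
      then have "(\<Sum>c\<in>?C. card c * ?F (insert (insert (Suc n) c) (?C - {c}))) =
        (\<Sum>c\<in>?C. card c * ?F ?C + card c * (g (Suc (card c)) - g (card c)))" by (rule sum.cong[OF refl])
      also have "\<dots> = n * ?F ?C + (\<Sum>c\<in>?C. card c * (g (Suc (card c)) - g (card c)))"
        by (simp add: sum.distrib sum_card_cycles[OF t] flip: sum_distrib_right)
      finally show "(\<Sum>c\<in>?C. card c * ?F (insert (insert (Suc n) c) (?C - {c}))) =
         n * ?F ?C + (\<Sum>c\<in>?C. card c * (g (Suc (card c)) - g (card c)))" .
    qed
    then show ?thesis unfolding ewens_sum_add ewens_sum_mult ewens_cycle_sum_def .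
  qed
  show ?thesis unfolding ewens_cycle_sum_def[of \<theta> "Suc n"] ewens_sum_Suc 1 2 by (simp add: algebra_simps)
qed

lemma ewens_pair_sum_Suc:
  fixes g :: "nat \<Rightarrow> nat \<Rightarrow> real"
  shows "ewens_pair_sum \<theta> (Suc n) g = (\<theta> + n) * ewens_pair_sum \<theta> n g + \<theta> * ewens_cycle_sum \<theta> n (\<lambda>j. g 1 j + g j 1) +
    ewens_pair_sum \<theta> n (\<lambda>x y. x * (g (Suc x) y - g x y) + y * (g x (Suc y) - g x y))"
proof -
  have 1: "ewens_sum \<theta> n (\<lambda>C. cycle_pair_sum g (insert {Suc n} C)) = ewens_pair_sum \<theta> n g + ewens_cycle_sum \<theta> n (\<lambda>j. g 1 j + g j 1)"
  proof -
    have "ewens_sum \<theta> n (\<lambda>C. cycle_pair_sum g (insert {Suc n} C)) = ewens_sum \<theta> n (\<lambda>C. cycle_pair_sum g C + (\<Sum>c\<in>C. g 1 (card c) + g (card c) 1))"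
      by (rule ewens_sum_cong) (simp add: cycle_pair_sum_insert perm_cycles_facts cycles_insert_facts)
    then show ?thesis unfolding ewens_sum_add ewens_pair_sum_def ewens_cycle_sum_def .
  qed
  let ?h1 = "\<lambda>x y. real x * (g (Suc x) y - g x y)" and ?h2 = "\<lambda>x y. real y * (g x (Suc y) - g x y)"
  have 2: "ewens_sum \<theta> n (\<lambda>C. \<Sum>c\<in>C. card c * cycle_pair_sum g (insert (insert (Suc n) c) (C - {c}))) =
     n * ewens_pair_sum \<theta> n g + ewens_pair_sum \<theta> n (\<lambda>x y. ?h1 x y + ?h2 x y)"
  proof -
    have "ewens_sum \<theta> n (\<lambda>C. \<Sum>c\<in>C. card c * cycle_pair_sum g (insert (insert (Suc n) c) (C - {c}))) =
       ewens_sum \<theta> n (\<lambda>C. n * cycle_pair_sum g C + cycle_pair_sum (\<lambda>x y. ?h1 x y + ?h2 x y) C)"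
    proof (rule ewens_sum_cong)
      fix \<tau> assume t: "\<tau> permutes {1..n}"
      let ?C = "perm_cycles n \<tau>"
      have fC: "finite ?C" by (rule perm_cycles_facts(1)[OF t])
      have "card c * cycle_pair_sum g (insert (insert (Suc n) c) (?C - {c})) =
          card c * cycle_pair_sum g ?C + (\<Sum>d\<in>?C - {c}. ?h1 (card c) (card d) + ?h2 (card d) (card c))"
        if c: "c \<in> ?C" for c
      proof -
        have A: "cycle_pair_sum g (insert (insert (Suc n) c) (?C - {c})) = cycle_pair_sum g (?C - {c}) +
            (\<Sum>d\<in>?C - {c}. g (Suc (card c)) (card d) + g (card d) (Suc (card c)))"
          using fC cycles_insert_facts(2,3)[OF t c] by (subst cycle_pair_sum_insert) auto
        have "cycle_pair_sum g (insert c (?C - {c})) = cycle_pair_sum g (?C - {c}) + (\<Sum>d\<in>?C - {c}. g (card c) (card d) + g (card d) (card c))"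
          using fC by (intro cycle_pair_sum_insert) auto
        then have B: "cycle_pair_sum g ?C = cycle_pair_sum g (?C - {c}) + (\<Sum>d\<in>?C - {c}. g (card c) (card d) + g (card d) (card c))"
          using c by (simp add: insert_absorb)
        show ?thesis unfolding A B
          by (simp add: algebra_simps sum_distrib_left sum.distrib sum_subtractf)
      qed
      then have "(\<Sum>c\<in>?C. card c * cycle_pair_sum g (insert (insert (Suc n) c) (?C - {c}))) =
        (\<Sum>c\<in>?C. card c * cycle_pair_sum g ?C + (\<Sum>d\<in>?C - {c}. ?h1 (card c) (card d) + ?h2 (card d) (card c)))"
        by (rule sum.cong[OF refl])
      also have "\<dots> = n * cycle_pair_sum g ?C + (cycle_pair_sum ?h1 ?C + cycle_pair_sum (\<lambda>x y. ?h2 y x) ?C)"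
        by (simp add: sum.distrib sum_card_cycles[OF t] cycle_pair_sum_def flip: sum_distrib_right)
      also have "cycle_pair_sum (\<lambda>x y. ?h2 y x) ?C = cycle_pair_sum ?h2 ?C" by (rule cycle_pair_sum_swap[OF fC])
      also have "cycle_pair_sum ?h1 ?C + cycle_pair_sum ?h2 ?C = cycle_pair_sum (\<lambda>x y. ?h1 x y + ?h2 x y) ?C"
        by (simp add: cycle_pair_sum_def sum.distrib)
      finally show "(\<Sum>c\<in>?C. card c * cycle_pair_sum g (insert (insert (Suc n) c) (?C - {c}))) =
         n * cycle_pair_sum g ?C + cycle_pair_sum (\<lambda>x y. ?h1 x y + ?h2 x y) ?C" .
    qed
    then show ?thesis unfolding ewens_sum_add ewens_sum_mult ewens_pair_sum_def .
  qed
  show ?thesis unfolding ewens_pair_sum_def[of \<theta> "Suc n"] ewens_sum_Suc 1 2 by (simp add: algebra_simps)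
qed

lemma len_weight_outside: "j > n \<Longrightarrow> len_weight \<theta> n j = 0" by (simp add: len_weight_def)
lemma len_weight_0: "len_weight \<theta> n 0 = \<theta> * pochhammer \<theta> n" by (simp add: len_weight_def)

lemma ewens_sum_0: "ewens_sum \<theta> 0 F = F {}"
proof -
  have "{\<sigma>::nat \<Rightarrow> nat. \<sigma> permutes {1..0}} = {id}" by (auto simp: permutes_empty)
  then show ?thesis by (simp add: ewens_sum_def num_cycles_def perm_cycles_def)
qed

text \<open>
  Both sides satisfy the recursion \<open>ewens_cycle_sum_Suc\<close>. The induction is over all \<open>g\<close> simultaneously, as the recursion involves
  differences of \<open>g\<close>; shifting the summation index transfers the differences to the weights, where they are
  governed by \<open>len_weight_rec\<close>.
\<close>

lemma ewens_cycle_sum_formula: "ewens_cycle_sum \<theta> n g = (\<Sum>j<n. len_weight \<theta> n (Suc j) / Suc j * g (Suc j))"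
proof (induction n arbitrary: g)
  case 0 then show ?case by (simp add: ewens_cycle_sum_def ewens_sum_0)
next
  case (Suc n)
  let ?V = "len_weight \<theta> n"
  \<comment> \<open>the range can be extended since \<open>len_weight \<theta> n (n + 1) = 0\<close>\<close>
  have ext: "(\<Sum>j<n. ?V (Suc j) / Suc j * g (Suc j)) = (\<Sum>j<Suc n. ?V (Suc j) / Suc j * g (Suc j))" for g
    by (simp add: len_weight_outside)
  have sh: "?V 0 * g 1 + (\<Sum>j<n. ?V (Suc j) * g (Suc (Suc j))) = (\<Sum>j<Suc n. ?V j * g (Suc j))"
    by (subst sum.lessThan_Suc_shift) simp
  have "ewens_cycle_sum \<theta> (Suc n) g = (\<theta> + n) * (\<Sum>j<n. ?V (Suc j) / Suc j * g (Suc j)) + ?V 0 * g 1 +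
      (\<Sum>j<n. ?V (Suc j) / Suc j * (Suc j * (g (Suc (Suc j)) - g (Suc j))))"
    unfolding ewens_cycle_sum_Suc Suc len_weight_0 ..
  also have "(\<Sum>j<n. ?V (Suc j) / Suc j * (Suc j * (g (Suc (Suc j)) - g (Suc j)))) =
      (\<Sum>j<n. ?V (Suc j) * g (Suc (Suc j))) - (\<Sum>j<n. ?V (Suc j) / Suc j * (Suc j * g (Suc j)))"
    unfolding sum_subtractf[symmetric] by (intro sum.cong refl) (simp add: field_simps)
  also have "(\<theta> + n) * (\<Sum>j<n. ?V (Suc j) / Suc j * g (Suc j)) + ?V 0 * g 1 +
      ((\<Sum>j<n. ?V (Suc j) * g (Suc (Suc j))) - (\<Sum>j<n. ?V (Suc j) / Suc j * (Suc j * g (Suc j)))) =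
      (\<theta> + n) * (\<Sum>j<Suc n. ?V (Suc j) / Suc j * g (Suc j)) + (\<Sum>j<Suc n. ?V j * g (Suc j)) -
      (\<Sum>j<Suc n. ?V (Suc j) / Suc j * (Suc j * g (Suc j)))"
    unfolding ext[of g] ext[of "\<lambda>i. i * g i"] sh[symmetric] by simp
  also have "\<dots> = (\<Sum>j<Suc n. (?V (Suc j) * (\<theta> + n - Suc j) + Suc j * ?V j) / Suc j * g (Suc j))"
    unfolding sum_distrib_left sum.distrib[symmetric] sum_subtractf[symmetric]
    by (intro sum.cong refl) (simp add: field_simps del: of_nat_Suc)
  also have "\<dots> = (\<Sum>j<Suc n. len_weight \<theta> (Suc n) (Suc j) / Suc j * g (Suc j))"
    by (rule sum.cong[OF refl]) (use len_weight_rec[of \<theta> n] in simp)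
  finally show ?case .
qed

text \<open>
  As for a single cycle. The weight depends on the two lengths \<open>a\<close> and \<open>b\<close>, apart from the factor \<open>1 / (a * b)\<close>, only
  through \<open>a + b\<close>, because the recursion of the weights in \<open>a + b\<close> is the same as for one cycle of that length.
\<close>

lemma ewens_pair_sum_formula:
  "ewens_pair_sum \<theta> n g = (\<Sum>a<n. \<Sum>b<n. \<theta> / (real (Suc a) * real (Suc b)) * len_weight \<theta> n (Suc a + Suc b) * g (Suc a) (Suc b))"
proof (induction n arbitrary: g)
  case 0 then show ?case by (simp add: ewens_pair_sum_def ewens_sum_0 cycle_pair_sum_def)
next
  case (Suc n)
  let ?V = "len_weight \<theta> n"
  let ?c = "\<lambda>a b. \<theta> / (real (Suc a) * real (Suc b))"
  have ext: "(\<Sum>a<n. \<Sum>b<n. q a b * ?V (Suc a + Suc b) * g a b) = (\<Sum>a<Suc n. \<Sum>b<Suc n. q a b * ?V (Suc a + Suc b) * g a b)"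
    for q g :: "nat \<Rightarrow> nat \<Rightarrow> real"
    by (simp add: len_weight_outside)
  \<comment> \<open>inserting the new point into the first cycle, together with the case that it forms the first cycle\<close>
  have 1: "(\<Sum>a<n. \<Sum>b<n. ?c a b * ?V (Suc a + Suc b) * (Suc a * g (Suc (Suc a)) (Suc b))) +
      (\<Sum>b<n. \<theta> / Suc b * ?V (Suc b) * g 1 (Suc b)) = (\<Sum>a<Suc n. \<Sum>b<Suc n. \<theta> / Suc b * ?V (a + Suc b) * g (Suc a) (Suc b))"
  proof -
    have "(\<Sum>a<Suc n. \<Sum>b<Suc n. \<theta> / Suc b * ?V (a + Suc b) * g (Suc a) (Suc b)) =
        (\<Sum>a<Suc n. \<Sum>b<n. \<theta> / Suc b * ?V (a + Suc b) * g (Suc a) (Suc b))"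
      by (rule sum.cong[OF refl]) (simp add: len_weight_outside)
    also have "\<dots> = (\<Sum>b<n. \<theta> / Suc b * ?V (Suc b) * g 1 (Suc b)) +
        (\<Sum>a<n. \<Sum>b<n. \<theta> / Suc b * ?V (Suc a + Suc b) * g (Suc (Suc a)) (Suc b))"
      by (subst sum.lessThan_Suc_shift) simp
    also have "(\<Sum>a<n. \<Sum>b<n. \<theta> / Suc b * ?V (Suc a + Suc b) * g (Suc (Suc a)) (Suc b)) =
        (\<Sum>a<n. \<Sum>b<n. ?c a b * ?V (Suc a + Suc b) * (Suc a * g (Suc (Suc a)) (Suc b)))"
      by (intro sum.cong refl) (simp add: field_simps del: of_nat_Suc)
    finally show ?thesis by simp
  qed
  \<comment> \<open>the same for the second cycle\<close>
  have 2: "(\<Sum>a<n. \<Sum>b<n. ?c a b * ?V (Suc a + Suc b) * (Suc b * g (Suc a) (Suc (Suc b)))) +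
      (\<Sum>a<n. \<theta> / Suc a * ?V (Suc a) * g (Suc a) 1) = (\<Sum>a<Suc n. \<Sum>b<Suc n. \<theta> / Suc a * ?V (Suc a + b) * g (Suc a) (Suc b))"
  proof -
    have "(\<Sum>a<Suc n. \<Sum>b<Suc n. \<theta> / Suc a * ?V (Suc a + b) * g (Suc a) (Suc b)) =
        (\<Sum>a<n. \<Sum>b<Suc n. \<theta> / Suc a * ?V (Suc a + b) * g (Suc a) (Suc b))"
      by (simp add: len_weight_outside)
    also have "\<dots> = (\<Sum>a<n. \<theta> / Suc a * ?V (Suc a) * g (Suc a) 1 +
        (\<Sum>b<n. \<theta> / Suc a * ?V (Suc a + Suc b) * g (Suc a) (Suc (Suc b))))"
      by (intro sum.cong refl) (subst sum.lessThan_Suc_shift, simp)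
    also have "\<dots> = (\<Sum>a<n. \<theta> / Suc a * ?V (Suc a) * g (Suc a) 1) +
        (\<Sum>a<n. \<Sum>b<n. \<theta> / Suc a * ?V (Suc a + Suc b) * g (Suc a) (Suc (Suc b)))"
      by (rule sum.distrib)
    also have "(\<Sum>a<n. \<Sum>b<n. \<theta> / Suc a * ?V (Suc a + Suc b) * g (Suc a) (Suc (Suc b))) =
        (\<Sum>a<n. \<Sum>b<n. ?c a b * ?V (Suc a + Suc b) * (Suc b * g (Suc a) (Suc (Suc b))))"
      by (intro sum.cong refl) (simp add: field_simps del: of_nat_Suc)
    finally show ?thesis by simp
  qed
  have A: "\<theta> * ewens_cycle_sum \<theta> n (\<lambda>j. g 1 j + g j 1) = (\<Sum>b<n. \<theta> / Suc b * ?V (Suc b) * g 1 (Suc b)) +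
     (\<Sum>a<n. \<theta> / Suc a * ?V (Suc a) * g (Suc a) 1)"
    unfolding ewens_cycle_sum_formula sum_distrib_left sum.distrib[symmetric]
    by (intro sum.cong refl) (simp add: field_simps del: of_nat_Suc)
  have B: "ewens_pair_sum \<theta> n (\<lambda>x y. x * (g (Suc x) y - g x y) + y * (g x (Suc y) - g x y)) =
     (\<Sum>a<n. \<Sum>b<n. ?c a b * ?V (Suc a + Suc b) * (Suc a * g (Suc (Suc a)) (Suc b))) +
     (\<Sum>a<n. \<Sum>b<n. ?c a b * ?V (Suc a + Suc b) * (Suc b * g (Suc a) (Suc (Suc b)))) -
     (\<Sum>a<n. \<Sum>b<n. ?c a b * ?V (Suc a + Suc b) * ((Suc a + Suc b) * g (Suc a) (Suc b)))"
  proof -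
    have key: "c * W * (x * (g1 - g0) + y * (g2 - g0)) = c * W * (x * g1) + c * W * (y * g2) - c * W * ((x + y) * g0)"
      for c W x y g0 g1 g2 :: real by (simp add: algebra_simps)
    show ?thesis unfolding Suc sum.distrib[symmetric] sum_subtractf[symmetric]
      by (intro sum.cong refl) (simp only: key of_nat_add)
  qed
  have "ewens_pair_sum \<theta> (Suc n) g = (\<theta> + n) * (\<Sum>a<Suc n. \<Sum>b<Suc n. ?c a b * ?V (Suc a + Suc b) * g (Suc a) (Suc b)) +
     (\<Sum>a<Suc n. \<Sum>b<Suc n. \<theta> / Suc b * ?V (a + Suc b) * g (Suc a) (Suc b)) +
     (\<Sum>a<Suc n. \<Sum>b<Suc n. \<theta> / Suc a * ?V (Suc a + b) * g (Suc a) (Suc b)) -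
     (\<Sum>a<Suc n. \<Sum>b<Suc n. ?c a b * ?V (Suc a + Suc b) * ((Suc a + Suc b) * g (Suc a) (Suc b)))"
  proof -
    have E0: "(\<Sum>a<Suc n. \<Sum>b<Suc n. ?c a b * ?V (Suc a + Suc b) * g (Suc a) (Suc b)) =
      (\<Sum>a<n. \<Sum>b<n. ?c a b * ?V (Suc a + Suc b) * g (Suc a) (Suc b))"
      by (rule ext[of ?c "\<lambda>a b. g (Suc a) (Suc b)", symmetric])
    have E3: "(\<Sum>a<Suc n. \<Sum>b<Suc n. ?c a b * ?V (Suc a + Suc b) * ((Suc a + Suc b) * g (Suc a) (Suc b))) =
      (\<Sum>a<n. \<Sum>b<n. ?c a b * ?V (Suc a + Suc b) * ((Suc a + Suc b) * g (Suc a) (Suc b)))"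
      by (rule ext[of ?c "\<lambda>a b. (Suc a + Suc b) * g (Suc a) (Suc b)", symmetric])
    have arr: "p + (b1 + b2) + (a1 + a2 - s) = p + (a1 + b1) + (a2 + b2) - s" for p b1 b2 a1 a2 s :: real by simp
    show ?thesis unfolding ewens_pair_sum_Suc A B Suc[of g] E0 E3 1[symmetric] 2[symmetric] by (rule arr)
  qed
  also have "\<dots> = (\<Sum>a<Suc n. \<Sum>b<Suc n. ?c a b * (?V (Suc a + Suc b) * (\<theta> + n - Suc (a + Suc b)) + Suc (a + Suc b) * ?V (a + Suc b)) *
      g (Suc a) (Suc b))"
    unfolding sum_distrib_left sum.distrib[symmetric] sum_subtractf[symmetric]
  proof (intro sum.cong refl)
    fix a b :: nat
    define x y where "x = real (Suc a)" and "y = real (Suc b)"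
    have xy: "x \<noteq> 0" "y \<noteq> 0" "real (Suc a + Suc b) = x + y" "real (Suc (a + Suc b)) = x + y"
      by (simp_all add: x_def y_def)
    have s: "Suc a + b = a + Suc b" by simp
    show "(\<theta> + n) * (?c a b * ?V (Suc a + Suc b) * g (Suc a) (Suc b)) +
      \<theta> / Suc b * ?V (a + Suc b) * g (Suc a) (Suc b) + \<theta> / Suc a * ?V (Suc a + b) * g (Suc a) (Suc b) -
      ?c a b * ?V (Suc a + Suc b) * ((Suc a + Suc b) * g (Suc a) (Suc b)) =
      ?c a b * (?V (Suc a + Suc b) * (\<theta> + n - Suc (a + Suc b)) + Suc (a + Suc b) * ?V (a + Suc b)) * g (Suc a) (Suc b)"
      unfolding s xy(3,4) x_def[symmetric] y_def[symmetric] using xy(1,2) by (simp add: field_simps)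
  qed
  also have "\<dots> = (\<Sum>a<Suc n. \<Sum>b<Suc n. ?c a b * len_weight \<theta> (Suc n) (Suc a + Suc b) * g (Suc a) (Suc b))"
    by (simp only: len_weight_rec add_Suc)
  finally show ?case .
qed

section \<open>The law of the cycle length of a point\<close>

text \<open>
  The probability that a given point lies on a cycle of length \<open>j\<close>.
\<close>

definition len_prob :: "real \<Rightarrow> nat \<Rightarrow> nat \<Rightarrow> real" where
  "len_prob \<theta> n j = len_weight \<theta> n j / (n * pochhammer \<theta> n)"

lemma len_weight_nonneg: "\<theta> > 0 \<Longrightarrow> len_weight \<theta> n j \<ge> 0"
  using pochhammer_pos[of \<theta> "n - j"] by (simp add: len_weight_def)

lemma len_prob_nonneg: "\<theta> > 0 \<Longrightarrow> len_prob \<theta> n j \<ge> 0"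
  using len_weight_nonneg[of \<theta> n j] pochhammer_pos[of \<theta> n] by (simp add: len_prob_def)

lemma sum_len_weight: "(\<Sum>j<n. len_weight \<theta> n (Suc j)) = n * pochhammer \<theta> n"
proof -
  have "(\<Sum>j<n. len_weight \<theta> n (Suc j)) = (\<Sum>j<n. len_weight \<theta> n (Suc j) / Suc j * Suc j)"
    by (intro sum.cong refl) (simp del: of_nat_Suc)
  also have "\<dots> = ewens_cycle_sum \<theta> n real" by (rule ewens_cycle_sum_formula[symmetric])
  also have "\<dots> = ewens_sum \<theta> n (\<lambda>_. real n * 1)"
    unfolding ewens_cycle_sum_def by (rule ewens_sum_cong) (simp add: sum_card_cycles)
  also have "\<dots> = n * pochhammer \<theta> n" unfolding ewens_sum_mult ewens_sum_1 ..
  finally show ?thesis .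
qed

lemma sum_len_prob:
  assumes "\<theta> > 0" "n > 0" shows "(\<Sum>j<n. len_prob \<theta> n (Suc j)) = 1"
  using assms pochhammer_pos[of \<theta> n] by (simp add: len_prob_def sum_len_weight flip: sum_divide_distrib)

lemma len_prob_ratio:
  assumes "\<theta> > 0" "j < n"
  shows "len_prob \<theta> n (Suc j) * (\<theta> + real (n - Suc j)) = len_prob \<theta> n j * real (n - j)"
proof -
  obtain m where m: "n = j + Suc m" using assms less_iff_Suc_add by auto
  have e: "n - j = Suc m" "n - Suc j = m" using m by auto
  have "len_weight \<theta> n (Suc j) * (\<theta> + real m) = len_weight \<theta> n j * real (Suc m)"
    unfolding len_weight_def using assms by (simp add: e pochhammer_Suc divide_simps)
  then show ?thesis unfolding len_prob_def e by (simp add: divide_simps)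
qed

text \<open>
  By \<open>len_prob_ratio\<close> the ratio of consecutive weights is \<open>(n - j) / (\<theta> + n - j - 1)\<close>, and its comparison with \<open>1\<close> depends only on
  whether \<open>\<theta> \<le> 1\<close>.
\<close>

lemma len_prob_mono:
  assumes "\<theta> > 0"
  shows "(\<forall>j. j < n \<longrightarrow> len_prob \<theta> n j \<le> len_prob \<theta> n (Suc j)) \<or> (\<forall>j. j < n \<longrightarrow> len_prob \<theta> n (Suc j) \<le> len_prob \<theta> n j)"
proof (cases "\<theta> \<le> 1")
  case True
  have "len_prob \<theta> n j \<le> len_prob \<theta> n (Suc j)" if j: "j < n" for j
  proof -
    have r: "real (n - j) = real (n - Suc j) + 1" using j by simp
    have pos: "\<theta> + real (n - Suc j) > 0" using assms by simp
    have "len_prob \<theta> n j * (\<theta> + real (n - Suc j)) \<le> len_prob \<theta> n j * real (n - j)"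
      using True len_prob_nonneg[OF assms] unfolding r by (intro mult_left_mono) auto
    also have "\<dots> = len_prob \<theta> n (Suc j) * (\<theta> + real (n - Suc j))" using len_prob_ratio[OF assms j] by simp
    finally show ?thesis using pos by simp
  qed
  then show ?thesis by blast
next
  case False
  have "len_prob \<theta> n (Suc j) \<le> len_prob \<theta> n j" if j: "j < n" for j
  proof -
    have r: "real (n - j) = real (n - Suc j) + 1" using j by simp
    have pos: "\<theta> + real (n - Suc j) > 0" using assms by simp
    have "len_prob \<theta> n (Suc j) * (\<theta> + real (n - Suc j)) = len_prob \<theta> n j * real (n - j)" using len_prob_ratio[OF assms j] .
    also have "\<dots> \<le> len_prob \<theta> n j * (\<theta> + real (n - Suc j))"
      using False len_prob_nonneg[OF assms] unfolding r by (intro mult_left_mono) auto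
    finally show ?thesis using pos by simp
  qed
  then show ?thesis by blast
qed

text \<open>
  By monotonicity every weight is at most the larger one of the two extreme ones, hence at most their sum.
\<close>

definition len_prob_bound :: "real \<Rightarrow> nat \<Rightarrow> real" where
  "len_prob_bound \<theta> n = len_prob \<theta> n 1 + len_prob \<theta> n n"

lemma len_prob_le_len_prob_bound:
  assumes "\<theta> > 0" "1 \<le> j" "j \<le> n"
  shows "len_prob \<theta> n j \<le> len_prob_bound \<theta> n"
  using len_prob_mono[OF assms(1), of n]
proof
  assume *: "\<forall>j. j < n \<longrightarrow> len_prob \<theta> n j \<le> len_prob \<theta> n (Suc j)"
  have "len_prob \<theta> n j \<le> len_prob \<theta> n n" using assms(3)
  proof (induction rule: inc_induct)
    case (step i) then show ?case using * by (meson order_trans)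
  qed simp
  then show ?thesis using len_prob_nonneg[OF assms(1), of n 1] by (simp add: len_prob_bound_def)
next
  assume *: "\<forall>j. j < n \<longrightarrow> len_prob \<theta> n (Suc j) \<le> len_prob \<theta> n j"
  have "j \<le> n \<longrightarrow> len_prob \<theta> n j \<le> len_prob \<theta> n 1" using assms(2)
  proof (induction rule: dec_induct)
    case (step i) then show ?case using * by (meson Suc_leD Suc_le_lessD order_trans)
  qed simp
  then show ?thesis using len_prob_nonneg[OF assms(1), of n n] assms(3) by (simp add: len_prob_bound_def)
qed

lemma len_prob_bound_nonneg: "\<theta> > 0 \<Longrightarrow> len_prob_bound \<theta> n \<ge> 0"
  using len_prob_nonneg[of \<theta> n] by (simp add: len_prob_bound_def)

text \<open>
  The weight of length \<open>1\<close> is \<open>\<theta> / (\<theta> + n - 1)\<close>; the one of length \<open>n\<close> is of the order \<open>n powr (-\<theta>)\<close>, by Euler's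
  limit for the Gamma function.
\<close>

lemma len_prob_bound_tendsto_0:
  assumes "\<theta> > 0" shows "len_prob_bound \<theta> \<longlonglongrightarrow> 0"
proof -
  have 1: "(\<lambda>n. len_prob \<theta> (Suc n) 1) \<longlonglongrightarrow> 0"
  proof -
    have "len_prob \<theta> (Suc n) 1 = \<theta> / (\<theta> + real n)" for n
    proof -
      have "len_weight \<theta> (Suc n) 1 = \<theta> * real (Suc n) * pochhammer \<theta> n" by (simp add: len_weight_def)
      then show ?thesis using pochhammer_pos[OF assms, of n] assms
        by (simp add: len_prob_def pochhammer_Suc divide_simps)
    qed
    moreover have "(\<lambda>n. \<theta> / (\<theta> + real n)) \<longlonglongrightarrow> 0"
      by (intro tendsto_divide_0[OF tendsto_const] filterlim_at_top_imp_at_infinity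
          filterlim_tendsto_add_at_top[OF tendsto_const] filterlim_real_sequentially)
    ultimately show ?thesis by simp
  qed
  have 2: "(\<lambda>n. len_prob \<theta> (Suc n) (Suc n)) \<longlonglongrightarrow> 0"
  proof (rule Lim_transform_eventually)
    have "(\<lambda>n. \<theta> * (Gamma_series \<theta> n * (1 / real n powr \<theta>))) \<longlonglongrightarrow> \<theta> * (Gamma \<theta> * 0)"
    proof (intro tendsto_mult tendsto_const Gamma_series_LIMSEQ)
      show "(\<lambda>n. 1 / real n powr \<theta>) \<longlonglongrightarrow> 0"
      proof -
        have "(\<lambda>n. real n powr (- \<theta>)) \<longlonglongrightarrow> 0"
          using assms by (intro tendsto_neg_powr filterlim_real_sequentially) auto
        then show ?thesis by (simp add: powr_minus_divide)
      qed
    qed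
    then show "(\<lambda>n. \<theta> * (Gamma_series \<theta> n * (1 / real n powr \<theta>))) \<longlonglongrightarrow> 0" by simp
    show "\<forall>\<^sub>F n in sequentially. \<theta> * (Gamma_series \<theta> n * (1 / real n powr \<theta>)) = len_prob \<theta> (Suc n) (Suc n)"
      using eventually_gt_at_top[of 0]
    proof eventually_elim
      case (elim n)
      have "exp (\<theta> * ln (real n)) = real n powr \<theta>" using elim by (simp add: powr_def)
      then have "Gamma_series \<theta> n * (1 / real n powr \<theta>) = fact n / pochhammer \<theta> (Suc n)"
        using elim by (simp add: Gamma_series_def)
      moreover have "len_prob \<theta> (Suc n) (Suc n) = \<theta> * (fact n / pochhammer \<theta> (Suc n))"
        by (simp add: len_prob_def len_weight_def)
      ultimately show ?case by simp
    qed
  qed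
  have "(\<lambda>n. len_prob_bound \<theta> (Suc n)) \<longlonglongrightarrow> 0 + 0"
    unfolding len_prob_bound_def by (rule tendsto_add[OF 1 2])
  then show ?thesis by (subst (asm) filterlim_sequentially_Suc) simp
qed

text \<open>
  The finitely many large terms of \<open>r\<close> receive vanishing weight, and the weights sum to \<open>1\<close>.
\<close>

lemma len_prob_average_tendsto_0:
  assumes \<theta>: "\<theta> > 0" and r: "r \<longlonglongrightarrow> 0"
  shows "(\<lambda>n. \<Sum>j<n. len_prob \<theta> n (Suc j) * r (Suc j)) \<longlonglongrightarrow> (0::real)"
proof (rule LIMSEQ_I)
  fix e :: real assume e: "e > 0"
  obtain M where M: "\<And>j. j \<ge> M \<Longrightarrow> \<bar>r j\<bar> < e / 2"
    using LIMSEQ_D[OF r, of "e / 2"] e by auto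
  define R where "R = (\<Sum>j<M. \<bar>r (Suc j)\<bar>)"
  have R0: "R \<ge> 0" by (simp add: R_def sum_nonneg)
  have "\<forall>\<^sub>F n in sequentially. len_prob_bound \<theta> n < e / (2 * (R + 1))"
    using e R0 by (intro order_tendstoD(2)[OF len_prob_bound_tendsto_0[OF \<theta>]]) simp
  then obtain N where N: "\<And>n. n \<ge> N \<Longrightarrow> len_prob_bound \<theta> n < e / (2 * (R + 1))"
    unfolding eventually_sequentially by blast
  show "\<exists>no. \<forall>n\<ge>no. norm ((\<Sum>j<n. len_prob \<theta> n (Suc j) * r (Suc j)) - 0) < e"
  proof (intro exI[of _ "max 1 N"] allI impI)
    fix n assume n: "n \<ge> max 1 N"
    have "\<bar>\<Sum>j<n. len_prob \<theta> n (Suc j) * r (Suc j)\<bar> \<le> (\<Sum>j<n. \<bar>len_prob \<theta> n (Suc j) * r (Suc j)\<bar>)" by (rule sum_abs)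
    also have "\<dots> \<le> (\<Sum>j<n. (if j < M then len_prob_bound \<theta> n * \<bar>r (Suc j)\<bar> else 0) + len_prob \<theta> n (Suc j) * (e / 2))"
    proof (rule sum_mono)
      fix j assume j: "j \<in> {..<n}"
      have p: "0 \<le> len_prob \<theta> n (Suc j)" "len_prob \<theta> n (Suc j) \<le> len_prob_bound \<theta> n" using len_prob_nonneg[OF \<theta>] len_prob_le_len_prob_bound[OF \<theta>] j by auto
      show "\<bar>len_prob \<theta> n (Suc j) * r (Suc j)\<bar> \<le> (if j < M then len_prob_bound \<theta> n * \<bar>r (Suc j)\<bar> else 0) + len_prob \<theta> n (Suc j) * (e / 2)"
      proof (cases "j < M")
        case True
        have "\<bar>len_prob \<theta> n (Suc j) * r (Suc j)\<bar> \<le> len_prob_bound \<theta> n * \<bar>r (Suc j)\<bar>" using p by (simp add: abs_mult mult_right_mono)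
        moreover have "0 \<le> len_prob \<theta> n (Suc j) * (e / 2)" using p e by simp
        ultimately show ?thesis using True by simp
      next
        case False
        then have "\<bar>r (Suc j)\<bar> \<le> e / 2" using M[of "Suc j"] by simp
        then have "len_prob \<theta> n (Suc j) * \<bar>r (Suc j)\<bar> \<le> len_prob \<theta> n (Suc j) * (e / 2)" using p by (intro mult_left_mono) auto
        then show ?thesis using p False by (simp add: abs_mult)
      qed
    qed
    also have "\<dots> = (\<Sum>j<n. if j < M then len_prob_bound \<theta> n * \<bar>r (Suc j)\<bar> else 0) + e / 2"
    proof -
      have "(\<Sum>j<n. len_prob \<theta> n (Suc j) * (e / 2)) = (\<Sum>j<n. len_prob \<theta> n (Suc j)) * (e / 2)"
        by (rule sum_distrib_right[symmetric])
      then have "(\<Sum>j<n. len_prob \<theta> n (Suc j) * (e / 2)) = e / 2" using sum_len_prob[OF \<theta>, of n] n by simp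
      then show ?thesis by (simp add: sum.distrib)
    qed
    also have "(\<Sum>j<n. if j < M then len_prob_bound \<theta> n * \<bar>r (Suc j)\<bar> else 0) \<le> len_prob_bound \<theta> n * R"
    proof -
      have "(\<Sum>j<n. if j < M then len_prob_bound \<theta> n * \<bar>r (Suc j)\<bar> else 0) = (\<Sum>j\<in>{..<n} \<inter> {..<M}. len_prob_bound \<theta> n * \<bar>r (Suc j)\<bar>)"
        by (simp add: sum.If_cases) (simp add: lessThan_def)
      also have "\<dots> \<le> (\<Sum>j<M. len_prob_bound \<theta> n * \<bar>r (Suc j)\<bar>)"
        using len_prob_bound_nonneg[OF \<theta>] by (intro sum_mono2) auto
      finally show ?thesis by (simp add: R_def sum_distrib_left)
    qed
    also have "len_prob_bound \<theta> n * R \<le> len_prob_bound \<theta> n * (R + 1)" using len_prob_bound_nonneg[OF \<theta>] by (intro mult_left_mono) auto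
    also have "len_prob_bound \<theta> n * (R + 1) < e / 2"
      using N[of n] n R0 by (simp add: field_simps)
    finally show "norm ((\<Sum>j<n. len_prob \<theta> n (Suc j) * r (Suc j)) - 0) < e" by simp
  qed
qed

lemma frac_add_le: "0 \<le> e \<Longrightarrow> frac (x + e) \<le> frac x + (e::real)"
  unfolding frac_def using floor_mono[of x "x + e"] by linarith

text \<open>
  Writing \<open>s = (c + f) / q\<close> with \<open>c\<close> an integer and \<open>f = frac (q * s)\<close>, the fractional parts are \<open>(r + f) / q\<close> where
  \<open>r\<close> runs through all residues modulo \<open>q\<close> once.
\<close>

lemma sum_frac_rational_rotation:
  fixes s :: real and p :: int and q :: nat
  assumes q: "q > 0" and cop: "coprime p (int q)"
  shows "(\<Sum>i<q. frac (s + real i * p / q)) = (real q - 1) / 2 + frac (q * s)"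
proof -
  define c where "c = \<lfloor>q * s\<rfloor>"
  have f: "frac (s + real i * p / q) = (of_int ((c + int i * p) mod int q) + frac (q * s)) / q" for i :: nat
  proof -
    let ?t = "c + int i * p"
    have "s + real i * p / q = (of_int ?t + frac (q * s)) / q"
      using q by (simp add: c_def frac_def field_simps)
    also have "of_int ?t = real q * of_int (?t div int q) + of_int (?t mod int q)"
      by (metis mult_div_mod_eq of_int_add of_int_mult of_int_of_nat_eq)
    finally have eq: "s + real i * p / q = of_int (?t div int q) + (of_int (?t mod int q) + frac (q * s)) / q"
      using q by (simp add: field_simps)
    have b: "0 \<le> ?t mod int q" "?t mod int q \<le> int q - 1" using q by (auto simp: pos_mod_bound zle_diff1_eq)
    have "real_of_int (?t mod int q) \<le> real q - 1" using b(2) by linarith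
    then have "real_of_int (?t mod int q) + frac (q * s) < q" using frac_lt_1[of "q * s"] by linarith
    then have "(of_int (?t mod int q) + frac (q * s)) / q < 1" using q by simp
    moreover have "0 \<le> (of_int (?t mod int q) + frac (q * s)) / q" using b frac_ge_0[of "q * s"] by simp
    ultimately show ?thesis unfolding eq by (subst frac_unique_iff) auto
  qed
  have inj: "inj_on (\<lambda>i. (c + int i * p) mod int q) {..<q}"
  proof (rule inj_onI)
    fix i j assume ij: "i \<in> {..<q}" "j \<in> {..<q}" "(c + int i * p) mod int q = (c + int j * p) mod int q"
    then have "int q dvd (c + int i * p) - (c + int j * p)" by (simp add: mod_eq_dvd_iff)
    also have "(c + int i * p) - (c + int j * p) = (int i - int j) * p" by (simp add: algebra_simps)
    finally have "int q dvd int i - int j" using cop by (simp add: coprime_dvd_mult_left_iff coprime_commute)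
    then have "int i mod int q = int j mod int q" by (simp add: mod_eq_dvd_iff)
    then show "i = j" using ij by simp
  qed
  have im: "(\<lambda>i. (c + int i * p) mod int q) ` {..<q} = {0..<int q}"
    using q inj by (intro card_subset_eq) (auto simp: card_image)
  have "(\<Sum>i<q. real_of_int ((c + int i * p) mod int q)) = (\<Sum>r\<in>(\<lambda>i. (c + int i * p) mod int q) ` {..<q}. real_of_int r)"
    using inj by (simp add: sum.reindex)
  also have "\<dots> = (\<Sum>r\<in>{0..<int q}. real_of_int r)" unfolding im ..
  also have "{0..<int q} = int ` {..<q}" by (simp add: image_int_atLeastLessThan lessThan_atLeast0)
  also have "(\<Sum>r\<in>int ` {..<q}. real_of_int r) = (\<Sum>r<q. real r)" by (simp add: sum.reindex)
  also have "(\<Sum>r<q. real r) = real q * (real q - 1) / 2" by (induction q) (simp_all add: field_simps)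
  finally have S: "(\<Sum>i<q. real_of_int ((c + int i * p) mod int q)) = q * (real q - 1) / 2" using q by (simp add: of_nat_diff)
  show ?thesis
    unfolding f sum_divide_distrib[symmetric] sum.distrib S using q by (simp add: field_simps)
qed

lemma irrational_dist:
  assumes "\<alpha> \<notin> \<rat>" "k > 0"
  obtains \<delta> :: real where "\<delta> > 0" "\<And>h::int. \<bar>real k * \<alpha> - of_int h\<bar> \<ge> \<delta>"
proof (rule that[of "min (frac (k * \<alpha>)) (1 - frac (k * \<alpha>))"])
  have "k * \<alpha> \<notin> \<int>"
  proof
    assume "k * \<alpha> \<in> \<int>"
    then have "k * \<alpha> / k \<in> \<rat>" using Ints_subset_Rats by (intro Rats_divide) auto
    then show False using assms by simp
  qed
  then show "min (frac (k * \<alpha>)) (1 - frac (k * \<alpha>)) > 0"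
    using frac_gt_0_iff[of "k * \<alpha>"] frac_lt_1[of "k * \<alpha>"] by simp
  fix h :: int
  show "\<bar>k * \<alpha> - of_int h\<bar> \<ge> min (frac (k * \<alpha>)) (1 - frac (k * \<alpha>))"
  proof (cases "h \<le> \<lfloor>k * \<alpha>\<rfloor>")
    case True
    then have "real_of_int h \<le> of_int \<lfloor>k * \<alpha>\<rfloor>" by simp
    then show ?thesis unfolding frac_def by linarith
  next
    case False
    then have "real_of_int h \<ge> of_int \<lfloor>k * \<alpha>\<rfloor> + 1" by linarith
    then show ?thesis unfolding frac_def by linarith
  qed
qed

text \<open>
  Dirichlet's theorem gives an approximation with error below \<open>1 / (N * q)\<close>. An irrational number keeps a positive
  distance from all fractions with denominator at most \<open>K\<close>, so a large \<open>N\<close> forces \<open>q > K\<close>.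
\<close>

lemma large_denominator_approx:
  fixes \<alpha> :: real and K :: nat
  assumes "\<alpha> \<notin> \<rat>"
  obtains q :: nat and p :: int where "q > K" "coprime p (int q)" "\<bar>\<alpha> - p / q\<bar> \<le> 1 / real q ^ 2"
proof -
  have "\<forall>k\<in>{1..K}. \<exists>\<delta>>0. \<forall>h::int. \<bar>real k * \<alpha> - of_int h\<bar> \<ge> \<delta>"
    using irrational_dist[OF assms] by (metis atLeastAtMost_iff less_eq_Suc_le One_nat_def)
  then obtain \<delta> where \<delta>: "\<And>k. k \<in> {1..K} \<Longrightarrow> \<delta> k > 0"
    "\<And>k h. k \<in> {1..K} \<Longrightarrow> \<bar>real k * \<alpha> - of_int (h::int)\<bar> \<ge> \<delta> k" by metis
  \<comment> \<open>the element \<open>1\<close> keeps the set nonempty for \<open>K = 0\<close>\<close>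
  define d where "d = Min (insert 1 (\<delta> ` {1..K}))"
  have d0: "d > 0" unfolding d_def using \<delta>(1) by (subst Min_gr_iff) auto
  have dle: "d \<le> \<delta> k" if "k \<in> {1..K}" for k unfolding d_def using that by (intro Min_le) auto
  obtain N :: nat where N: "real N > 1 / d" using reals_Archimedean2 by blast
  have "0 < 1 / d" using d0 by simp
  then have "0 < real N" using N by linarith
  then have N0: "N > 0" by simp
  obtain h k :: int where hk: "coprime h k" "0 < k" "k \<le> int N" "\<bar>of_int k * \<alpha> - of_int h\<bar> < 1 / N"
    using Dirichlet_approx_coprime[OF N0] by blast
  define q where "q = nat k"
  have q: "k = int q" "q > 0" "q \<le> N" using hk by (auto simp: q_def)
  have "1 / N < d" using N d0 N0 by (simp add: field_simps)
  then have "q > K" using hk(4) \<delta>(2)[of q h] dle[of q] q by (cases "q \<le> K") force+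
  moreover have "\<bar>\<alpha> - h / q\<bar> \<le> 1 / real q ^ 2"
  proof -
    have "\<bar>\<alpha> - h / q\<bar> = \<bar>q * \<alpha> - h\<bar> / q" using q by (simp add: field_simps abs_divide flip: abs_mult)
    also have "\<dots> \<le> (1 / N) / q" using hk(4) q by (intro divide_right_mono) auto
    also have "\<dots> \<le> (1 / q) / q" using q by (intro divide_right_mono divide_left_mono) auto
    finally show ?thesis by (simp add: power2_eq_square)
  qed
  ultimately show ?thesis using that[of q h] hk(1) q by simp
qed

text \<open>
  Over a window of length \<open>q\<close>, where \<open>p / q\<close> approximates \<open>\<alpha>\<close> to within \<open>1 / q^2\<close>, the rotation by \<open>\<alpha>\<close> stays within \<open>1 / q\<close> of
  the rational rotation, whose average is \<open>1/2\<close> up to \<open>1 / (2 * q)\<close>. Hence the deviation of the sum is bounded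
  independently of \<open>q\<close> and of the starting point.
\<close>

lemma irrational_rotation_windows:
  fixes \<alpha> :: real
  assumes "\<alpha> \<notin> \<rat>"
  shows "\<exists>q::nat. q > K \<and> (\<forall>s::real. \<bar>\<Sum>i<q. frac (s + real i * \<alpha>) - 1 / 2\<bar> \<le> 5 / 2)"
proof -
  obtain q p where qp: "q > K" "coprime p (int q)" "\<bar>\<alpha> - p / q\<bar> \<le> 1 / real q ^ 2"
    using large_denominator_approx[OF assms] by blast
  have q0: "q > 0" using qp by simp
  have "\<bar>\<Sum>i<q. frac (s + real i * \<alpha>) - 1 / 2\<bar> \<le> 5 / 2" for s :: real
  proof -
    have e: "\<bar>i * (\<alpha> - p / q)\<bar> \<le> 1 / q" if "i < q" for i
    proof -
      have "\<bar>i * (\<alpha> - p / q)\<bar> \<le> q * (1 / real q ^ 2)"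
        using that qp(3) by (simp only: abs_mult abs_of_nat) (intro mult_mono, auto)
      then show ?thesis using q0 by (simp add: power2_eq_square)
    qed
    \<comment> \<open>moving the starting point by \<open>1 / q\<close> makes the perturbation nonnegative, as \<open>frac_add_le\<close> requires\<close>
    have up: "frac (s + real i * \<alpha>) \<le> frac ((s - 1 / q) + real i * p / q) + 2 / q" if "i < q" for i
    proof -
      have eq: "s + i * \<alpha> = ((s - 1 / q) + real i * p / q) + (1 / q + i * (\<alpha> - p / q))" by (simp add: algebra_simps)
      have "0 \<le> 1 / q + i * (\<alpha> - p / q)" "1 / q + i * (\<alpha> - p / q) \<le> 2 / q"
        using e[OF that] by (auto simp: abs_le_iff field_simps)
      then show ?thesis
        using frac_add_le[of "1 / q + i * (\<alpha> - p / q)" "(s - 1 / q) + real i * p / q"] unfolding eq by linarith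
    qed
    have lo: "frac ((s + 1 / q) + real i * p / q) \<le> frac (s + real i * \<alpha>) + 2 / q" if "i < q" for i
    proof -
      have eq: "(s + 1 / q) + real i * p / q = (s + i * \<alpha>) + (1 / q - i * (\<alpha> - p / q))" by (simp add: algebra_simps)
      have "0 \<le> 1 / q - i * (\<alpha> - p / q)" "1 / q - i * (\<alpha> - p / q) \<le> 2 / q"
        using e[OF that] by (auto simp: abs_le_iff field_simps)
      then show ?thesis
        using frac_add_le[of "1 / q - i * (\<alpha> - p / q)" "s + i * \<alpha>"] unfolding eq by linarith
    qed
    have "(\<Sum>i<q. frac (s + real i * \<alpha>)) \<le> (\<Sum>i<q. frac ((s - 1 / q) + real i * p / q) + 2 / q)"
      using up by (intro sum_mono) auto
    also have "\<dots> = (real q - 1) / 2 + frac (q * (s - 1 / q)) + 2"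
      unfolding sum.distrib sum_frac_rational_rotation[OF q0 qp(2)] using q0 by simp
    also have "\<dots> \<le> (real q - 1) / 2 + 3" using frac_lt_1[of "q * (s - 1 / q)"] by simp
    finally have U: "(\<Sum>i<q. frac (s + real i * \<alpha>)) \<le> q / 2 + 5 / 2" by (simp add: field_simps)
    have "(real q - 1) / 2 \<le> (real q - 1) / 2 + frac (q * (s + 1 / q))" by simp
    also have "\<dots> = (\<Sum>i<q. frac ((s + 1 / q) + real i * p / q))"
      unfolding sum_frac_rational_rotation[OF q0 qp(2)] ..
    also have "\<dots> \<le> (\<Sum>i<q. frac (s + real i * \<alpha>) + 2 / q)" using lo by (intro sum_mono) auto
    also have "\<dots> = (\<Sum>i<q. frac (s + real i * \<alpha>)) + 2" using q0 by (simp add: sum.distrib)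
    finally have L: "(\<Sum>i<q. frac (s + real i * \<alpha>)) \<ge> q / 2 - 5 / 2" by (simp add: field_simps)
    have "(\<Sum>i<q. frac (s + real i * \<alpha>) - 1 / 2) = (\<Sum>i<q. frac (s + real i * \<alpha>)) - q / 2"
      by (simp add: sum_subtractf)
    then show ?thesis using U L by linarith
  qed
  then show ?thesis using qp(1) by blast
qed

text \<open>
  Summation by parts in an averaged form: shifting \<open>f\<close> by \<open>i\<close> changes the sum by at most \<open>i\<close> times the total variation of the
  weights \<open>u\<close>, and the mean of the shifts by \<open>0, ..., q - 1\<close> is controlled by the window sums.
\<close>

lemma window_averaging:
  fixes u f :: "nat \<Rightarrow> real"
  assumes u0: "u 0 = 0" and un: "u (Suc n) = 0" and f: "\<And>j. \<bar>f j\<bar> \<le> 1"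
    and w: "\<And>j. \<bar>\<Sum>i<q. f (j + i)\<bar> \<le> C"
  shows "q * \<bar>\<Sum>j\<le>n. u j * f j\<bar> \<le> C * (\<Sum>j\<le>n. \<bar>u j\<bar>) + real q ^ 2 * (\<Sum>j\<le>n. \<bar>u (Suc j) - u j\<bar>)"
proof -
  define TV where "TV = (\<Sum>j\<le>n. \<bar>u (Suc j) - u j\<bar>)"
  \<comment> \<open>the sum with \<open>f\<close> shifted by \<open>i\<close>\<close>
  define D where "D i = (\<Sum>j\<le>n. u j * f (j + i))" for i
  have TV0: "TV \<ge> 0" by (simp add: TV_def sum_nonneg)
  have step: "\<bar>D i - D (Suc i)\<bar> \<le> TV" for i
  proof -
    have "D i = (\<Sum>j\<le>Suc n. u j * f (j + i))" by (simp add: D_def un)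
    also have "\<dots> = (\<Sum>j\<le>n. u (Suc j) * f (Suc j + i))" by (subst sum.atMost_Suc_shift) (simp add: u0)
    finally have "D i - D (Suc i) = (\<Sum>j\<le>n. (u (Suc j) - u j) * f (Suc j + i))"
      by (simp add: D_def algebra_simps sum_subtractf)
    also have "\<bar>\<dots>\<bar> \<le> (\<Sum>j\<le>n. \<bar>(u (Suc j) - u j) * f (Suc j + i)\<bar>)" by (rule sum_abs)
    also have "\<dots> \<le> TV" unfolding TV_def
      using f by (intro sum_mono) (simp add: abs_mult mult_left_le)
    finally show ?thesis .
  qed
  have Di: "\<bar>D 0 - D i\<bar> \<le> i * TV" for i
  proof (induction i)
    case (Suc i)
    have "\<bar>D 0 - D (Suc i)\<bar> \<le> \<bar>D 0 - D i\<bar> + \<bar>D i - D (Suc i)\<bar>" by linarith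
    then show ?case using Suc step[of i] by (simp add: algebra_simps)
  qed simp
  have "(\<Sum>i<q. D i) = (\<Sum>j\<le>n. u j * (\<Sum>i<q. f (j + i)))"
    unfolding D_def by (subst sum.swap) (simp add: sum_distrib_left)
  also have "\<bar>\<dots>\<bar> \<le> (\<Sum>j\<le>n. \<bar>u j * (\<Sum>i<q. f (j + i))\<bar>)" by (rule sum_abs)
  also have "\<dots> \<le> (\<Sum>j\<le>n. \<bar>u j\<bar> * C)" using w by (intro sum_mono) (simp add: abs_mult mult_left_mono)
  finally have 1: "\<bar>\<Sum>i<q. D i\<bar> \<le> C * (\<Sum>j\<le>n. \<bar>u j\<bar>)" by (simp add: sum_distrib_left mult.commute)
  have "q * D 0 = (\<Sum>i<q. D i) + (\<Sum>i<q. D 0 - D i)" by (simp add: sum_subtractf)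
  moreover have "\<bar>\<Sum>i<q. D 0 - D i\<bar> \<le> real q ^ 2 * TV"
  proof -
    have "\<bar>\<Sum>i<q. D 0 - D i\<bar> \<le> (\<Sum>i<q. \<bar>D 0 - D i\<bar>)" by (rule sum_abs)
    also have "\<dots> \<le> (\<Sum>i<q. q * TV)"
    proof (rule sum_mono)
      fix i assume "i \<in> {..<q}"
      then have "i * TV \<le> q * TV" using TV0 by (intro mult_right_mono) auto
      then show "\<bar>D 0 - D i\<bar> \<le> q * TV" using Di[of i] by linarith
    qed
    finally show ?thesis by (simp add: power2_eq_square)
  qed
  ultimately have "\<bar>q * D 0\<bar> \<le> C * (\<Sum>j\<le>n. \<bar>u j\<bar>) + real q ^ 2 * TV" using 1 by linarith
  then show ?thesis by (simp add: D_def TV_def abs_mult)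
qed

text \<open>
  The weights \<open>len_prob \<theta> n j * (j / n)^m\<close> have mass at most \<open>1\<close> and total variation at most four times \<open>len_prob_bound\<close>, as both
  factors are monotone in \<open>j\<close>. Averaging over windows of a fixed large length \<open>q\<close> leaves an error of order \<open>1 / q\<close> plus \<open>q\<close> times the
  total variation, and the latter vanishes as \<open>n\<close> grows.
\<close>

lemma len_prob_equidistribution:
  fixes \<alpha> :: real
  assumes \<theta>: "\<theta> > 0" and \<alpha>: "\<alpha> \<notin> \<rat>"
  shows "(\<lambda>n. \<Sum>j<n. len_prob \<theta> n (Suc j) * ((real (Suc j) / n) ^ m * (frac (Suc j * \<alpha>) - 1 / 2))) \<longlonglongrightarrow> 0"
proof (rule LIMSEQ_I)
  fix e :: real assume e: "e > 0"
  obtain K :: nat where K: "real K > 5 / e" using reals_Archimedean2 by blast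
  obtain q :: nat where q1: "q > K" and q2: "\<forall>s::real. \<bar>\<Sum>i<q. frac (s + real i * \<alpha>) - 1 / 2\<bar> \<le> 5 / 2"
    using irrational_rotation_windows[OF \<alpha>, of K] by blast
  note q = q1 spec[OF q2]
  have q0: "real q > 0" and qe: "5 / q < e"
  proof -
    have "0 < 5 / e" using e by simp
    then have qq: "real q > 5 / e" using K q(1) by linarith
    show q0: "real q > 0" using qq \<open>0 < 5 / e\<close> by linarith
    show "5 / q < e" using qq e q0 by (simp add: field_simps)
  qed
  have "\<forall>\<^sub>F n in sequentially. len_prob_bound \<theta> n < e / (8 * q)"
    using e q0 by (intro order_tendstoD(2)[OF len_prob_bound_tendsto_0[OF \<theta>]]) simp
  then obtain N where N: "\<And>n. n \<ge> N \<Longrightarrow> len_prob_bound \<theta> n < e / (8 * q)"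
    unfolding eventually_sequentially by blast
  show "\<exists>no. \<forall>n\<ge>no. norm ((\<Sum>j<n. len_prob \<theta> n (Suc j) * ((real (Suc j) / n) ^ m * (frac (Suc j * \<alpha>) - 1 / 2))) - 0) < e"
  proof (intro exI[of _ "max 1 N"] allI impI)
    fix n assume n: "n \<ge> max 1 N"
    then have n1: "n \<ge> 1" by simp
    let ?P = "len_prob_bound \<theta> n"
    define Q where "Q j = (real j / n) ^ m" for j
    \<comment> \<open>cut off outside \<open>{1..n}\<close>; the two jumps at the ends are bounded by \<open>len_prob_bound\<close> each\<close>
    define u where "u j = (if 1 \<le> j \<and> j \<le> n then len_prob \<theta> n j * Q j else 0)" for j
    define f where "f j = frac (j * \<alpha>) - 1 / 2" for j :: nat
    have Q: "0 \<le> Q j" "j \<le> n \<Longrightarrow> Q j \<le> 1" "Q j \<le> Q (Suc j)" for j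
      using n1 by (auto simp: Q_def power_le_one_iff divide_le_eq_1 intro!: power_le_one power_mono divide_right_mono)
    have p: "0 \<le> len_prob \<theta> n j" "1 \<le> j \<Longrightarrow> j \<le> n \<Longrightarrow> len_prob \<theta> n j \<le> ?P" for j
      using len_prob_nonneg[OF \<theta>] len_prob_le_len_prob_bound[OF \<theta>] by auto
    have u: "0 \<le> u j" "u j \<le> (if 1 \<le> j \<and> j \<le> n then len_prob \<theta> n j else 0)" for j
      using p[of j] Q[of j] by (auto simp: u_def mult_left_le)
    have uP: "u j \<le> ?P" for j
      using u(2)[of j] p(2)[of j] len_prob_bound_nonneg[OF \<theta>, of n] by (auto split: if_splits)
    have su: "(\<Sum>j\<le>n. \<bar>u j\<bar>) \<le> 1"
    proof -
      have "(\<Sum>j\<le>n. \<bar>u j\<bar>) \<le> (\<Sum>j\<le>n. if 1 \<le> j \<and> j \<le> n then len_prob \<theta> n j else 0)"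
        using u by (intro sum_mono) (metis abs_of_nonneg)
      also have "\<dots> = (\<Sum>j<n. len_prob \<theta> n (Suc j))"
        by (subst sum.atMost_shift) (auto intro!: sum.cong)
      finally show ?thesis using sum_len_prob[OF \<theta>, of n] n1 by simp
    qed
    have TV: "(\<Sum>j\<le>n. \<bar>u (Suc j) - u j\<bar>) \<le> 4 * ?P"
    proof -
      have "{..n} = insert 0 (insert n {1..<n})" using n1 by auto
      then have "(\<Sum>j\<le>n. \<bar>u (Suc j) - u j\<bar>) = \<bar>u 1 - u 0\<bar> + \<bar>u (Suc n) - u n\<bar> + (\<Sum>j=1..<n. \<bar>u (Suc j) - u j\<bar>)"
        using n1 by simp
      moreover have "\<bar>u 1 - u 0\<bar> \<le> ?P" using u(1)[of 1] uP[of 1] by (simp add: u_def)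
      moreover have "\<bar>u (Suc n) - u n\<bar> \<le> ?P" using u(1)[of n] uP[of n] by (simp add: u_def)
      moreover have "(\<Sum>j=1..<n. \<bar>u (Suc j) - u j\<bar>) \<le> 2 * ?P"
      proof -
        have "(\<Sum>j=1..<n. \<bar>u (Suc j) - u j\<bar>) \<le> (\<Sum>j=1..<n. \<bar>len_prob \<theta> n (Suc j) - len_prob \<theta> n j\<bar> + ?P * (Q (Suc j) - Q j))"
        proof (rule sum_mono)
          fix j assume j: "j \<in> {1..<n}"
          have "u (Suc j) - u j = (len_prob \<theta> n (Suc j) - len_prob \<theta> n j) * Q (Suc j) + len_prob \<theta> n j * (Q (Suc j) - Q j)"
            using j by (simp add: u_def algebra_simps)
          also have "\<bar>\<dots>\<bar> \<le> \<bar>(len_prob \<theta> n (Suc j) - len_prob \<theta> n j) * Q (Suc j)\<bar> + \<bar>len_prob \<theta> n j * (Q (Suc j) - Q j)\<bar>"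
            by (rule abs_triangle_ineq)
          also have "\<bar>(len_prob \<theta> n (Suc j) - len_prob \<theta> n j) * Q (Suc j)\<bar> \<le> \<bar>len_prob \<theta> n (Suc j) - len_prob \<theta> n j\<bar>"
            using Q(1)[of "Suc j"] Q(2)[of "Suc j"] j by (simp add: abs_mult mult_left_le)
          also have "\<bar>len_prob \<theta> n j * (Q (Suc j) - Q j)\<bar> \<le> ?P * (Q (Suc j) - Q j)"
            using p[of j] j Q(3)[of j] by (simp add: abs_mult mult_right_mono)
          finally show "\<bar>u (Suc j) - u j\<bar> \<le> \<bar>len_prob \<theta> n (Suc j) - len_prob \<theta> n j\<bar> + ?P * (Q (Suc j) - Q j)" by simp
        qed
        also have "\<dots> = (\<Sum>j=1..<n. \<bar>len_prob \<theta> n (Suc j) - len_prob \<theta> n j\<bar>) + ?P * (Q n - Q 1)"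
          using sum_Suc_diff'[OF n1, of Q] by (simp add: sum.distrib flip: sum_distrib_left)
        also have "(\<Sum>j=1..<n. \<bar>len_prob \<theta> n (Suc j) - len_prob \<theta> n j\<bar>) \<le> ?P"
          using len_prob_mono[OF \<theta>, of n]
        proof
          assume "\<forall>j. j < n \<longrightarrow> len_prob \<theta> n j \<le> len_prob \<theta> n (Suc j)"
          then have "(\<Sum>j=1..<n. \<bar>len_prob \<theta> n (Suc j) - len_prob \<theta> n j\<bar>) = (\<Sum>j=1..<n. len_prob \<theta> n (Suc j) - len_prob \<theta> n j)"
            by (intro sum.cong) auto
          then show ?thesis using sum_Suc_diff'[OF n1, of "len_prob \<theta> n"] p(1)[of 1] by (simp add: len_prob_bound_def)
        next
          assume "\<forall>j. j < n \<longrightarrow> len_prob \<theta> n (Suc j) \<le> len_prob \<theta> n j"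
          then have "(\<Sum>j=1..<n. \<bar>len_prob \<theta> n (Suc j) - len_prob \<theta> n j\<bar>) = - (\<Sum>j=1..<n. len_prob \<theta> n (Suc j) - len_prob \<theta> n j)"
            unfolding sum_negf[symmetric] by (intro sum.cong) auto
          then show ?thesis using sum_Suc_diff'[OF n1, of "len_prob \<theta> n"] p(1)[of n] by (simp only: len_prob_bound_def)
        qed
        also have "?P * (Q n - Q 1) \<le> ?P * 1"
          using Q(1)[of 1] Q(2)[of n] len_prob_bound_nonneg[OF \<theta>, of n] by (intro mult_left_mono) auto
        finally show ?thesis by simp
      qed
      ultimately show ?thesis by linarith
    qed
    have fb: "\<bar>f j\<bar> \<le> 1" for j using frac_ge_0[of "j * \<alpha>"] frac_lt_1[of "j * \<alpha>"] unfolding f_def by linarith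
    have fw: "\<bar>\<Sum>i<q. f (j + i)\<bar> \<le> 5 / 2" for j
      using q(2)[of "j * \<alpha>"] by (simp add: f_def algebra_simps)
    have "q * \<bar>\<Sum>j\<le>n. u j * f j\<bar> \<le> 5 / 2 * (\<Sum>j\<le>n. \<bar>u j\<bar>) + real q ^ 2 * (\<Sum>j\<le>n. \<bar>u (Suc j) - u j\<bar>)"
      by (rule window_averaging[OF _ _ fb fw]) (simp_all add: u_def)
    also have "\<dots> \<le> 5 / 2 * 1 + real q ^ 2 * (4 * ?P)"
      using su TV by (intro add_mono mult_left_mono) auto
    also have "\<dots> < q * e"
    proof -
      have "5 / 2 < q * (e / 2)" using qe q0 by (simp add: field_simps)
      moreover have "?P * (8 * q) < e" using N[of n] n q0 by (simp add: field_simps)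
      then have "q * (4 * ?P) < e / 2" by (simp add: mult.commute mult.left_commute)
      then have "q * (q * (4 * ?P)) < q * (e / 2)" using q0 by (intro mult_strict_left_mono) auto
      ultimately show ?thesis by (simp add: power2_eq_square algebra_simps)
    qed
    finally have "\<bar>\<Sum>j\<le>n. u j * f j\<bar> < e" using q0 by simp
    moreover have "(\<Sum>j\<le>n. u j * f j) = (\<Sum>j<n. len_prob \<theta> n (Suc j) * ((real (Suc j) / n) ^ m * (frac (Suc j * \<alpha>) - 1 / 2)))"
      by (subst sum.atMost_shift) (auto simp: u_def Q_def f_def mult.assoc simp del: of_nat_Suc intro!: sum.cong)
    ultimately show "norm ((\<Sum>j<n. len_prob \<theta> n (Suc j) * ((real (Suc j) / n) ^ m * (frac (Suc j * \<alpha>) - 1 / 2))) - 0) < e"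
      by simp
  qed
qed

section \<open>A sum of greatest common divisors\<close>

text \<open>
  Divisors come in pairs \<open>d\<close>, \<open>m / d\<close>, and one of the two is at most \<open>sqrt m\<close>.
\<close>

lemma card_divisors_le:
  fixes m :: nat
  assumes "m > 0"
  shows "real (card {d. d dvd m}) \<le> 2 * sqrt m"
proof -
  define s where "s = nat \<lfloor>sqrt m\<rfloor>"
  have "real s = of_int \<lfloor>sqrt m\<rfloor>" by (simp add: s_def)
  then have s: "real s \<le> sqrt m" "sqrt m < real s + 1" by linarith+
  have "{d. d dvd m} \<subseteq> {1..s} \<union> (\<lambda>e. m div e) ` {1..s}"
  proof
    fix d assume "d \<in> {d. d dvd m}"
    then obtain e where m: "m = d * e" by auto
    have de: "d > 0" "e > 0" using m assms by auto
    show "d \<in> {1..s} \<union> (\<lambda>e. m div e) ` {1..s}"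
    proof (cases "d \<le> s")
      case False
      have "e \<le> s"
      proof (rule ccontr)
        assume "\<not> e \<le> s"
        then have "real s + 1 \<le> d" "real s + 1 \<le> e" using False by auto
        then have "(real s + 1) * (real s + 1) \<le> real d * real e" by (intro mult_mono) auto
        also have "\<dots> = sqrt m * sqrt m" using m by simp
        also have "\<dots> < (real s + 1) * (real s + 1)" using s(2) assms by (intro mult_strict_mono) auto
        finally show False by simp
      qed
      moreover have "d = m div e" using m de by simp
      ultimately show ?thesis using de by (intro UnI2 image_eqI[of _ _ e]) auto
    qed (use de in auto)
  qed
  then have "card {d. d dvd m} \<le> card ({1..s} \<union> (\<lambda>e. m div e) ` {1..s})" by (intro card_mono) auto
  also have "\<dots> \<le> card {1..s} + card ((\<lambda>e. m div e) ` {1..s})" by (rule card_Un_le)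
  also have "\<dots> \<le> s + s" using card_image_le[of "{1..s}" "\<lambda>e. m div e"] by simp
  finally show ?thesis using s(1) by linarith
qed

lemma sum_inverse_le:
  fixes m :: nat
  assumes "m > 0"
  shows "(\<Sum>q=1..m. 1 / real q) \<le> 1 + ln (real m)"
proof -
  have "(\<Sum>q=1..m. 1 / real q) = harm m" by (simp add: harm_def inverse_eq_divide)
  then show ?thesis using euler_mascheroni_sequence_decreasing[of 1 m] assms by (simp add: harm_def)
qed

text \<open>
  A pair of cycles of lengths \<open>a\<close> and \<open>b\<close> has weight \<open>1 / (a * b)\<close> times a function of \<open>a + b\<close>. This is the part of the mean of
  \<open>gcd a b\<close> that belongs to \<open>a + b = m\<close>, without that function.
\<close>

definition gcd_sum :: "nat \<Rightarrow> real" where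
  "gcd_sum m = (\<Sum>a=1..<m. real (gcd a (m - a)) / (real a * real (m - a)))"

text \<open>
  A number \<open>a\<close> is determined by \<open>d = gcd a m\<close> and \<open>a / d\<close>, and the term is the reciprocal of the second of these. So the sum is at
  most the number of divisors times a harmonic sum.
\<close>

lemma sum_gcd_over:
  fixes m :: nat
  assumes "m > 0"
  shows "(\<Sum>a=1..<m. real (gcd a m) / a) \<le> 2 * sqrt m * (1 + ln m)"
proof -
  let ?D = "{d. d dvd m}"
  have fD: "finite ?D" using assms by simp
  have "(\<Sum>a=1..<m. real (gcd a m) / a) = (\<Sum>a=1..<m. 1 / real (a div gcd a m))"
  proof (rule sum.cong[OF refl])
    fix a assume "a \<in> {1..<m}"
    then have "real (a div gcd a m) = real a / real (gcd a m)" by (intro real_of_nat_div) simp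
    then show "real (gcd a m) / a = 1 / real (a div gcd a m)" by simp
  qed
  also have "\<dots> = (\<Sum>(d, q)\<in>(\<lambda>a. (gcd a m, a div gcd a m)) ` {1..<m}. 1 / real q)"
  proof (subst sum.reindex)
    show "inj_on (\<lambda>a. (gcd a m, a div gcd a m)) {1..<m}"
    proof (rule inj_onI)
      fix a b assume "(gcd a m, a div gcd a m) = (gcd b m, b div gcd b m)"
      then have "a div gcd a m * gcd a m = b div gcd b m * gcd b m" by (metis prod.inject)
      then show "a = b" by (metis dvd_div_mult_self gcd_dvd1)
    qed
  qed simp
  also have "\<dots> \<le> (\<Sum>(d, q)\<in>?D \<times> {1..m}. 1 / real q)"
  proof (intro sum_mono2)
    show "(\<lambda>a. (gcd a m, a div gcd a m)) ` {1..<m} \<subseteq> ?D \<times> {1..m}"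
    proof (rule image_subsetI)
      fix a assume a: "a \<in> {1..<m}"
      have "gcd a m \<le> a" using a by (intro dvd_imp_le) auto
      moreover have "gcd a m > 0" using a by simp
      ultimately have "1 \<le> a div gcd a m" by (simp add: div_greater_zero_iff Suc_le_eq)
      moreover have "a div gcd a m \<le> m" 
        by (rule order_trans[OF div_le_dividend]) (use a in simp)
      ultimately show "(gcd a m, a div gcd a m) \<in> ?D \<times> {1..m}" by simp
    qed
  qed (use fD in auto)
  also have "\<dots> = (\<Sum>d\<in>?D. \<Sum>q=1..m. 1 / real q)" by (rule sum.cartesian_product[symmetric])
  also have "\<dots> = card ?D * (\<Sum>q=1..m. 1 / real q)" by simp
  also have "\<dots> \<le> (2 * sqrt m) * (1 + ln m)"
    using card_divisors_le[OF assms] sum_inverse_le[OF assms] assms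
    by (intro mult_mono) (auto intro: sum_nonneg)
  finally show ?thesis by simp
qed

text \<open>
  Partial fractions: \<open>1 / (a * (m - a)) = (1 / a + 1 / (m - a)) / m\<close>, and \<open>gcd a (m - a) = gcd a m\<close>.
\<close>

lemma gcd_sum_bound:
  assumes "m > 0"
  shows "0 \<le> gcd_sum m" "gcd_sum m \<le> 4 * ((1 + ln m) / sqrt m)"
proof -
  show "0 \<le> gcd_sum m" unfolding gcd_sum_def by (intro sum_nonneg) auto
  have g: "gcd a (m - a) = gcd a m" if "a \<in> {1..<m}" for a
    using gcd_diff1_nat[of a m] that by (simp add: gcd.commute)
  have "gcd_sum m = (\<Sum>a=1..<m. (real (gcd a m) / a + real (gcd (m - a) m) / real (m - a)) / m)"
    unfolding gcd_sum_def
  proof (rule sum.cong[OF refl])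
    fix a assume a: "a \<in> {1..<m}"
    have "gcd (m - a) m = gcd (m - a) (m - (m - a))" using a by (intro g[symmetric]) auto
    also have "m - (m - a) = a" using a by simp
    also have "gcd (m - a) a = gcd a (m - a)" by (rule gcd.commute)
    also have "\<dots> = gcd a m" by (rule g[OF a])
    finally have g2: "gcd (m - a) m = gcd a m" .
    have r: "real (m - a) = real m - real a" using a by simp
    have nz: "real a \<noteq> 0" "real m - real a \<noteq> 0" "real m \<noteq> 0" using a by auto
    show "real (gcd a (m - a)) / (real a * real (m - a)) = (real (gcd a m) / a + real (gcd (m - a) m) / real (m - a)) / m"
      unfolding g[OF a] g2 r using nz by (simp add: field_simps)
  qed
  also have "\<dots> = ((\<Sum>a=1..<m. real (gcd a m) / a) + (\<Sum>a=1..<m. real (gcd (m - a) m) / real (m - a))) / m"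
    by (simp add: sum.distrib flip: sum_divide_distrib)
  also have "(\<Sum>a=1..<m. real (gcd (m - a) m) / real (m - a)) = (\<Sum>a=1..<m. real (gcd a m) / real a)"
    by (rule sum.reindex_bij_witness[of _ "\<lambda>a. m - a" "\<lambda>a. m - a"]) auto
  also have "((\<Sum>a=1..<m. real (gcd a m) / a) + (\<Sum>a=1..<m. real (gcd a m) / real a)) / m \<le>
      (2 * sqrt m * (1 + ln m) + 2 * sqrt m * (1 + ln m)) / m"
    using sum_gcd_over[OF assms] by (intro divide_right_mono add_mono) auto
  also have "\<dots> = 4 * ((1 + ln m) / sqrt m)"
  proof -
    have "sqrt m / m = 1 / sqrt m" using assms by (simp add: field_simps)
    moreover have "(2 * sqrt m * (1 + ln m) + 2 * sqrt m * (1 + ln m)) / m = 4 * (1 + ln m) * (sqrt m / m)" by simp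
    ultimately show ?thesis by (simp only: times_divide_eq_right mult_1_right)
  qed
  finally show "gcd_sum m \<le> 4 * ((1 + ln m) / sqrt m)" .
qed

lemma gcd_sum_tendsto_0: "gcd_sum \<longlonglongrightarrow> 0"
proof (rule tendsto_sandwich[of "\<lambda>_. 0" _ _ "\<lambda>m. 4 * (1 / real m powr (1/2) + ln m / real m powr (1/2))"])
  show "\<forall>\<^sub>F m in sequentially. 0 \<le> gcd_sum m"
    using eventually_gt_at_top[of 0] by eventually_elim (rule gcd_sum_bound)
  show "\<forall>\<^sub>F m in sequentially. gcd_sum m \<le> 4 * (1 / real m powr (1/2) + ln m / real m powr (1/2))"
    using eventually_gt_at_top[of 0]
  proof eventually_elim
    case (elim m) then show ?case using gcd_sum_bound(2)[OF elim] by (simp add: powr_half_sqrt add_divide_distrib)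
  qed
  have "(\<lambda>m. real m powr (- (1/2))) \<longlonglongrightarrow> 0"
    by (intro tendsto_neg_powr filterlim_real_sequentially) auto
  then have "(\<lambda>m. 1 / real m powr (1/2)) \<longlonglongrightarrow> 0" by (simp add: powr_minus_divide)
  moreover have "(\<lambda>m. ln (real m) / real m powr (1/2)) \<longlonglongrightarrow> 0" by (intro lim_ln_over_power) simp
  ultimately have "(\<lambda>m. 4 * (1 / real m powr (1/2) + ln m / real m powr (1/2))) \<longlonglongrightarrow> 4 * (0 + 0)"
    by (intro tendsto_intros)
  then show "(\<lambda>m. 4 * (1 / real m powr (1/2) + ln m / real m powr (1/2))) \<longlonglongrightarrow> 0" by simp
qed simp

section \<open>Weak convergence\<close>

definition ewens_weight :: "real \<Rightarrow> nat \<Rightarrow> (nat \<Rightarrow> nat) \<Rightarrow> real" where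
  "ewens_weight \<theta> n \<sigma> = \<theta> ^ num_cycles n \<sigma> / pochhammer \<theta> n"

lemma ewens_weight_nonneg: "\<theta> > 0 \<Longrightarrow> ewens_weight \<theta> n \<sigma> \<ge> 0"
  using pochhammer_pos[of \<theta> n] by (simp add: ewens_weight_def)

lemma finite_perms [simp]: "finite {\<sigma>. \<sigma> permutes {1..n::nat}}"
  by (rule finite_permutations) simp

lemma ewens_integral:
  fixes f :: "(nat \<Rightarrow> nat) \<Rightarrow> 'b::{banach, second_countable_topology}"
  assumes "\<theta> > 0"
  shows "(\<integral>\<sigma>. f \<sigma> \<partial>ewens \<theta> n) = (\<Sum>\<sigma> | \<sigma> permutes {1..n}. ewens_weight \<theta> n \<sigma> *\<^sub>R f \<sigma>)"
  unfolding ewens_def ewens_weight_def[symmetric]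
  by (rule lebesgue_integral_point_measure_finite[OF finite_perms ewens_weight_nonneg[OF assms]])

lemma ewens_integral_cycles:
  assumes "\<theta> > 0"
  shows "(\<Sum>\<sigma> | \<sigma> permutes {1..n}. ewens_weight \<theta> n \<sigma> * F (perm_cycles n \<sigma>)) = ewens_sum \<theta> n F / pochhammer \<theta> n"
  by (simp add: ewens_sum_def ewens_weight_def sum_divide_distrib)

lemma sum_ewens_weight: "\<theta> > 0 \<Longrightarrow> (\<Sum>\<sigma> | \<sigma> permutes {1..n}. ewens_weight \<theta> n \<sigma>) = 1"
  using ewens_integral_cycles[of \<theta> n "\<lambda>_. 1"] ewens_sum_1[of \<theta> n] pochhammer_pos[of \<theta> n] by simp

lemma prob_space_ewens:
  assumes "\<theta> > 0" shows "prob_space (ewens \<theta> n)"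
  unfolding ewens_def ewens_weight_def[symmetric]
proof (rule prob_space_point_measure[OF finite_perms])
  have "(\<Sum>\<sigma> | \<sigma> permutes {1..n}. ennreal (ewens_weight \<theta> n \<sigma>)) = ennreal (\<Sum>\<sigma> | \<sigma> permutes {1..n}. ewens_weight \<theta> n \<sigma>)"
    using ewens_weight_nonneg[OF assms] by (intro sum_ennreal) auto
  then show "(\<Sum>\<sigma> | \<sigma> permutes {1..n}. ennreal (ewens_weight \<theta> n \<sigma>)) = 1" using sum_ewens_weight[OF assms] by simp
qed auto

lemma measurable_ewens: "f \<in> measurable (ewens \<theta> n) borel"
  by (simp add: ewens_def)

lemma cmod_iexp_diff_le: "cmod (iexp a - iexp b) \<le> \<bar>a - b\<bar>"
proof -
  have "iexp a - iexp b = iexp b * (iexp (a - b) - 1)"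
    by (simp add: algebra_simps flip: exp_add)
  moreover have "cmod (iexp b) = 1" by simp
  moreover have "cmod (iexp (a - b) - 1) \<le> \<bar>a - b\<bar>"
    using iexp_approx1[of "a - b" 0] by simp
  ultimately show ?thesis by (simp add: norm_mult)
qed

text \<open>
  The characteristic functions of \<open>Z n\<close> and \<open>U n\<close> at \<open>t\<close> differ by at most \<open>\<bar>t\<bar>\<close> times the mean of \<open>\<bar>Z n - U n\<bar>\<close>, and Levy's
  continuity theorem applies in both directions.
\<close>

lemma weak_conv_ewens_perturb:
  fixes U Z :: "nat \<Rightarrow> (nat \<Rightarrow> nat) \<Rightarrow> real"
  assumes \<theta>: "\<theta> > 0" and \<mu>: "real_distribution \<mu>"
    and U: "weak_conv_m (\<lambda>n. distr (ewens \<theta> n) borel (U n)) \<mu>"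
    and d: "(\<lambda>n. \<Sum>\<sigma> | \<sigma> permutes {1..n}. ewens_weight \<theta> n \<sigma> * \<bar>Z n \<sigma> - U n \<sigma>\<bar>) \<longlonglongrightarrow> 0"
  shows "weak_conv_m (\<lambda>n. distr (ewens \<theta> n) borel (Z n)) \<mu>"
proof (rule levy_continuity)
  have rd: "real_distribution (distr (ewens \<theta> n) borel (X n))" for X :: "nat \<Rightarrow> (nat \<Rightarrow> nat) \<Rightarrow> real" and n
    by (rule prob_space.real_distribution_distr[OF prob_space_ewens[OF \<theta>] measurable_ewens])
  show "real_distribution (distr (ewens \<theta> n) borel (Z n))" for n by (rule rd)
  show "real_distribution \<mu>" by (rule \<mu>)
  fix t
  have ch: "char (distr (ewens \<theta> n) borel (X n)) t = (\<Sum>\<sigma> | \<sigma> permutes {1..n}. ewens_weight \<theta> n \<sigma> *\<^sub>R iexp (t * X n \<sigma>))"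
    for X :: "nat \<Rightarrow> (nat \<Rightarrow> nat) \<Rightarrow> real" and n
    unfolding char_def by (subst integral_distr[OF measurable_ewens]) (simp_all add: ewens_integral[OF \<theta>])
  have cU: "(\<lambda>n. char (distr (ewens \<theta> n) borel (U n)) t) \<longlonglongrightarrow> char \<mu> t"
    by (rule levy_continuity1[OF rd[where X = U] \<mu> U])
  have "(\<lambda>n. char (distr (ewens \<theta> n) borel (Z n)) t - char (distr (ewens \<theta> n) borel (U n)) t) \<longlonglongrightarrow> 0"
  proof (rule Lim_null_comparison)
    show "\<forall>\<^sub>F n in sequentially. norm (char (distr (ewens \<theta> n) borel (Z n)) t - char (distr (ewens \<theta> n) borel (U n)) t)
      \<le> \<bar>t\<bar> * (\<Sum>\<sigma> | \<sigma> permutes {1..n}. ewens_weight \<theta> n \<sigma> * \<bar>Z n \<sigma> - U n \<sigma>\<bar>)"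
    proof (rule always_eventually, rule allI)
      fix n
      have "norm (char (distr (ewens \<theta> n) borel (Z n)) t - char (distr (ewens \<theta> n) borel (U n)) t) =
        norm (\<Sum>\<sigma> | \<sigma> permutes {1..n}. ewens_weight \<theta> n \<sigma> *\<^sub>R (iexp (t * Z n \<sigma>) - iexp (t * U n \<sigma>)))"
        unfolding ch scaleR_diff_right sum_subtractf ..
      also have "\<dots> \<le> (\<Sum>\<sigma> | \<sigma> permutes {1..n}. norm (ewens_weight \<theta> n \<sigma> *\<^sub>R (iexp (t * Z n \<sigma>) - iexp (t * U n \<sigma>))))"
        by (rule norm_sum)
      also have "\<dots> \<le> (\<Sum>\<sigma> | \<sigma> permutes {1..n}. \<bar>t\<bar> * (ewens_weight \<theta> n \<sigma> * \<bar>Z n \<sigma> - U n \<sigma>\<bar>))"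
      proof (rule sum_mono)
        fix \<sigma>
        have "norm (ewens_weight \<theta> n \<sigma> *\<^sub>R (iexp (t * Z n \<sigma>) - iexp (t * U n \<sigma>))) =
          ewens_weight \<theta> n \<sigma> * cmod (iexp (t * Z n \<sigma>) - iexp (t * U n \<sigma>))"
          using ewens_weight_nonneg[OF \<theta>, of n \<sigma>] by simp
        also have "\<dots> \<le> ewens_weight \<theta> n \<sigma> * \<bar>t * Z n \<sigma> - t * U n \<sigma>\<bar>"
          using cmod_iexp_diff_le ewens_weight_nonneg[OF \<theta>, of n \<sigma>] by (intro mult_left_mono)
        also have "\<bar>t * Z n \<sigma> - t * U n \<sigma>\<bar> = \<bar>t\<bar> * \<bar>Z n \<sigma> - U n \<sigma>\<bar>"
          by (simp only: abs_mult[symmetric] right_diff_distrib)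
        finally show "norm (ewens_weight \<theta> n \<sigma> *\<^sub>R (iexp (t * Z n \<sigma>) - iexp (t * U n \<sigma>))) \<le> \<bar>t\<bar> * (ewens_weight \<theta> n \<sigma> * \<bar>Z n \<sigma> - U n \<sigma>\<bar>)"
          by (simp only: mult_ac)
      qed
      finally show "norm (char (distr (ewens \<theta> n) borel (Z n)) t - char (distr (ewens \<theta> n) borel (U n)) t)
        \<le> \<bar>t\<bar> * (\<Sum>\<sigma> | \<sigma> permutes {1..n}. ewens_weight \<theta> n \<sigma> * \<bar>Z n \<sigma> - U n \<sigma>\<bar>)" by (simp only: sum_distrib_left)
    qed
    show "(\<lambda>n. \<bar>t\<bar> * (\<Sum>\<sigma> | \<sigma> permutes {1..n}. ewens_weight \<theta> n \<sigma> * \<bar>Z n \<sigma> - U n \<sigma>\<bar>)) \<longlonglongrightarrow> 0"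
      using tendsto_mult[OF tendsto_const d, of "\<bar>t\<bar>"] by simp
  qed
  from tendsto_add[OF this cU] show "(\<lambda>n. char (distr (ewens \<theta> n) borel (Z n)) t) \<longlonglongrightarrow> char \<mu> t" by simp
qed

lemma expectation_sum_points:
  assumes "\<theta> > 0"
  shows "(\<Sum>\<sigma> | \<sigma> permutes {1..n}. ewens_weight \<theta> n \<sigma> * (\<Sum>x\<in>{1..n}. g (perm_on.len \<sigma> x))) = n * (\<Sum>j<n. len_prob \<theta> n (Suc j) * g (Suc j))"
proof -
  have "(\<Sum>\<sigma> | \<sigma> permutes {1..n}. ewens_weight \<theta> n \<sigma> * (\<Sum>x\<in>{1..n}. g (perm_on.len \<sigma> x))) =
    (\<Sum>\<sigma> | \<sigma> permutes {1..n}. ewens_weight \<theta> n \<sigma> * (\<lambda>C. \<Sum>c\<in>C. card c * g (card c)) (perm_cycles n \<sigma>))"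
  proof (intro sum.cong refl)
    fix \<sigma> assume "\<sigma> \<in> {\<sigma>. \<sigma> permutes {1..n}}"
    then have s: "\<sigma> permutes {1..n}" by simp
    interpret perm_on n \<sigma> by unfold_locales (rule s)
    show "ewens_weight \<theta> n \<sigma> * (\<Sum>x\<in>{1..n}. g (len x)) = ewens_weight \<theta> n \<sigma> * (\<lambda>C. \<Sum>c\<in>C. card c * g (card c)) (perm_cycles n \<sigma>)"
      using sum_points_cycles[OF s, of "\<lambda>c. g (card c)"] by (simp add: len_def)
  qed
  also have "\<dots> = ewens_cycle_sum \<theta> n (\<lambda>j. j * g j) / pochhammer \<theta> n"
    unfolding ewens_integral_cycles[OF assms] ewens_cycle_sum_def ..
  also have "ewens_cycle_sum \<theta> n (\<lambda>j. j * g j) = (\<Sum>j<n. len_weight \<theta> n (Suc j) * g (Suc j))"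
    unfolding ewens_cycle_sum_formula by (intro sum.cong refl) (simp del: of_nat_Suc)
  also have "(\<Sum>j<n. len_weight \<theta> n (Suc j) * g (Suc j)) / pochhammer \<theta> n = n * (\<Sum>j<n. len_prob \<theta> n (Suc j) * g (Suc j))"
    by (cases "n = 0") (simp_all add: len_prob_def sum_distrib_left sum_divide_distrib)
  finally show ?thesis .
qed

text \<open>
  A pair of cycles of lengths \<open>a\<close> and \<open>b\<close> contains \<open>a * b\<close> pairs of points, and \<open>a * b / lcm a b = gcd a b\<close>.
\<close>

lemma (in perm_on) inv_lcm_sum_cycle_pair_sum: "inv_lcm_sum = cycle_pair_sum (\<lambda>a b. real (gcd a b)) (perm_cycles n \<sigma>)"
proof -
  let ?C = "perm_cycles n \<sigma>"
  note pf = perm_cycles_facts[OF perm]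
  have fC: "finite ?C" by (rule pf(1))
  define r where "r a b = 1 / real (lcm a b)" for a b :: nat
  have inner: "(\<Sum>y\<in>{1..n} - c. r l (len y)) = (\<Sum>d\<in>?C - {c}. card d * r l (card d))" if c: "c \<in> ?C" for c l
  proof -
    have "(\<Sum>y\<in>{1..n} - c. r l (len y)) = (\<Sum>y\<in>{1..n}. if orbit \<sigma> y = c then 0 else r l (card (orbit \<sigma> y)))"
    proof (rule sum.mono_neutral_cong_left)
      show "\<forall>i\<in>{1..n} - ({1..n} - c). (if orbit \<sigma> i = c then 0 else r l (card (orbit \<sigma> i))) = 0"
        using pf(4)[OF c] by auto
      show "r l (len y) = (if orbit \<sigma> y = c then 0 else r l (card (orbit \<sigma> y)))" if y: "y \<in> {1..n} - c" for y
        using pf(3)[of y] y by (auto simp: len_def)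
    qed auto
    also have "\<dots> = (\<Sum>d\<in>?C. card d * (if d = c then 0 else r l (card d)))"
      by (rule sum_points_cycles[OF perm, of "\<lambda>d. if d = c then 0 else r l (card d)"])
    also have "\<dots> = (\<Sum>d\<in>?C - {c}. card d * r l (card d))"
      using fC by (intro sum.mono_neutral_cong_right) auto
    finally show ?thesis .
  qed
  have "inv_lcm_sum = (\<Sum>x\<in>{1..n}. (\<lambda>c. \<Sum>d\<in>?C - {c}. card d * r (card c) (card d)) (orbit \<sigma> x))"
    unfolding inv_lcm_sum_def r_def[symmetric]
  proof (rule sum.cong[OF refl])
    fix x assume "x \<in> {1..n}"
    then have "orbit \<sigma> x \<in> ?C" by (simp add: perm_cycles_def)
    from inner[OF this, of "len x"]
    show "(\<Sum>y\<in>{1..n} - orbit \<sigma> x. r (len x) (len y)) = (\<lambda>c. \<Sum>d\<in>?C - {c}. card d * r (card c) (card d)) (orbit \<sigma> x)"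
      by (simp add: len_def)
  qed
  also have "\<dots> = (\<Sum>c\<in>?C. card c * (\<Sum>d\<in>?C - {c}. card d * r (card c) (card d)))"
    by (rule sum_points_cycles[OF perm])
  also have "\<dots> = cycle_pair_sum (\<lambda>a b. real (gcd a b)) ?C"
    unfolding cycle_pair_sum_def sum_distrib_left
  proof (intro sum.cong refl)
    fix c d assume "c \<in> ?C" "d \<in> ?C - {c}"
    then have pos: "card c > 0" "card d > 0"
      using pf(2)[of c] pf(2)[of d] finite_subset[of c "{1..n}"] finite_subset[of d "{1..n}"] by (auto simp: card_gt_0_iff)
    have eq: "real (card c) * real (card d) = real (gcd (card c) (card d)) * real (lcm (card c) (card d))"
      by (metis of_nat_mult prod_gcd_lcm_nat)
    have "card c * (card d * r (card c) (card d)) = (real (card c) * real (card d)) / real (lcm (card c) (card d))"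
      by (simp add: r_def)
    also have "\<dots> = real (gcd (card c) (card d))" unfolding eq using pos by simp
    finally show "card c * (card d * r (card c) (card d)) = real (gcd (card c) (card d))" .
  qed
  finally show ?thesis .
qed

text \<open>
  Group the pairs of lengths in \<open>ewens_pair_sum_formula\<close> by their sum \<open>m\<close>, on which alone \<open>len_weight\<close> depends.
\<close>

lemma expectation_inv_lcm_sum:
  assumes "\<theta> > 0"
  shows "(\<Sum>\<sigma> | \<sigma> permutes {1..n}. ewens_weight \<theta> n \<sigma> * perm_on.inv_lcm_sum n \<sigma>) = n * (\<theta> * (\<Sum>j<n. len_prob \<theta> n (Suc j) * gcd_sum (Suc j)))"
proof -
  define F where "F a b = \<theta> / (real a * real b) * len_weight \<theta> n (a + b) * real (gcd a b)" for a b
  have "(\<Sum>\<sigma> | \<sigma> permutes {1..n}. ewens_weight \<theta> n \<sigma> * perm_on.inv_lcm_sum n \<sigma>) =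
     (\<Sum>\<sigma> | \<sigma> permutes {1..n}. ewens_weight \<theta> n \<sigma> * cycle_pair_sum (\<lambda>a b. real (gcd a b)) (perm_cycles n \<sigma>))"
    using perm_on.inv_lcm_sum_cycle_pair_sum by (intro sum.cong refl) (simp add: perm_on_def)
  also have "\<dots> = ewens_pair_sum \<theta> n (\<lambda>a b. real (gcd a b)) / pochhammer \<theta> n"
    unfolding ewens_integral_cycles[OF assms] ewens_pair_sum_def ..
  also have "ewens_pair_sum \<theta> n (\<lambda>a b. real (gcd a b)) = (\<Sum>a<n. \<Sum>b<n. F (Suc a) (Suc b))"
    unfolding ewens_pair_sum_formula F_def ..
  also have "\<dots> = (\<Sum>(a, b)\<in>{..<n} \<times> {..<n}. F (Suc a) (Suc b))" by (rule sum.cartesian_product)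
  also have "\<dots> = (\<Sum>(a, b)\<in>{(a, b). a < n \<and> b < n \<and> a + b + 2 \<le> n}. F (Suc a) (Suc b))"
    by (intro sum.mono_neutral_right) (auto simp: F_def len_weight_def split: if_splits)
  also have "\<dots> = (\<Sum>(m, a)\<in>Sigma {..<n} (\<lambda>m. {1..<Suc m}). F a (Suc m - a))"
    by (rule sum.reindex_bij_witness[of _ "\<lambda>(m, a). (a - 1, m - a)" "\<lambda>(a, b). (a + b + 1, a + 1)"])
       (auto simp: Suc_diff_le)
  also have "\<dots> = (\<Sum>m<n. \<Sum>a=1..<Suc m. F a (Suc m - a))"
    by (rule sum.Sigma[symmetric]) auto
  also have "\<dots> = (\<Sum>m<n. \<theta> * (len_weight \<theta> n (Suc m) * gcd_sum (Suc m)))"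
    unfolding gcd_sum_def sum_distrib_left by (intro sum.cong refl) (auto simp: F_def)
  also have "\<dots> / pochhammer \<theta> n = n * (\<theta> * (\<Sum>j<n. len_prob \<theta> n (Suc j) * gcd_sum (Suc j)))"
    by (cases "n = 0") (simp_all add: len_prob_def sum_distrib_left sum_divide_distrib mult_ac)
  finally show ?thesis .
qed

definition mean_error :: "real \<Rightarrow> nat \<Rightarrow> real" where
  "mean_error \<theta> n = (\<Sum>\<sigma> | \<sigma> permutes {1..n}. ewens_weight \<theta> n \<sigma> * (perm_on.inv_len_sum n \<sigma> + perm_on.inv_lcm_sum n \<sigma>))"

lemma mean_error_over_n_tendsto_0:
  assumes "\<theta> > 0" shows "(\<lambda>n. mean_error \<theta> n / n) \<longlonglongrightarrow> 0"
proof -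
  let ?R = "\<lambda>n. (\<Sum>j<n. len_prob \<theta> n (Suc j) * (1 / real (Suc j))) + \<theta> * (\<Sum>j<n. len_prob \<theta> n (Suc j) * gcd_sum (Suc j))"
  have eq: "mean_error \<theta> n = n * ?R n" for n
  proof -
    have "mean_error \<theta> n = (\<Sum>\<sigma> | \<sigma> permutes {1..n}. ewens_weight \<theta> n \<sigma> * (\<Sum>x\<in>{1..n}. (\<lambda>j. 1 / real j) (perm_on.len \<sigma> x))) +
       (\<Sum>\<sigma> | \<sigma> permutes {1..n}. ewens_weight \<theta> n \<sigma> * perm_on.inv_lcm_sum n \<sigma>)"
      unfolding mean_error_def distrib_left sum.distrib
      by (intro arg_cong2[where f = "(+)"] sum.cong refl) (simp add: perm_on.inv_len_sum_def perm_on_def)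
    also have "\<dots> = n * (\<Sum>j<n. len_prob \<theta> n (Suc j) * (1 / real (Suc j))) + n * (\<theta> * (\<Sum>j<n. len_prob \<theta> n (Suc j) * gcd_sum (Suc j)))"
      by (rule arg_cong2[where f = "(+)", OF expectation_sum_points[OF assms] expectation_inv_lcm_sum[OF assms]])
    finally show ?thesis by (simp only: distrib_left)
  qed
  have "(\<lambda>n. 1 / real n) \<longlonglongrightarrow> 0" by (rule lim_1_over_n)
  then have "?R \<longlonglongrightarrow> 0 + \<theta> * 0"
    using len_prob_average_tendsto_0[OF assms, of "\<lambda>j. 1 / real j"] len_prob_average_tendsto_0[OF assms gcd_sum_tendsto_0]
    by (intro tendsto_intros)
  then have R: "?R \<longlonglongrightarrow> 0" by simp
  show ?thesis
    by (rule Lim_transform_eventually[OF R], use eventually_gt_at_top[of 0] in eventually_elim) (simp add: eq)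
qed

definition mean_Y :: "real \<Rightarrow> real \<Rightarrow> real \<Rightarrow> nat \<Rightarrow> nat \<Rightarrow> real" where
  "mean_Y \<theta> \<alpha> \<beta> m n = (\<Sum>\<sigma> | \<sigma> permutes {1..n}. ewens_weight \<theta> n \<sigma> * Y \<alpha> \<beta> n (Suc (Suc m)) \<sigma>)"

text \<open>
  In \<open>frac (j * \<alpha>) - frac (j * \<beta>)\<close> both terms average to \<open>1/2\<close> against slowly varying weights, so that the difference averages to
  \<open>0\<close>.
\<close>

lemma mean_Y_tendsto_0:
  assumes \<theta>: "\<theta> > 0" and ab: "\<alpha> \<notin> \<rat>" "\<beta> \<notin> \<rat>"
  shows "mean_Y \<theta> \<alpha> \<beta> m \<longlonglongrightarrow> 0"
proof -
  let ?S = "\<lambda>(\<gamma>::real) n. \<Sum>j<n. len_prob \<theta> n (Suc j) * ((real (Suc j) / n) ^ m * (frac (real (Suc j) * \<gamma>) - 1 / 2))"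
  have "(\<lambda>n. ?S \<alpha> n - ?S \<beta> n) \<longlonglongrightarrow> 0 - 0"
    by (intro tendsto_diff len_prob_equidistribution \<theta> ab)
  moreover have "mean_Y \<theta> \<alpha> \<beta> m n = ?S \<alpha> n - ?S \<beta> n" if n: "n > 0" for n
  proof -
    have "mean_Y \<theta> \<alpha> \<beta> m n = (\<Sum>\<sigma> | \<sigma> permutes {1..n}. ewens_weight \<theta> n \<sigma> *
        (\<Sum>x\<in>{1..n}. (\<lambda>j. real j ^ m * frac_diff \<alpha> \<beta> j) (perm_on.len \<sigma> x))) / real n ^ Suc m"
      unfolding mean_Y_def sum_divide_distrib
      by (intro sum.cong refl) (simp add: perm_on.Y_eq[unfolded perm_on_def] del: power_Suc)
    also have "\<dots> = n * (\<Sum>j<n. len_prob \<theta> n (Suc j) * (real (Suc j) ^ m * frac_diff \<alpha> \<beta> (Suc j))) / real n ^ Suc m"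
      by (rule arg_cong[where f = "\<lambda>x. x / real n ^ Suc m", OF expectation_sum_points[OF \<theta>]])
    also have "\<dots> = (\<Sum>j<n. len_prob \<theta> n (Suc j) * (real (Suc j) ^ m * frac_diff \<alpha> \<beta> (Suc j))) / real n ^ m"
      using n by simp
    also have "\<dots> = ?S \<alpha> n - ?S \<beta> n"
      unfolding sum_divide_distrib sum_subtractf[symmetric]
      by (intro sum.cong refl) (simp add: frac_diff_def power_divide algebra_simps diff_divide_distrib del: of_nat_Suc)
    finally show ?thesis .
  qed
  ultimately show ?thesis
    by (intro Lim_transform_eventually[of "\<lambda>n. ?S \<alpha> n - ?S \<beta> n" 0 _ "mean_Y \<theta> \<alpha> \<beta> m"])
       (auto intro!: eventually_mono[OF eventually_gt_at_top[of 0]])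
qed

text \<open>
  If \<open>Z n\<close> equals a constant \<open>c n\<close> plus \<open>n^(m+1) Y\<close> up to an error whose mean absolute value is \<open>o(n^(m+1))\<close>, then centring \<open>Z n\<close> removes \<open>c n\<close> together
  with the means of \<open>Y\<close> and of the error, both of which are negligible after normalisation.
\<close>

lemma weak_conv_centred:
  fixes Z :: "nat \<Rightarrow> (nat \<Rightarrow> nat) \<Rightarrow> real" and c :: "nat \<Rightarrow> real"
  assumes \<theta>: "\<theta> > 0" and \<alpha>: "\<alpha> \<notin> \<rat>" and \<beta>: "\<beta> \<notin> \<rat>" and \<mu>: "real_distribution \<mu>"
    and Y: "weak_conv_m (\<lambda>n. distr (ewens \<theta> n) borel (Y \<alpha> \<beta> n (Suc (Suc m)))) \<mu>"
    and B: "B \<ge> 0"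
    and cmp: "\<And>n \<sigma>. n > Suc (Suc m) \<Longrightarrow> \<sigma> permutes {1..n} \<Longrightarrow>
      \<bar>Z n \<sigma> - c n - real n ^ Suc m * Y \<alpha> \<beta> n (Suc (Suc m)) \<sigma>\<bar> \<le> B * real n ^ m * (perm_on.inv_len_sum n \<sigma> + perm_on.inv_lcm_sum n \<sigma>)"
  shows "weak_conv_m (\<lambda>n. distr (ewens \<theta> n) borel (\<lambda>\<sigma>. (Z n \<sigma> - (\<integral>\<tau>. Z n \<tau> \<partial>ewens \<theta> n)) / real n ^ Suc m)) \<mu>"
proof (rule weak_conv_ewens_perturb[OF \<theta> \<mu> Y], rule Lim_null_comparison)
  let ?P = "\<lambda>n. {\<sigma>. \<sigma> permutes {1..n::nat}}"
  let ?Y = "\<lambda>n. Y \<alpha> \<beta> n (Suc (Suc m))"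
  let ?D = "\<lambda>n \<sigma>. (Z n \<sigma> - (\<integral>\<tau>. Z n \<tau> \<partial>ewens \<theta> n)) / real n ^ Suc m - ?Y n \<sigma>"
  show "(\<lambda>n. 2 * (B * (mean_error \<theta> n / n)) + \<bar>mean_Y \<theta> \<alpha> \<beta> m n\<bar>) \<longlonglongrightarrow> 0"
  proof -
    have "(\<lambda>n. 2 * (B * (mean_error \<theta> n / n)) + \<bar>mean_Y \<theta> \<alpha> \<beta> m n\<bar>) \<longlonglongrightarrow> 2 * (B * 0) + \<bar>0\<bar>"
      by (intro tendsto_intros mean_error_over_n_tendsto_0[OF \<theta>] mean_Y_tendsto_0[OF \<theta> \<alpha> \<beta>])
    then show ?thesis by simp
  qed
  show "\<forall>\<^sub>F n in sequentially. norm (\<Sum>\<sigma>\<in>?P n. ewens_weight \<theta> n \<sigma> * \<bar>?D n \<sigma>\<bar>) \<le> 2 * (B * (mean_error \<theta> n / n)) + \<bar>mean_Y \<theta> \<alpha> \<beta> m n\<bar>"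
    using eventually_gt_at_top[of "Suc (Suc m)"]
  proof eventually_elim
    case (elim n)
    then have n: "real n > 0" by simp
    \<comment> \<open>the normalised error; \<open>Ee\<close> below is its mean\<close>
    define e where "e \<sigma> = (Z n \<sigma> - c n) / real n ^ Suc m - ?Y n \<sigma>" for \<sigma>
    define Ee where "Ee = (\<Sum>\<sigma>\<in>?P n. ewens_weight \<theta> n \<sigma> * e \<sigma>)"
    have w0: "0 \<le> ewens_weight \<theta> n \<sigma>" for \<sigma> by (rule ewens_weight_nonneg[OF \<theta>])
    have e: "\<bar>e \<sigma>\<bar> \<le> B / n * (perm_on.inv_len_sum n \<sigma> + perm_on.inv_lcm_sum n \<sigma>)" if s: "\<sigma> \<in> ?P n" for \<sigma>
    proof -
      have "e \<sigma> = (Z n \<sigma> - c n - real n ^ Suc m * ?Y n \<sigma>) / real n ^ Suc m"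
        using n by (simp add: e_def diff_divide_distrib)
      then have "\<bar>e \<sigma>\<bar> \<le> (B * real n ^ m * (perm_on.inv_len_sum n \<sigma> + perm_on.inv_lcm_sum n \<sigma>)) / real n ^ Suc m"
        using cmp[OF elim, of \<sigma>] s n by (simp add: abs_divide divide_right_mono del: power_Suc)
      also have "\<dots> = B / n * (perm_on.inv_len_sum n \<sigma> + perm_on.inv_lcm_sum n \<sigma>)" using n by simp
      finally show ?thesis .
    qed
    have abs_e: "(\<Sum>\<sigma>\<in>?P n. ewens_weight \<theta> n \<sigma> * \<bar>e \<sigma>\<bar>) \<le> B * (mean_error \<theta> n / n)"
    proof -
      have "(\<Sum>\<sigma>\<in>?P n. ewens_weight \<theta> n \<sigma> * \<bar>e \<sigma>\<bar>) \<le> (\<Sum>\<sigma>\<in>?P n. ewens_weight \<theta> n \<sigma> * (B / n * (perm_on.inv_len_sum n \<sigma> + perm_on.inv_lcm_sum n \<sigma>)))"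
        using e w0 by (intro sum_mono mult_left_mono) auto
      also have "\<dots> = B / n * mean_error \<theta> n" by (simp only: mean_error_def sum_distrib_left mult.left_commute)
      finally show ?thesis by simp
    qed
    have Ee: "\<bar>Ee\<bar> \<le> B * (mean_error \<theta> n / n)"
    proof -
      have "\<bar>Ee\<bar> \<le> (\<Sum>\<sigma>\<in>?P n. \<bar>ewens_weight \<theta> n \<sigma> * e \<sigma>\<bar>)" unfolding Ee_def by (rule sum_abs)
      also have "\<dots> = (\<Sum>\<sigma>\<in>?P n. ewens_weight \<theta> n \<sigma> * \<bar>e \<sigma>\<bar>)" using w0 by (simp add: abs_mult)
      finally show ?thesis using abs_e by simp
    qed
    have D: "?D n \<sigma> = e \<sigma> - Ee - mean_Y \<theta> \<alpha> \<beta> m n" for \<sigma>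
    proof -
      have "Z n \<tau> = c n + real n ^ Suc m * (e \<tau> + ?Y n \<tau>)" for \<tau>
        using n by (simp add: e_def)
      then have "(\<integral>\<tau>. Z n \<tau> \<partial>ewens \<theta> n) = (\<Sum>\<tau>\<in>?P n. ewens_weight \<theta> n \<tau> * (c n + real n ^ Suc m * (e \<tau> + ?Y n \<tau>)))"
        by (simp add: ewens_integral[OF \<theta>])
      also have "\<dots> = (\<Sum>\<tau>\<in>?P n. c n * ewens_weight \<theta> n \<tau> + real n ^ Suc m * (ewens_weight \<theta> n \<tau> * e \<tau>) + real n ^ Suc m * (ewens_weight \<theta> n \<tau> * ?Y n \<tau>))"
        by (intro sum.cong refl) (simp add: algebra_simps)
      also have "\<dots> = c n * (\<Sum>\<tau>\<in>?P n. ewens_weight \<theta> n \<tau>) + real n ^ Suc m * Ee + real n ^ Suc m * mean_Y \<theta> \<alpha> \<beta> m n"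
        unfolding sum.distrib sum_distrib_left[symmetric] Ee_def mean_Y_def ..
      finally have I: "(\<integral>\<tau>. Z n \<tau> \<partial>ewens \<theta> n) = c n + real n ^ Suc m * Ee + real n ^ Suc m * mean_Y \<theta> \<alpha> \<beta> m n"
        using sum_ewens_weight[OF \<theta>, of n] by simp
      show ?thesis unfolding I e_def using n by (simp add: field_simps)
    qed
    have "(\<Sum>\<sigma>\<in>?P n. ewens_weight \<theta> n \<sigma> * \<bar>?D n \<sigma>\<bar>) \<le> (\<Sum>\<sigma>\<in>?P n. ewens_weight \<theta> n \<sigma> * \<bar>e \<sigma>\<bar> + ewens_weight \<theta> n \<sigma> * (\<bar>Ee\<bar> + \<bar>mean_Y \<theta> \<alpha> \<beta> m n\<bar>))"
    proof (rule sum_mono)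
      fix \<sigma>
      have "\<bar>?D n \<sigma>\<bar> \<le> \<bar>e \<sigma>\<bar> + (\<bar>Ee\<bar> + \<bar>mean_Y \<theta> \<alpha> \<beta> m n\<bar>)" unfolding D by linarith
      then have "ewens_weight \<theta> n \<sigma> * \<bar>?D n \<sigma>\<bar> \<le> ewens_weight \<theta> n \<sigma> * (\<bar>e \<sigma>\<bar> + (\<bar>Ee\<bar> + \<bar>mean_Y \<theta> \<alpha> \<beta> m n\<bar>))"
        using w0 by (intro mult_left_mono)
      then show "ewens_weight \<theta> n \<sigma> * \<bar>?D n \<sigma>\<bar> \<le> ewens_weight \<theta> n \<sigma> * \<bar>e \<sigma>\<bar> + ewens_weight \<theta> n \<sigma> * (\<bar>Ee\<bar> + \<bar>mean_Y \<theta> \<alpha> \<beta> m n\<bar>)"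
        unfolding distrib_left[of "ewens_weight \<theta> n \<sigma>" "\<bar>e \<sigma>\<bar>"] .
    qed
    also have "\<dots> = (\<Sum>\<sigma>\<in>?P n. ewens_weight \<theta> n \<sigma> * \<bar>e \<sigma>\<bar>) + (\<bar>Ee\<bar> + \<bar>mean_Y \<theta> \<alpha> \<beta> m n\<bar>)"
      unfolding sum.distrib sum_distrib_right[symmetric] sum_ewens_weight[OF \<theta>] mult_1 ..
    also have "\<dots> \<le> 2 * (B * (mean_error \<theta> n / n)) + \<bar>mean_Y \<theta> \<alpha> \<beta> m n\<bar>" using abs_e Ee by linarith
    finally have "(\<Sum>\<sigma>\<in>?P n. ewens_weight \<theta> n \<sigma> * \<bar>?D n \<sigma>\<bar>) \<le> 2 * (B * (mean_error \<theta> n / n)) + \<bar>mean_Y \<theta> \<alpha> \<beta> m n\<bar>" .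
    moreover have "0 \<le> (\<Sum>\<sigma>\<in>?P n. ewens_weight \<theta> n \<sigma> * \<bar>?D n \<sigma>\<bar>)" using w0 by (intro sum_nonneg mult_nonneg_nonneg) auto
    ultimately show ?case by (simp only: real_norm_def abs_of_nonneg)
  qed
qed

lemma (in perm_on) inv_len_sum_inv_lcm_sum_nonneg: "0 \<le> inv_len_sum" "0 \<le> inv_lcm_sum"
proof -
  show "0 \<le> inv_len_sum" unfolding inv_len_sum_def by (intro sum_nonneg) simp
  show "0 \<le> inv_lcm_sum" unfolding inv_lcm_sum_def by (intro sum_nonneg) simp
qed

lemma (in perm_on) pair_error_le:
  "pair_error m \<le> (real m + 2) ^ 2 * (1 + real (fact (m + 2))) * (real n ^ m * (inv_len_sum + inv_lcm_sum))"
proof -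
  have "(1 + real (fact (m + 2))) * inv_len_sum + inv_lcm_sum \<le> (1 + real (fact (m + 2))) * (inv_len_sum + inv_lcm_sum)"
  proof -
    have "inv_lcm_sum \<le> (1 + real (fact (m + 2))) * inv_lcm_sum" using inv_len_sum_inv_lcm_sum_nonneg(2) by (simp add: distrib_right del: fact_Suc)
    then show ?thesis by (simp only: distrib_left)
  qed
  then have "(real m + 2) ^ 2 * real n ^ m * ((1 + real (fact (m + 2))) * inv_len_sum + inv_lcm_sum) \<le>
    (real m + 2) ^ 2 * real n ^ m * ((1 + real (fact (m + 2))) * (inv_len_sum + inv_lcm_sum))" by (intro mult_left_mono) auto
  then show ?thesis unfolding pair_error_def by (simp only: mult_ac)
qed

lemma (in perm_on) comparison_Y:
  assumes X: "\<bar>Z - S\<bar> \<le> a * pair_error m + b * ((real m + 2) * (real n ^ m * inv_len_sum))" and S: "S = (\<Sum>x\<in>{1..n}. real (len x) ^ m * frac_diff \<alpha> \<beta> (len x))"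
    and ab: "a \<ge> 0" "b \<ge> 0" and n: "n > 0"
  shows "\<bar>Z - real n ^ Suc m * Y \<alpha> \<beta> n (Suc (Suc m)) \<sigma>\<bar> \<le>
    (a * ((real m + 2) ^ 2 * (1 + real (fact (m + 2)))) + b * (real m + 2)) * real n ^ m * (inv_len_sum + inv_lcm_sum)"
proof -
  have "real n ^ Suc m * Y \<alpha> \<beta> n (Suc (Suc m)) \<sigma> = S" unfolding Y_eq S using n by simp
  moreover have "a * pair_error m \<le> a * ((real m + 2) ^ 2 * (1 + real (fact (m + 2))) * (real n ^ m * (inv_len_sum + inv_lcm_sum)))"
    using pair_error_le ab by (intro mult_left_mono)
  moreover have "b * ((real m + 2) * (real n ^ m * inv_len_sum)) \<le> b * ((real m + 2) * (real n ^ m * (inv_len_sum + inv_lcm_sum)))"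
    using inv_len_sum_inv_lcm_sum_nonneg ab by (intro mult_left_mono) auto
  ultimately have "\<bar>Z - real n ^ Suc m * Y \<alpha> \<beta> n (Suc (Suc m)) \<sigma>\<bar> \<le>
    a * ((real m + 2) ^ 2 * (1 + real (fact (m + 2))) * (real n ^ m * (inv_len_sum + inv_lcm_sum))) +
    b * ((real m + 2) * (real n ^ m * (inv_len_sum + inv_lcm_sum)))" using X by linarith
  also have "\<dots> = (a * ((real m + 2) ^ 2 * (1 + real (fact (m + 2)))) + b * (real m + 2)) * real n ^ m * (inv_len_sum + inv_lcm_sum)"
    by (simp only: distrib_right mult.assoc)
  finally show ?thesis .
qed

theorem theorem1p1:
  fixes k :: nat and \<theta> \<alpha> \<beta> :: real and \<mu> :: "real measure"
  assumes "k > 1" and "\<theta> > 0"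
    and "0 < \<alpha>" and "\<alpha> < \<beta>" and "\<beta> < 1"
    and "\<alpha> \<notin> \<rat>" and "\<beta> \<notin> \<rat>"
    and "real_over_rat.independent {\<alpha>, \<beta>}"
    and "real_distribution \<mu>"
    and "weak_conv_m (\<lambda>n. distr (ewens \<theta> n) borel (Y \<alpha> \<beta> n k)) \<mu>"
  shows "weak_conv_m (\<lambda>n. distr (ewens \<theta> n) borel (Y_tuple \<theta> \<alpha> \<beta> n k)) \<mu> \<and>
         weak_conv_m (\<lambda>n. distr (ewens \<theta> n) borel (Y_set \<theta> \<alpha> \<beta> n k)) \<mu> \<and>
         weak_conv_m (\<lambda>n. distr (ewens \<theta> n) borel (Y_irrep \<theta> \<alpha> \<beta> n k)) \<mu>"
proof -
  \<comment> \<open>\<open>m = k - 2\<close>, which avoids truncated subtraction in the exponents\<close>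
  obtain m where k: "k = Suc (Suc m)" using less_imp_Suc_add[OF assms(1)] by auto
  note ab = assms(3-5,7)
  note conv = weak_conv_centred[OF assms(2,6,7,9) assms(10)[unfolded k]]
  let ?g = "(real m + 2) ^ 2 * (1 + real (fact (m + 2)))"
  let ?f = "fact (Suc (Suc m)) :: real"
  have f0: "?f \<ge> 0" by (rule fact_ge_zero)
  have tup: "weak_conv_m (\<lambda>n. distr (ewens \<theta> n) borel (Y_tuple \<theta> \<alpha> \<beta> n k)) \<mu>"
  proof -
    have cmp: "\<bar>X_tuple \<alpha> \<beta> n k \<sigma> - (\<beta> - \<alpha>) * card (tuples n k) - real n ^ Suc m * Y \<alpha> \<beta> n (Suc (Suc m)) \<sigma>\<bar> \<le>
        (2 * ?g + 0 * (real m + 2)) * real n ^ m * (perm_on.inv_len_sum n \<sigma> + perm_on.inv_lcm_sum n \<sigma>)"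
      if n: "n > Suc (Suc m)" and s: "\<sigma> permutes {1..n}" for n \<sigma>
    proof -
      interpret perm_on n \<sigma> by unfold_locales (rule s)
      show ?thesis unfolding k
        by (rule comparison_Y[OF _ refl]) (use X_tuple_comparison[OF ab, of m] n in simp_all)
    qed
    show ?thesis unfolding Y_tuple_def k diff_Suc_1
      by (rule conv[OF _ cmp[unfolded k]]) (auto simp del: fact_Suc)
  qed
  have st: "weak_conv_m (\<lambda>n. distr (ewens \<theta> n) borel (Y_set \<theta> \<alpha> \<beta> n k)) \<mu>"
  proof -
    have cmp: "\<bar>?f * X_set \<alpha> \<beta> n k \<sigma> - ?f * ((\<beta> - \<alpha>) * card (ksubsets n k)) - real n ^ Suc m * Y \<alpha> \<beta> n (Suc (Suc m)) \<sigma>\<bar> \<le>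
        ((?f + 1) * ?g + 0 * (real m + 2)) * real n ^ m * (perm_on.inv_len_sum n \<sigma> + perm_on.inv_lcm_sum n \<sigma>)"
      if n: "n > Suc (Suc m)" and s: "\<sigma> permutes {1..n}" for n \<sigma>
    proof -
      interpret perm_on n \<sigma> by unfold_locales (rule s)
      show ?thesis unfolding k right_diff_distrib[symmetric]
        by (rule comparison_Y[OF _ refl]) (use X_set_comparison[OF ab, of m] f0 n in \<open>simp_all del: fact_Suc\<close>)
    qed
    have Y: "Y_set \<theta> \<alpha> \<beta> n k = (\<lambda>\<sigma>. (?f * X_set \<alpha> \<beta> n k \<sigma> - (\<integral>\<tau>. ?f * X_set \<alpha> \<beta> n k \<tau> \<partial>ewens \<theta> n)) / real n ^ Suc m)" for n
      unfolding Y_set_def k diff_Suc_1 by (rule ext) (simp add: right_diff_distrib del: fact_Suc power_Suc)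
    show ?thesis unfolding Y unfolding k
      by (rule conv[OF _ cmp[unfolded k]]) (use f0 in \<open>auto simp del: fact_Suc intro!: mult_nonneg_nonneg add_nonneg_nonneg\<close>)
  qed
  have ir: "weak_conv_m (\<lambda>n. distr (ewens \<theta> n) borel (Y_irrep \<theta> \<alpha> \<beta> n k)) \<mu>"
  proof -
    have cmp: "\<bar>?f * X_irrep \<alpha> \<beta> n k \<sigma> - ?f * ker_const (\<beta> - \<alpha>) n k - real n ^ Suc m * Y \<alpha> \<beta> n (Suc (Suc m)) \<sigma>\<bar> \<le>
        ((?f + 1) * ?g + ?f * (real m + 2)) * real n ^ m * (perm_on.inv_len_sum n \<sigma> + perm_on.inv_lcm_sum n \<sigma>)"
      if n: "n > Suc (Suc m)" and s: "\<sigma> permutes {1..n}" for n \<sigma>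
    proof -
      interpret perm_on n \<sigma> by unfold_locales (rule s)
      show ?thesis unfolding k right_diff_distrib[symmetric]
        by (rule comparison_Y[OF X_irrep_comparison[OF ab n] refl]) (use f0 n in \<open>simp_all del: fact_Suc\<close>)
    qed
    have Y: "Y_irrep \<theta> \<alpha> \<beta> n k = (\<lambda>\<sigma>. (?f * X_irrep \<alpha> \<beta> n k \<sigma> - (\<integral>\<tau>. ?f * X_irrep \<alpha> \<beta> n k \<tau> \<partial>ewens \<theta> n)) / real n ^ Suc m)" for n
      unfolding Y_irrep_def k diff_Suc_1 by (rule ext) (simp add: right_diff_distrib del: fact_Suc power_Suc)
    show ?thesis unfolding Y unfolding k
      by (rule conv[OF _ cmp[unfolded k]]) (use f0 in \<open>auto simp del: fact_Suc intro!: mult_nonneg_nonneg add_nonneg_nonneg\<close>)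
  qed
  show ?thesis using tup st ir by blast
qed

end
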